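(* Let $p$ be a prime, let $n, m, k$ be nonnegative integers, let $M = \mathbb{Z}/p^n\mathbb{Z} \times (\mathbb{Z}/p\mathbb{Z})^m \times (\mathbb{Z}/p^2\mathbb{Z})^k$, and let $H$ be a (not necessarily finite) group on which $M$ acts. Then the number of crossed homomorphisms $M \to H$ is divisible by $\gcd(H, |M|)$.
   Context: All group actions are right actions; a group $M$ acts on a group $H$ by automorphisms, and the image of $h\in H$ under $a\in M$ is written $h^a$. A map $\alpha\colon M\to H$ is a crossed homomorphism if $\alpha(ab)=\alpha(a)^b\,\alpha(b)$ for all $a,b\in M$. For a group $G$ and a positive integer $n$, $\gcd(G,n)$ denotes the least common multiple of the set $\{|K| : K \text{ is a subgroup of } G \text{ and } |K| \text{ divides } n\}$ (for finite $G$ this equals the ordinary $\gcd(|G|,n)$). Finiteness of groups is not assumed unless stated. Divisibility is understood in the sense of cardinal arithmetic: an infinite cardinal is divisible by all nonzero cardinals not exceeding it, zero is divisible by all cardinals, and for finite cardinals divisibility is the usual one. *)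

theory Defs
  imports
    "HOL-Algebra.Elementary_Groups"
    "HOL-Algebra.Product_Groups"
    "HOL-Computational_Algebra.Primes"
    "HOL-Library.Equipollence"
begin

text \<open>\<open>act h a\<close> is the image $h^a$ of \<open>h\<close> under \<open>a\<close>.\<close>

definition right_action_by_automorphisms ::
    "('a, 'c) monoid_scheme \<Rightarrow> ('b, 'd) monoid_scheme \<Rightarrow> ('b \<Rightarrow> 'a \<Rightarrow> 'b) \<Rightarrow> bool" where
  "right_action_by_automorphisms M H act \<longleftrightarrow>
     (\<forall>a\<in>carrier M. (\<lambda>h. act h a) \<in> iso H H) \<and>
     (\<forall>h\<in>carrier H. act h \<one>\<^bsub>M\<^esub> = h) \<and>
     (\<forall>h\<in>carrier H. \<forall>a\<in>carrier M. \<forall>b\<in>carrier M. act h (a \<otimes>\<^bsub>M\<^esub> b) = act (act h a) b)"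

text \<open>Maps are taken extensional (\<open>undefined\<close> outside the carrier of \<open>M\<close>), so that each
  crossed homomorphism is counted exactly once.\<close>

definition crossed_homs ::
    "('a, 'c) monoid_scheme \<Rightarrow> ('b, 'd) monoid_scheme \<Rightarrow> ('b \<Rightarrow> 'a \<Rightarrow> 'b) \<Rightarrow> ('a \<Rightarrow> 'b) set" where
  "crossed_homs M H act =
     {\<alpha> \<in> carrier M \<rightarrow>\<^sub>E carrier H.
        \<forall>a\<in>carrier M. \<forall>b\<in>carrier M. \<alpha> (a \<otimes>\<^bsub>M\<^esub> b) = act (\<alpha> a) b \<otimes>\<^bsub>H\<^esub> \<alpha> b}"

text \<open>Meant for \<open>n > 0\<close>, where only finite subgroups can have order dividing \<open>n\<close>. Finiteness
  is stated explicitly because \<open>card\<close> of an infinite set is 0.\<close>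

definition group_gcd :: "('a, 'c) monoid_scheme \<Rightarrow> nat \<Rightarrow> nat" where
  "group_gcd G n = Lcm {card K | K. subgroup K G \<and> finite K \<and> card K dvd n}"

text \<open>Divisibility of cardinals, each represented by a set of that cardinality: the cardinality
  of \<open>A\<close> divides the cardinality of \<open>B\<close>.\<close>

definition cardinality_dvd :: "'a set \<Rightarrow> 'b set \<Rightarrow> bool" where
  "cardinality_dvd A B \<longleftrightarrow>
     (if infinite B then A \<noteq> {} \<and> A \<lesssim> B
      else B = {} \<or> (finite A \<and> card A dvd card B))"

definition pgroup_M :: "nat \<Rightarrow> nat \<Rightarrow> nat \<Rightarrow> nat \<Rightarrow> (int \<times> (nat \<Rightarrow> int) \<times> (nat \<Rightarrow> int)) monoid" where
  "pgroup_M p n m k =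
     integer_mod_group (p ^ n) \<times>\<times>
     (product_group {..<m} (\<lambda>_. integer_mod_group p) \<times>\<times>
      product_group {..<k} (\<lambda>_. integer_mod_group (p ^ 2)))"

end

(*
  A crossed homomorphism from M to H is a complement of H in the semidirect product of H by M, that
  is, a tuple of commuting elements x_i in prescribed cosets of H with x_i^(q_i) = 1, where M is the
  product of cyclic groups of orders q_i. Such tuples are counted by splitting off the factors of
  order p and p^2 one at a time; what remains is a single cyclic factor, the theorem of P. Hall.

  In a finite p-group an entry x of order dividing q is grouped with its conjugates under H and its
  translates by central elements of H. If the centre supplies q translates this suffices. Otherwise
  q = p^2 and the centre has order p, and the only bad x are those that act trivially on H modulo the
  centre. They are compared with the count in which the condition x^q = 1 is dropped, which is
  divisible by |H| by the class equation: among the bad x the value of x^q is constant.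

  A finite group is reduced to p-groups by letting the tuples act on powers of the set of Sylow
  cosets. If H is infinite but the number of tuples is finite, their entries form a finite normal set
  of torsion elements, which generates a finite group by Dietzmann's lemma.
*)
theory Submission
  imports Defs "HOL-Algebra.Sylow" "HOL-Algebra.Zassenhaus" "HOL-Number_Theory.Residues"
begin

section \<open>Actions of finite groups\<close>

text \<open>The size of the available translations shapes the proof. An entry \<open>x\<close> may
  be replaced by \<open>x \<otimes> z\<close> only if neither the power condition nor the set of
  completions of \<open>x\<close> changes. The latter is guaranteed when \<open>z\<close> commutes
  with all candidates for the later entries, and such central elements may form a group of order
  only \<open>p\<close>. That is why the factors split off have order \<open>p\<close> or
  \<open>p\<^sup>2\<close>. For the last factor nothing is left to complete: \<open>z\<close> may
  then run through a larger, noncentral subgroup that does not affect the powers in question, and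
  any order \<open>p ^ n\<close> is allowed.

  Completions of \<open>x\<close> live in the centralizer of \<open>x\<close>, so induction gives
  divisibility of their number by the gcd of \<open>card (H \<inter> cent G x)\<close> and the
  product of the remaining orders. If this gcd is the order of the centralizer, the orbit of
  \<open>x\<close> under \<open>H\<close> supplies the missing index. If it is the product of the
  remaining orders, a single factor \<open>q\<close> has to be gained, and translations are needed
  only there.

  For bad \<open>x\<close> the powers are compared by the class two formula. Its commutator exponent
  \<open>p\<^sup>2 * (p\<^sup>2 - 1) / 2\<close> is a multiple of \<open>p\<close> even for
  \<open>p = 2\<close>.\<close>

locale finite_action = group A for A (structure) +
  fixes f :: "'a \<Rightarrow> 's \<Rightarrow> 's" and S :: "'s set"
  assumes finite_group: "finite (carrier A)"
    and finite_set: "finite S"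
    and closed: "a \<in> carrier A \<Longrightarrow> s \<in> S \<Longrightarrow> f a s \<in> S"
    and act_one: "s \<in> S \<Longrightarrow> f \<one> s = s"
    and act_mult: "a \<in> carrier A \<Longrightarrow> b \<in> carrier A \<Longrightarrow> s \<in> S \<Longrightarrow> f (a \<otimes> b) s = f a (f b s)"
begin

definition orb where "orb s = (\<lambda>a. f a s) ` carrier A"
definition stab where "stab s = {a \<in> carrier A. f a s = s}"

lemma act_inv: "a \<in> carrier A \<Longrightarrow> s \<in> S \<Longrightarrow> f (inv a) (f a s) = s"
  using act_mult[of "inv a" a s] act_one by simp

lemma orb_subset: "s \<in> S \<Longrightarrow> orb s \<subseteq> S"
  by (auto simp: orb_def closed)

lemma in_orb: "s \<in> S \<Longrightarrow> s \<in> orb s"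
  using act_one by (force simp: orb_def)

lemma orb_eq:
  assumes "s \<in> S" "t \<in> orb s"
  shows "orb t = orb s"
proof -
  obtain a where a: "a \<in> carrier A" "t = f a s"
    using assms by (auto simp: orb_def)
  have "f b t \<in> orb s" if "b \<in> carrier A" for b
    using that a assms act_mult[of b a s] by (metis imageI m_closed orb_def)
  moreover have "f b s \<in> orb t" if "b \<in> carrier A" for b
  proof -
    have "f b s = f (b \<otimes> inv a) t"
      using that a assms act_mult[of b "inv a" t] act_inv closed by auto
    then show ?thesis using that a by (auto simp: orb_def)
  qed
  ultimately show ?thesis by (auto simp: orb_def)
qed

lemma finite_orb: "finite (orb s)"
  by (simp add: orb_def finite_group)

lemma card_orb_stab:
  assumes s: "s \<in> S"
  shows "card (orb s) * card (stab s) = order A"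
proof -
  have "card {a \<in> carrier A. f a s = t} = card (stab s)" if tin: "t \<in> orb s" for t
  proof -
    obtain b where b: "b \<in> carrier A" "t = f b s" using tin by (auto simp: orb_def)
    have "bij_betw (\<lambda>a. b \<otimes> a) (stab s) {a \<in> carrier A. f a s = t}"
    proof (rule bij_betw_byWitness[where f' = "\<lambda>a. inv b \<otimes> a"])
      show "\<forall>a\<in>stab s. inv b \<otimes> (b \<otimes> a) = a"
        "\<forall>a'\<in>{a \<in> carrier A. f a s = t}. b \<otimes> (inv b \<otimes> a') = a'"
        using b by (auto simp: stab_def m_assoc[symmetric])
      show "(\<otimes>) b ` stab s \<subseteq> {a \<in> carrier A. f a s = t}"
        using b s by (auto simp: stab_def act_mult)
      show "(\<lambda>a. inv b \<otimes> a) ` {a \<in> carrier A. f a s = t} \<subseteq> stab s"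
        using b s act_inv by (auto simp: stab_def act_mult)
    qed
    then show ?thesis by (simp add: bij_betw_same_card)
  qed
  then have "(\<Sum>t\<in>orb s. card {a \<in> carrier A. f a s = t}) = card (orb s) * card (stab s)"
    by simp
  moreover have "(\<Sum>t\<in>orb s. card {a \<in> carrier A. f a s = t}) = card (carrier A)"
    using sum.image_gen[OF finite_group, of "\<lambda>_. 1::nat" "\<lambda>a. f a s"] by (simp add: orb_def)
  ultimately show ?thesis by (simp add: order_def)
qed

text \<open>The weight is constant on each orbit, so the sum splits into terms of the form orbit
  length times weight. The divisibility results below apply this with varying groups: conjugation,
  translation, both together, or \<open>H\<close> acting on tuples and on lists of cosets.\<close>

lemma sum_dvd:
  fixes w :: "'s \<Rightarrow> nat"
  assumes w: "\<And>a s. a \<in> carrier A \<Longrightarrow> s \<in> S \<Longrightarrow> w (f a s) = w s"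
    and d: "\<And>s. s \<in> S \<Longrightarrow> d dvd card (orb s) * w s"
  shows "d dvd sum w S"
proof -
  have U: "S = \<Union>(orb ` S)" using in_orb orb_subset by blast
  have disj: "O1 \<inter> O2 = {}" if "O1 \<in> orb ` S" "O2 \<in> orb ` S" "O1 \<noteq> O2" for O1 O2
    using that orb_eq by blast
  have "sum w S = sum w (\<Union>(orb ` S))" using U by simp
  also have "\<dots> = (\<Sum>T\<in>orb ` S. sum w T)"
    by (subst sum.Union_disjoint) (use disj finite_orb in auto)
  also have "d dvd \<dots>"
  proof (rule dvd_sum)
    fix T assume "T \<in> orb ` S"
    then obtain s where s: "s \<in> S" "T = orb s" by auto
    have "sum w T = (\<Sum>t\<in>T. w s)"
      using s w by (intro sum.cong) (auto simp: orb_def)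
    then show "d dvd sum w T" using d s by simp
  qed
  finally show ?thesis .
qed


lemma card_orb_prime_power:
  assumes "prime p" "order A = p ^ e" "s \<in> S"
  obtains i where "card (orb s) = p ^ i"
  using card_orb_stab[OF assms(3)] assms(1,2) divides_primepow_nat[of p "card (orb s)" e]
  by (metis dvd_triv_left)

text \<open>Orbit lengths are powers of \<open>p\<close>, so exhibiting one point beyond
  \<open>p ^ j\<close> gains a whole factor \<open>p\<close>.\<close>

lemma prime_power_dvd_card_orb:
  assumes "prime p" "order A = p ^ e" "s \<in> S" "p ^ j < card (orb s)"
  shows "p ^ Suc j dvd card (orb s)"
proof -
  obtain i where i: "card (orb s) = p ^ i" using card_orb_prime_power assms by blast
  then have "j < i" using assms(1,4) prime_gt_1_nat power_strict_increasing_iff by metis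
  then show ?thesis unfolding i by (intro le_imp_power_dvd) simp
qed

lemma fixed_points_cong:
  assumes p: "prime p" and e: "order A = p ^ e"
  shows "[card {s \<in> S. \<forall>a\<in>carrier A. f a s = s} = card S] (mod p)"
proof -
  let ?F = "{s \<in> S. \<forall>a\<in>carrier A. f a s = s}"
  \<comment> \<open>The weight counts the moved points. The orbit of such a point has at least two
    elements, hence length divisible by \<open>p\<close>.\<close>
  define w where "w s = (if s \<in> ?F then 0 else 1::nat)" for s
  have fixed: "f a s \<in> ?F \<longleftrightarrow> s \<in> ?F" if "a \<in> carrier A" "s \<in> S" for a s
  proof
    assume "f a s \<in> ?F"
    then have "f (inv a) (f a s) = f a s" using that by auto
    then have "f a s = s" using that act_inv by simp
    with \<open>f a s \<in> ?F\<close> show "s \<in> ?F" by simp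
  next
    assume "s \<in> ?F" then show "f a s \<in> ?F" using that by auto
  qed
  have "p dvd sum w S"
  proof (rule sum_dvd)
    fix a s assume "a \<in> carrier A" "s \<in> S"
    then show "w (f a s) = w s" unfolding w_def using fixed by simp
  next
    fix s assume s: "s \<in> S"
    show "p dvd card (orb s) * w s"
    proof (cases "s \<in> ?F")
      case True then show ?thesis by (simp add: w_def)
    next
      case False
      then obtain a where "a \<in> carrier A" "f a s \<noteq> s" using s by auto
      then have "{s, f a s} \<subseteq> orb s" using in_orb s by (auto simp: orb_def)
      then have "card {s, f a s} \<le> card (orb s)" using finite_orb card_mono by blast
      then have "p ^ 0 < card (orb s)" using \<open>f a s \<noteq> s\<close> by simp
      then have "p dvd card (orb s)" using prime_power_dvd_card_orb[OF p e s, of 0] by simp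
      then show ?thesis by simp
    qed
  qed
  also have "sum w S = card (S - ?F)"
    unfolding w_def using finite_set
    by (auto simp: sum.If_cases intro!: arg_cong[where f = card])
  finally have "p dvd card S - card ?F"
    by (subst (asm) card_Diff_subset) (use finite_set in auto)
  moreover have "card ?F \<le> card S" using finite_set by (intro card_mono) auto
  ultimately show ?thesis
    using cong_diff_iff_cong_0_nat[of "card ?F" "card S" p] cong_sym by (simp add: cong_0_iff)
qed

end

section \<open>Commuting tuples\<close>

definition cent :: "('a, 'b) monoid_scheme \<Rightarrow> 'a \<Rightarrow> 'a set" where
  "cent G x = {g \<in> carrier G. g \<otimes>\<^bsub>G\<^esub> x = x \<otimes>\<^bsub>G\<^esub> g}"

text \<open>A list element \<open>(K, q)\<close> prescribes a set \<open>K\<close> for an entry and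
  an exponent \<open>q\<close> that kills it. Commutation is required of each entry with all later
  ones, so fixing the first entry \<open>x\<close> leaves a problem of the same shape with every set
  intersected with \<open>cent G x\<close>; this intersection is \<open>restr\<close>.\<close>

primrec com_tuples :: "('a, 'b) monoid_scheme \<Rightarrow> ('a set \<times> nat) list \<Rightarrow> 'a list set" where
  "com_tuples G [] = {[]}"
| "com_tuples G (s # r) = {x # xs | x xs.
     x \<in> fst s \<and> x [^]\<^bsub>G\<^esub> snd s = \<one>\<^bsub>G\<^esub> \<and> xs \<in> com_tuples G r \<and> set xs \<subseteq> cent G x}"

definition restr :: "'a set \<Rightarrow> ('a set \<times> nat) list \<Rightarrow> ('a set \<times> nat) list" where
  "restr C r = map (\<lambda>s. (fst s \<inter> C, snd s)) r"

lemma map_snd_restr [simp]: "map snd (restr C r) = map snd r"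
  by (simp add: restr_def)

lemma com_tuples_restr: "com_tuples G (restr C r) = {xs \<in> com_tuples G r. set xs \<subseteq> C}"
  by (induction r) (auto simp: restr_def)

lemma com_tuples_set:
  "xs \<in> com_tuples G r \<Longrightarrow> y \<in> set xs \<Longrightarrow> \<exists>s\<in>set r. y \<in> fst s"
  by (induction r arbitrary: xs) fastforce+

lemma finite_com_tuples:
  "(\<And>s. s \<in> set r \<Longrightarrow> finite (fst s)) \<Longrightarrow> finite (com_tuples G r)"
proof (induction r)
  case (Cons s r)
  have "com_tuples G (s # r) \<subseteq> (\<lambda>(x, xs). x # xs) ` (fst s \<times> com_tuples G r)" by auto
  then show ?case using Cons by (meson finite_SigmaI finite_imageI finite_subset list.set_intros)
qed simp

lemma card_com_tuples_Cons:
  assumes "finite (fst s)" "finite (com_tuples G r)"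
  shows "card (com_tuples G (s # r)) =
    (\<Sum>x | x \<in> fst s \<and> x [^]\<^bsub>G\<^esub> snd s = \<one>\<^bsub>G\<^esub>. card (com_tuples G (restr (cent G x) r)))"
proof -
  let ?X = "{x. x \<in> fst s \<and> x [^]\<^bsub>G\<^esub> snd s = \<one>\<^bsub>G\<^esub>}"
  have "bij_betw (\<lambda>(x, xs). x # xs) (SIGMA x:?X. com_tuples G (restr (cent G x) r)) (com_tuples G (s # r))"
    by (auto simp: bij_betw_def inj_on_def com_tuples_restr image_iff)
  from bij_betw_same_card[OF this, symmetric]
  have "card (com_tuples G (s # r)) = card (SIGMA x:?X. com_tuples G (restr (cent G x) r))" .
  also have "\<dots> =
      (\<Sum>x\<in>?X. card (com_tuples G (restr (cent G x) r)))"
    using assms by (intro card_SigmaI) (auto simp: com_tuples_restr)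
  finally show ?thesis .
qed

context group
begin

section \<open>Conjugation, centralizers and relative cosets\<close>

abbreviation cnj where "cnj g x \<equiv> g \<otimes> x \<otimes> inv g"

lemma cnj_mult:
  "g \<in> carrier G \<Longrightarrow> x \<in> carrier G \<Longrightarrow> y \<in> carrier G \<Longrightarrow> cnj g (x \<otimes> y) = cnj g x \<otimes> cnj g y"
  by (metis inv_closed inv_solve_left m_assoc m_closed)

lemma cnj_pow:
  "g \<in> carrier G \<Longrightarrow> x \<in> carrier G \<Longrightarrow> cnj g (x [^] (n::nat)) = cnj g x [^] n"
  by (induction n) (simp_all add: cnj_mult)

lemma cnj_cnj:
  "g \<in> carrier G \<Longrightarrow> h \<in> carrier G \<Longrightarrow> x \<in> carrier G \<Longrightarrow> cnj (g \<otimes> h) x = cnj g (cnj h x)"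
  by (simp add: m_assoc inv_mult_group)

lemma cnj_inv_cancel [simp]:
  "g \<in> carrier G \<Longrightarrow> x \<in> carrier G \<Longrightarrow> cnj g (cnj (inv g) x) = x"
  "g \<in> carrier G \<Longrightarrow> x \<in> carrier G \<Longrightarrow> cnj (inv g) (cnj g x) = x"
  using cnj_cnj[of g "inv g" x] cnj_cnj[of "inv g" g x] by simp_all

lemma cnj_eq_iff:
  "g \<in> carrier G \<Longrightarrow> x \<in> carrier G \<Longrightarrow> cnj g x = x \<longleftrightarrow> g \<otimes> x = x \<otimes> g"
  by (metis inv_solve_right' m_closed)

lemma cent_subset: "cent G x \<subseteq> carrier G" by (auto simp: cent_def)

lemma cent_iff: "g \<in> carrier G \<Longrightarrow> x \<in> carrier G \<Longrightarrow> g \<in> cent G x \<longleftrightarrow> cnj g x = x"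
  by (simp add: cent_def cnj_eq_iff)

lemma cent_sym: "g \<in> carrier G \<Longrightarrow> x \<in> carrier G \<Longrightarrow> g \<in> cent G x \<longleftrightarrow> x \<in> cent G g"
  by (auto simp: cent_def)

lemma subgroup_cent: assumes "x \<in> carrier G" shows "subgroup (cent G x) G"
proof
  show "cent G x \<subseteq> carrier G" by (rule cent_subset)
  show "\<one> \<in> cent G x" using assms by (simp add: cent_def)
next
  fix g h assume "g \<in> cent G x" "h \<in> cent G x"
  then show "g \<otimes> h \<in> cent G x" using assms unfolding cent_def by simp (metis m_assoc)
next
  fix g assume "g \<in> cent G x"
  then show "inv g \<in> cent G x" using assms unfolding cent_def
    by simp (metis inv_closed inv_solve_left inv_solve_right m_assoc m_closed)
qed

lemma cnj_cent: 
  assumes "g \<in> carrier G" "x \<in> carrier G" "y \<in> cent G x"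
  shows "cnj g y \<in> cent G (cnj g x)"
  using assms unfolding cent_def by (auto simp flip: cnj_mult)

lemma com_tuples_cnj:
  assumes g: "g \<in> carrier G"
  shows "xs \<in> com_tuples G r \<Longrightarrow>
    \<forall>s\<in>set r. fst s \<subseteq> carrier G \<and> (\<forall>k\<in>fst s. cnj g k \<in> fst s) \<Longrightarrow>
    map (cnj g) xs \<in> com_tuples G r"
proof (induction r arbitrary: xs)
  case (Cons s r)
  then obtain y ys where y: "xs = y # ys" "y \<in> fst s" "y [^] snd s = \<one>" "ys \<in> com_tuples G r"
    "set ys \<subseteq> cent G y" by auto
  have yc: "y \<in> carrier G" "cnj g y \<in> fst s" using y(2) Cons.prems(2) by auto
  have "map (cnj g) ys \<in> com_tuples G r"
    using Cons.IH[OF y(4)] Cons.prems(2) by simp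
  moreover have "cnj g y [^] snd s = \<one>"
    using cnj_pow[OF g yc(1), of "snd s"] y(3) g by simp
  moreover have "set (map (cnj g) ys) \<subseteq> cent G (cnj g y)"
    using y(5) cnj_cent[OF g yc(1)] by auto
  ultimately show ?case using y(1) yc by simp
qed simp

text \<open>Normality is relative to a subgroup \<open>P\<close> of a fixed ambient group. In this
  form \<open>H\<close> and \<open>P\<close> can be intersected with centralizers and stabilizers
  while the operations stay those of \<open>G\<close>.\<close>

definition normal_in :: "'a set \<Rightarrow> 'a set \<Rightarrow> bool" where
  "normal_in H P \<longleftrightarrow> subgroup H G \<and> subgroup P G \<and> H \<subseteq> P \<and> (\<forall>g\<in>P. \<forall>h\<in>H. cnj g h \<in> H)"

text \<open>The empty set is allowed because a coset of \<open>H\<close> may miss a given subgroup.\<close>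

definition coset_in :: "'a set \<Rightarrow> 'a set \<Rightarrow> 'a set \<Rightarrow> bool" where
  "coset_in H P K \<longleftrightarrow> K \<subseteq> P \<and> (\<forall>x\<in>K. \<forall>y\<in>P. y \<in> K \<longleftrightarrow> inv x \<otimes> y \<in> H)"

lemma normal_in_carrier:
  assumes "normal_in H P" shows "H \<subseteq> carrier G" "P \<subseteq> carrier G"
  using assms subgroup.subset by (auto simp: normal_in_def)

lemma normal_in_Int: "normal_in H P \<Longrightarrow> subgroup C G \<Longrightarrow> normal_in (H \<inter> C) (P \<inter> C)"
  unfolding normal_in_def
  by (auto intro!: subgroups_Inter_pair simp: subgroup.m_closed subgroup.m_inv_closed)

lemma coset_in_Int: "coset_in H P K \<Longrightarrow> subgroup C G \<Longrightarrow> coset_in (H \<inter> C) (P \<inter> C) (K \<inter> C)"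
  unfolding coset_in_def by (auto simp: subgroup.m_closed subgroup.m_inv_closed)

lemma coset_in_mult:
  assumes "normal_in H P" "coset_in H P K" "x \<in> K" "h \<in> H"
  shows "x \<otimes> h \<in> K"
proof -
  have "x \<in> P" "h \<in> P" "subgroup P G" using assms by (auto simp: normal_in_def coset_in_def)
  moreover from this have "inv x \<otimes> (x \<otimes> h) = h"
    by (metis inv_solve_left subgroup.mem_carrier subgroup.m_closed)
  ultimately show ?thesis using assms unfolding coset_in_def by (metis subgroup.m_closed)
qed

text \<open>Conjugation by \<open>h\<close> multiplies \<open>x\<close> on the right by a commutator
  of \<open>x\<close> and \<open>h\<close>, which lies in the normal subgroup
  \<open>H\<close>.\<close>

lemma coset_in_cnj:
  assumes N: "normal_in H P" and C: "coset_in H P K" and "x \<in> K" "h \<in> H"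
  shows "cnj h x \<in> K"
proof -
  have S: "subgroup H G" "subgroup P G" "x \<in> P" "h \<in> P" "x \<in> carrier G" "h \<in> carrier G"
    using assms normal_in_carrier[OF N] by (auto simp: normal_in_def coset_in_def)
  have "cnj h x = x \<otimes> (cnj (inv x) h \<otimes> inv h)"
    using S by (metis cnj_inv_cancel(1) cnj_mult inv_closed inv_inv l_inv m_assoc m_closed r_one)
  moreover have "cnj (inv x) h \<otimes> inv h \<in> H"
  proof (rule subgroup.m_closed[OF S(1)])
    show "cnj (inv x) h \<in> H"
      using N subgroup.m_inv_closed[OF S(2,3)] assms(4) unfolding normal_in_def by blast
    show "inv h \<in> H" using subgroup.m_inv_closed[OF S(1)] assms(4) .
  qed
  ultimately show ?thesis using coset_in_mult[OF N C assms(3)] by simp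
qed

lemma card_subgroup_dvd:
  assumes "subgroup H G" "subgroup P G" "H \<subseteq> P" "finite P"
  shows "card H dvd card P"
proof -
  interpret P: group "G\<lparr>carrier := P\<rparr>" using assms subgroup.subgroup_is_group is_group by blast
  have "subgroup H (G\<lparr>carrier := P\<rparr>)" using assms subgroup_incl by blast
  then have "card (carrier (G\<lparr>carrier := P\<rparr>) ) = card (rcosets\<^bsub>G\<lparr>carrier := P\<rparr>\<^esub> H) * card H"
    using P.lagrange_finite[of H] assms(4) by (simp add: order_def)
  then show ?thesis by simp
qed

lemma finite_action_cnj:
  assumes H: "subgroup H G" "finite H" "finite K" "K \<subseteq> carrier G"
    "\<And>h k. h \<in> H \<Longrightarrow> k \<in> K \<Longrightarrow> cnj h k \<in> K"
  shows "finite_action (G\<lparr>carrier := H\<rparr>) cnj K"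
proof -
  interpret P: group "G\<lparr>carrier := H\<rparr>" using H(1) subgroup.subgroup_is_group is_group by blast
  have HG: "h \<in> carrier G" if "h \<in> H" for h using that subgroup.mem_carrier[OF H(1)] by simp
  show ?thesis
  proof
    show "finite (carrier (G\<lparr>carrier := H\<rparr>))" "finite K" using H by auto
    show "cnj a s \<in> K" if "a \<in> carrier (G\<lparr>carrier := H\<rparr>)" "s \<in> K" for a s
      using H(5) that by simp
    show "cnj \<one>\<^bsub>G\<lparr>carrier := H\<rparr>\<^esub> s = s" if "s \<in> K" for s
      using that H(4) by auto
    show "cnj (a \<otimes>\<^bsub>G\<lparr>carrier := H\<rparr>\<^esub> b) s = cnj a (cnj b s)"
      if "a \<in> carrier (G\<lparr>carrier := H\<rparr>)" "b \<in> carrier (G\<lparr>carrier := H\<rparr>)" "s \<in> K" for a b s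
      using that H(4) HG cnj_cnj[of a b s] by auto
  qed
qed


lemma subgroup_nat_pow: "subgroup H G \<Longrightarrow> x \<in> H \<Longrightarrow> x [^] (n::nat) \<in> H"
  using subgroup_int_pow_closed[of H x "int n"] by (simp add: int_pow_int)

lemma finite_carrier_prime_power: "prime p \<Longrightarrow> order G = p ^ e \<Longrightarrow> finite (carrier G)"
  by (metis card_gt_0_iff order_def power_not_zero not_prime_0 not_gr_zero)

lemma card_subgroup_prime_power:
  assumes "prime p" "card P = p ^ e" "subgroup H G" "subgroup P G" "H \<subseteq> P"
  obtains i where "card H = p ^ i" "i \<le> e"
proof -
  have "card P \<noteq> 0" using assms(1,2) by simp
  then have "finite P" using card_ge_0_finite by auto
  then have "card H dvd p ^ e" using card_subgroup_dvd[OF assms(3-5)] assms(2) by simp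
  then show ?thesis using that divides_primepow_nat[OF assms(1)] by blast
qed

section \<open>Central series and powers in finite prime power groups\<close>

text \<open>\<open>R'\<close> is the preimage of a subgroup of order \<open>p\<close> in the part of
  \<open>H\<close> modulo \<open>R\<close> that is central in \<open>G Mod R\<close>. As this
  subgroup is central of exponent \<open>p\<close>, multiplication by its elements does not change
  \<open>p\<close>-th powers modulo \<open>R\<close>; the last clause records this for the proof of
  Hall's theorem.\<close>

lemma central_extension_step:
  assumes p: "prime p" and e: "order G = p ^ e" and R: "R \<lhd> G" and H: "H \<lhd> G"
    and RH: "R \<subseteq> H" "R \<noteq> H" and cR: "card R = p ^ i"
  shows "\<exists>R'. R' \<lhd> G \<and> R \<subseteq> R' \<and> R' \<subseteq> H \<and> card R' = p ^ Suc i \<and>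
    (\<forall>g\<in>carrier G. \<forall>x\<in>R'. cnj g x \<otimes> inv x \<in> R) \<and>
    (\<forall>c\<in>carrier G. \<forall>x\<in>R'. \<exists>r\<in>R. (c \<otimes> x) [^] p = c [^] p \<otimes> r)"
proof -
  interpret R: normal R G by fact
  interpret H: normal H G by fact
  interpret Q: group "G Mod R" by (rule R.factorgroup_is_group)
  note one_FactGroup [simp del] and mult_FactGroup [simp del]
  define \<pi> where "\<pi> x = R #> x" for x
  interpret \<pi>: group_hom G "G Mod R" \<pi>
    using R.r_coset_hom_Mod unfolding \<pi>_def
    by (intro group_hom.intro is_group Q.is_group group_hom_axioms.intro)
  have fin: "finite (carrier G)" using finite_carrier_prime_power[OF p e] .
  have sR: "subgroup R G" and sH: "subgroup H G" using R.subgroup_axioms H.subgroup_axioms .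
  have inG: "x \<in> carrier G" if "x \<in> H" for x using that H.subset by auto
  have fR: "finite R" and fH: "finite H" using fin finite_subset R.subset H.subset by auto
  have \<pi>_eq: "\<pi> x = \<pi> y \<longleftrightarrow> x \<otimes> inv y \<in> R" if "x \<in> carrier G" "y \<in> carrier G" for x y
    unfolding \<pi>_def
    by (metis R.rcos_module is_group rcos_self repr_independence sR that)
  have \<pi>_one: "\<pi> x = \<one>\<^bsub>G Mod R\<^esub> \<longleftrightarrow> x \<in> R" if "x \<in> carrier G" for x
    using \<pi>_eq[of x \<one>] that by simp
  have ontoQ: "carrier (G Mod R) = \<pi> ` carrier G"
    by (auto simp: FactGroup_def RCOSETS_def \<pi>_def)
  have cardQ: "card (carrier (G Mod R)) * card R = p ^ e"
    using lagrange_finite[OF fin sR] e by (simp add: FactGroup_def)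
  have cHR: "card (\<pi> ` H) * card R = card H"
  proof -
    interpret GH: group "G\<lparr>carrier := H\<rparr>" using subgroup.subgroup_is_group[OF sH is_group] .
    have "subgroup R (G\<lparr>carrier := H\<rparr>)" using subgroup_incl[OF sR sH RH(1)] .
    then have "card (rcosets\<^bsub>G\<lparr>carrier := H\<rparr>\<^esub> R) * card R = order (G\<lparr>carrier := H\<rparr>)"
      using GH.lagrange_finite[of R] fH by simp
    moreover have "rcosets\<^bsub>G\<lparr>carrier := H\<rparr>\<^esub> R = \<pi> ` H"
      by (auto simp: RCOSETS_def \<pi>_def r_coset_def)
    ultimately show ?thesis by (simp add: order_def)
  qed
  obtain h where cH: "card H = p ^ h"
    using card_subgroup_prime_power[OF p e[unfolded order_def] sH subgroup_self H.subset] by blast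
  have lt: "i < h"
  proof -
    have "card R < card H" using RH fH by (simp add: psubset_card_mono psubsetI)
    then show ?thesis using cR cH p prime_gt_1_nat power_strict_increasing_iff by metis
  qed
  have "p ^ h = p ^ (h - i) * p ^ i" using lt by (simp flip: power_add)
  then have "card (\<pi> ` H) = p ^ (h - i)" using cHR cR cH p by simp
  then have pdvd: "p dvd card (\<pi> ` H)" using lt by simp
  have "card (carrier (G Mod R)) dvd p ^ e" using cardQ by (metis dvd_triv_left)
  then obtain e' where e': "order (G Mod R) = p ^ e'"
    using divides_primepow_nat[OF p] unfolding order_def by blast
  have finQ: "finite (carrier (G Mod R))" using ontoQ fin by simp
  have sub: "\<pi> ` H \<subseteq> carrier (G Mod R)" using inG by auto
  have "finite_action ((G Mod R)\<lparr>carrier := carrier (G Mod R)\<rparr>) Q.cnj (\<pi> ` H)"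
  proof (rule Q.finite_action_cnj[OF Q.subgroup_self finQ _ sub])
    fix D C assume "D \<in> carrier (G Mod R)" "C \<in> \<pi> ` H"
    then obtain g x where *: "g \<in> carrier G" "D = \<pi> g" "x \<in> H" "C = \<pi> x" using ontoQ by auto
    then have "Q.cnj D C = \<pi> (cnj g x)" using inG by simp
    moreover have "cnj g x \<in> H" using * H.inv_op_closed2 by simp
    ultimately show "Q.cnj D C \<in> \<pi> ` H" by simp
  qed (use fH in simp)
  then interpret act: finite_action "G Mod R" Q.cnj "\<pi> ` H" by simp
  \<comment> \<open>\<open>F\<close> is the part of the image of \<open>H\<close> that is central in
    the quotient. Its size is congruent modulo \<open>p\<close> to that of the image of
    \<open>H\<close>, hence divisible by \<open>p\<close>, and it contains the identity, so it is
    not trivial.\<close>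
  define F where "F = {C \<in> \<pi> ` H. \<forall>D\<in>carrier (G Mod R). Q.cnj D C = C}"
  have "[card F = card (\<pi> ` H)] (mod p)" unfolding F_def by (rule act.fixed_points_cong[OF p e'])
  then have "p dvd card F" using pdvd cong_dvd_iff by blast
  moreover have oneF: "\<one>\<^bsub>G Mod R\<^esub> \<in> F"
  proof -
    have "\<one>\<^bsub>G Mod R\<^esub> \<in> \<pi> ` H" using \<pi>.hom_one H.one_closed imageI[of \<one> H \<pi>] by simp
    moreover have "Q.cnj D \<one>\<^bsub>G Mod R\<^esub> = \<one>\<^bsub>G Mod R\<^esub>" if "D \<in> carrier (G Mod R)" for D
      using Q.r_one[OF that] Q.r_inv[OF that] by simp
    ultimately show ?thesis unfolding F_def by blast
  qed
  ultimately have "\<exists>C\<in>F. C \<noteq> \<one>\<^bsub>G Mod R\<^esub>"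
  proof -
    have "finite F" unfolding F_def using fH by simp
    then have "card F \<noteq> 0" using oneF by auto
    then have "p \<le> card F" using \<open>p dvd card F\<close> by (simp add: dvd_imp_le)
    then have "card F > 1" using p prime_gt_1_nat by (meson less_le_trans)
    moreover have "card F \<le> 1" if "F \<subseteq> {\<one>\<^bsub>G Mod R\<^esub>}"
      using card_mono[OF _ that] by simp
    ultimately show ?thesis by fastforce
  qed
  then obtain u where u: "u \<in> H" "\<pi> u \<in> F" "u \<notin> R" using \<pi>_one inG unfolding F_def by blast
  have uc: "D \<otimes>\<^bsub>G Mod R\<^esub> \<pi> u = \<pi> u \<otimes>\<^bsub>G Mod R\<^esub> D" if "D \<in> carrier (G Mod R)" for D
    using u that sub Q.cnj_eq_iff[of D "\<pi> u"] unfolding F_def by auto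
  have "u [^] p ^ e \<in> R" 
    using pow_order_eq_1[of u] inG u(1) e R.one_closed by simp
  \<comment> \<open>The element \<open>v\<close> below is the last of the powers
    \<open>u [^] p ^ k\<close> outside \<open>R\<close>: still central modulo \<open>R\<close>, and
    of order \<open>p\<close> there.\<close>
  then obtain j where j: "u [^] p ^ j \<in> R" "\<And>k. k < j \<Longrightarrow> u [^] p ^ k \<notin> R"
    using exists_least_iff[of "\<lambda>j. u [^] p ^ j \<in> R"] by blast
  have "j \<noteq> 0" using j(1) u(1,3) inG by (metis nat_pow_eone power_0)
  then obtain k where k: "j = Suc k" by (cases j) auto
  define v where "v = u [^] p ^ k"
  have vG: "v \<in> carrier G" using u(1) inG by (simp add: v_def)
  have vH: "v \<in> H" unfolding v_def using subgroup_nat_pow[OF sH u(1)] .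
  have vR: "v \<notin> R" using j k by (simp add: v_def)
  have "v [^] p = u [^] p ^ j" using u(1) inG by (simp add: v_def k nat_pow_pow mult.commute)
  then have vp: "\<pi> v [^]\<^bsub>G Mod R\<^esub> p = \<one>\<^bsub>G Mod R\<^esub>"
    using \<pi>.hom_nat_pow[OF vG, of p] \<pi>_one j(1) vG by (metis nat_pow_closed)
  have vc: "\<pi> v \<otimes>\<^bsub>G Mod R\<^esub> D = D \<otimes>\<^bsub>G Mod R\<^esub> \<pi> v" if D: "D \<in> carrier (G Mod R)" for D
  proof -
    have "\<pi> v = \<pi> u [^]\<^bsub>G Mod R\<^esub> (p ^ k)" using \<pi>.hom_nat_pow[OF inG[OF u(1)]] by (simp add: v_def)
    moreover have "\<pi> u \<in> cent (G Mod R) D" using uc[OF D] inG[OF u(1)] by (simp add: cent_def)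
    ultimately have "\<pi> v \<in> cent (G Mod R) D" using Q.subgroup_nat_pow[OF Q.subgroup_cent[OF D]] by simp
    then show ?thesis by (simp add: cent_def)
  qed
  \<comment> \<open>Preimage of the group generated by \<open>\<pi> v\<close>. Integer exponents
    make closure under inverses immediate; reducing them modulo \<open>p\<close> gives the upper
    bound for the size in \<open>R'sub\<close>.\<close>
  define R' where "R' = {x \<in> carrier G. \<exists>k::int. \<pi> x = \<pi> v [^]\<^bsub>G Mod R\<^esub> k}"
  have \<pi>vG: "\<pi> v \<in> carrier (G Mod R)" using vG by simp
  have R'G: "x \<in> carrier G" if "x \<in> R'" for x using that by (simp add: R'_def)
  have comm: "\<pi> x \<otimes>\<^bsub>G Mod R\<^esub> D = D \<otimes>\<^bsub>G Mod R\<^esub> \<pi> x" if x: "x \<in> R'" and D: "D \<in> carrier (G Mod R)" for x D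
  proof -
    have "\<pi> v \<in> cent (G Mod R) D" using vc[OF D] \<pi>vG by (simp add: cent_def)
    then have "\<pi> v [^]\<^bsub>G Mod R\<^esub> (k::int) \<in> cent (G Mod R) D" for k
      by (rule Q.subgroup_int_pow_closed[OF Q.subgroup_cent[OF D]])
    then have "\<pi> x \<in> cent (G Mod R) D" using x unfolding R'_def by auto
    then show ?thesis by (simp add: cent_def)
  qed
  have xp: "\<pi> x [^]\<^bsub>G Mod R\<^esub> p = \<one>\<^bsub>G Mod R\<^esub>" if x: "x \<in> R'" for x
  proof -
    obtain a :: int where a: "\<pi> x = \<pi> v [^]\<^bsub>G Mod R\<^esub> a" using x unfolding R'_def by blast
    have "\<pi> x [^]\<^bsub>G Mod R\<^esub> int p = (\<pi> v [^]\<^bsub>G Mod R\<^esub> int p) [^]\<^bsub>G Mod R\<^esub> a"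
      unfolding a by (simp only: Q.int_pow_pow[OF \<pi>vG] mult.commute)
    then show ?thesis using vp by (simp add: int_pow_int)
  qed
  have sR': "subgroup R' G"
  proof
    show "R' \<subseteq> carrier G" by (auto simp: R'_def)
    have "\<pi> \<one> = \<pi> v [^]\<^bsub>G Mod R\<^esub> (0::int)" by simp
    then show "\<one> \<in> R'" unfolding R'_def using one_closed by blast
  next
    fix x y assume "x \<in> R'" "y \<in> R'"
    then obtain a b :: int where ab: "\<pi> x = \<pi> v [^]\<^bsub>G Mod R\<^esub> a" "\<pi> y = \<pi> v [^]\<^bsub>G Mod R\<^esub> b"
      "x \<in> carrier G" "y \<in> carrier G" unfolding R'_def by blast
    then have "\<pi> (x \<otimes> y) = \<pi> v [^]\<^bsub>G Mod R\<^esub> (a + b)" by (simp add: Q.int_pow_mult[OF \<pi>vG])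
    then show "x \<otimes> y \<in> R'" unfolding R'_def using ab by blast
  next
    fix x assume "x \<in> R'"
    then obtain a :: int where ab: "\<pi> x = \<pi> v [^]\<^bsub>G Mod R\<^esub> a"
      "x \<in> carrier G" unfolding R'_def by blast
    then have "\<pi> (inv x) = \<pi> v [^]\<^bsub>G Mod R\<^esub> (- a)" by (simp add: Q.int_pow_neg[OF \<pi>vG])
    then show "inv x \<in> R'" unfolding R'_def using ab by blast
  qed
  have \<pi>cnj: "\<pi> (cnj g x) = \<pi> x" if "g \<in> carrier G" "x \<in> R'" for g x
  proof -
    have "\<pi> (cnj g x) = Q.cnj (\<pi> g) (\<pi> x)" using that R'G by simp
    then show ?thesis using Q.cnj_eq_iff[of "\<pi> g" "\<pi> x"] comm[OF that(2), of "\<pi> g"] that R'G by simp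
  qed
  have nR': "R' \<lhd> G"
  proof (rule normal_invI[OF sR'])
    fix g x assume "g \<in> carrier G" "x \<in> R'"
    then show "cnj g x \<in> R'" using \<pi>cnj[of g x] R'G[of x] by (simp add: R'_def)
  qed
  have RR': "R \<subseteq> R'"
  proof
    fix x assume "x \<in> R"
    then have "x \<in> carrier G" "\<pi> x = \<pi> v [^]\<^bsub>G Mod R\<^esub> (0::int)" using \<pi>_one R.subset by auto
    then show "x \<in> R'" unfolding R'_def by blast
  qed
  have R'sub: "R' \<subseteq> (\<lambda>(a, r). r \<otimes> v [^] a) ` ({..<p} \<times> R)"
  proof
    fix x assume x: "x \<in> R'"
    then obtain a :: int where a: "\<pi> x = \<pi> v [^]\<^bsub>G Mod R\<^esub> a" unfolding R'_def by blast
    define b where "b = nat (a mod int p)"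
    have p0: "0 < p" using p prime_gt_0_nat by blast
    have ib: "int b = a mod int p" unfolding b_def using p0 by simp
    have "\<pi> v [^]\<^bsub>G Mod R\<^esub> a = \<pi> v [^]\<^bsub>G Mod R\<^esub> (int p * (a div int p) + int b)"
      unfolding ib by (simp add: mult.commute)
    also have "\<dots> = (\<pi> v [^]\<^bsub>G Mod R\<^esub> int p) [^]\<^bsub>G Mod R\<^esub> (a div int p) \<otimes>\<^bsub>G Mod R\<^esub> \<pi> v [^]\<^bsub>G Mod R\<^esub> int b"
      by (simp only: Q.int_pow_mult[OF \<pi>vG] Q.int_pow_pow[OF \<pi>vG])
    also have "\<dots> = \<pi> v [^]\<^bsub>G Mod R\<^esub> b" using vp \<pi>vG by (simp add: int_pow_int)
    also have "\<dots> = \<pi> (v [^] b)" using \<pi>.hom_nat_pow[OF vG] by simp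
    finally have "x \<otimes> inv (v [^] b) \<in> R" using a \<pi>_eq x R'G vG by simp
    moreover have "x = (x \<otimes> inv (v [^] b)) \<otimes> v [^] b" using x R'G vG by (simp add: m_assoc)
    moreover have "b < p" using ib p0 by (metis of_nat_0_less_iff of_nat_less_iff pos_mod_bound)
    ultimately show "x \<in> (\<lambda>(a, r). r \<otimes> v [^] a) ` ({..<p} \<times> R)" by force
  qed
  have R'H: "R' \<subseteq> H"
    using R'sub RH(1) subgroup_nat_pow[OF sH vH] H.m_closed by force
  have "card R' \<le> card ({..<p} \<times> R)"
    using R'sub fR by (intro surj_card_le) auto
  then have le: "card R' \<le> p ^ Suc i" by (simp add: card_cartesian_product cR)
  have vR': "v \<in> R'" unfolding R'_def using vG \<pi>vG Q.int_pow_1[OF \<pi>vG] by (metis (mono_tags, lifting) mem_Collect_eq)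
  have "R \<subset> R'" using RR' vR' vR by blast
  then have "card R < card R'" using R'H fH by (meson finite_subset psubset_card_mono)
  moreover obtain k' where k': "card R' = p ^ k'" 
    using card_subgroup_prime_power[OF p e[unfolded order_def] sR' subgroup_self subgroup.subset[OF sR']]
    by blast
  ultimately have "i < k'" "k' \<le> Suc i" using le cR p prime_gt_1_nat
    by (metis power_strict_increasing_iff, metis power_increasing_iff)
  then have "k' = Suc i" by simp
  then have card: "card R' = p ^ Suc i" using k' by simp
  show ?thesis
  proof (intro exI[of _ R'] conjI ballI nR' RR' R'H card)
    fix g x assume *: "g \<in> carrier G" "x \<in> R'"
    then show "cnj g x \<otimes> inv x \<in> R"
      using \<pi>cnj \<pi>_eq[of "cnj g x" x] R'G by simp
  next
    fix c x assume *: "c \<in> carrier G" "x \<in> R'"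
    then have xG: "x \<in> carrier G" using R'G by simp
    have "\<pi> ((c \<otimes> x) [^] p) = (\<pi> c \<otimes>\<^bsub>G Mod R\<^esub> \<pi> x) [^]\<^bsub>G Mod R\<^esub> p"
      using * xG \<pi>.hom_nat_pow[of "c \<otimes> x" p] by simp
    also have "\<dots> = \<pi> c [^]\<^bsub>G Mod R\<^esub> p \<otimes>\<^bsub>G Mod R\<^esub> \<pi> x [^]\<^bsub>G Mod R\<^esub> p"
      using Q.pow_mult_distrib[of "\<pi> c" "\<pi> x" p] comm[OF *(2), of "\<pi> c"] * xG by simp
    also have "\<dots> = \<pi> (c [^] p)" using xp[OF *(2)] * \<pi>.hom_nat_pow[of c p] by simp
    finally have "\<pi> (inv (c [^] p) \<otimes> (c \<otimes> x) [^] p) = \<one>\<^bsub>G Mod R\<^esub>" using * xG by simp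
    then have "inv (c [^] p) \<otimes> (c \<otimes> x) [^] p \<in> R"
      using \<pi>_one[of "inv (c [^] p) \<otimes> (c \<otimes> x) [^] p"] * xG by blast
    moreover have "(c \<otimes> x) [^] p = c [^] p \<otimes> (inv (c [^] p) \<otimes> (c \<otimes> x) [^] p)"
      using * xG by (simp flip: m_assoc)
    ultimately show "\<exists>r\<in>R. (c \<otimes> x) [^] p = c [^] p \<otimes> r" by blast
  qed
qed


text \<open>Climbing a central series one step at a time: by \<open>central_extension_step\<close> a
  first \<open>p\<close>-th power pushes the disturbing factor from \<open>R'\<close> down into
  \<open>R\<close>, and the remaining \<open>p ^ i\<close>-th power, taken of \<open>c [^] p\<close>
  times an element of \<open>R\<close>, does not see it.\<close>

lemma normal_power_chain:
  assumes p: "prime p" and e: "order G = p ^ e" and H: "H \<lhd> G" "card H = p ^ a"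
  shows "i \<le> a \<Longrightarrow> \<exists>R. R \<lhd> G \<and> R \<subseteq> H \<and> card R = p ^ i \<and>
    (\<forall>c\<in>carrier G. \<forall>r\<in>R. (c \<otimes> r) [^] (p ^ i) = c [^] (p ^ i))"
proof (induction i)
  case 0
  have "subgroup H G" using H(1) by (simp add: normal_def)
  then show ?case using one_is_normal subgroup.one_closed[of H G] by (intro exI[of _ "{\<one>}"]) auto
next
  case (Suc i)
  then obtain R where R: "R \<lhd> G" "R \<subseteq> H" "card R = p ^ i"
    and RP: "\<And>c r. c \<in> carrier G \<Longrightarrow> r \<in> R \<Longrightarrow> (c \<otimes> r) [^] (p ^ i) = c [^] (p ^ i)" by auto
  have "p ^ i < p ^ a" using Suc.prems p prime_gt_1_nat by (intro power_strict_increasing) auto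
  then have "R \<noteq> H" using R H by auto
  from central_extension_step[OF p e R(1) H(1) R(2) this R(3)]
  obtain R' where R': "R' \<lhd> G" "R' \<subseteq> H" "card R' = p ^ Suc i"
    and step: "\<forall>c\<in>carrier G. \<forall>x\<in>R'. \<exists>r\<in>R. (c \<otimes> x) [^] p = c [^] p \<otimes> r"
    by blast
  have "(c \<otimes> x) [^] (p ^ Suc i) = c [^] (p ^ Suc i)" if c: "c \<in> carrier G" and x: "x \<in> R'" for c x
  proof -
    obtain r where r: "r \<in> R" "(c \<otimes> x) [^] p = c [^] p \<otimes> r" using step c x by blast
    have xG: "x \<in> carrier G" using x R'(1) by (meson normal_def subgroup.mem_carrier)
    have "(c \<otimes> x) [^] (p ^ Suc i) = ((c \<otimes> x) [^] p) [^] (p ^ i)"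
      using c xG by (simp add: nat_pow_pow)
    also have "\<dots> = (c [^] p) [^] (p ^ i)" using r RP[of "c [^] p" r] c by simp
    finally show ?thesis using c by (simp add: nat_pow_pow)
  qed
  then show ?case using R' by blast
qed

text \<open>This is \<open>central_extension_step\<close> starting from the trivial
  subgroup.\<close>

lemma central_element:
  assumes p: "prime p" and e: "order G = p ^ e" and H: "H \<lhd> G" "H \<noteq> {\<one>}"
  shows "\<exists>y\<in>H. y \<noteq> \<one> \<and> (\<forall>g\<in>carrier G. g \<otimes> y = y \<otimes> g)"
proof -
  have sH: "subgroup H G" using H(1) by (simp add: normal_def)
  have "{\<one>} \<subseteq> H" "{\<one>} \<noteq> H" "card {\<one>} = p ^ 0" using H(2) subgroup.one_closed[OF sH] by auto
  from central_extension_step[OF p e one_is_normal H(1) this]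
  obtain R' where R': "R' \<lhd> G" "R' \<subseteq> H" "card R' = p ^ Suc 0"
    and step: "\<forall>g\<in>carrier G. \<forall>x\<in>R'. cnj g x \<otimes> inv x \<in> {\<one>}"
    by blast
  have "\<not> R' \<subseteq> {\<one>}"
  proof
    assume "R' \<subseteq> {\<one>}"
    then have "card R' \<le> 1" using card_mono[of "{\<one>}" R'] by simp
    then show False using R'(3) p prime_gt_1_nat[of p] by simp
  qed
  then obtain y where y: "y \<in> R'" "y \<noteq> \<one>" by blast
  have yG: "y \<in> carrier G" using y(1) R'(1) by (meson normal_def subgroup.mem_carrier)
  have "g \<otimes> y = y \<otimes> g" if g: "g \<in> carrier G" for g
  proof -
    have "cnj g y \<otimes> inv y = \<one>" using step g y(1) by blast
    then have "cnj g y = y" using g yG inv_equality[of "cnj g y" "inv y"] by simp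
    then show ?thesis using cnj_eq_iff[OF g yG] by simp
  qed
  then show ?thesis using y R'(2) by blast
qed

lemma normal_in_imp_normal:
  assumes "normal_in H P"
  shows "H \<lhd> G\<lparr>carrier := P\<rparr>"
proof -
  have S: "subgroup H G" "subgroup P G" "H \<subseteq> P" using assms by (auto simp: normal_in_def)
  interpret P: group "G\<lparr>carrier := P\<rparr>" using subgroup.subgroup_is_group[OF S(2) is_group] .
  show ?thesis
  proof (rule P.normal_invI[OF subgroup_incl[OF S]])
    fix x h assume "x \<in> carrier (G\<lparr>carrier := P\<rparr>)" "h \<in> H"
    then show "x \<otimes>\<^bsub>G\<lparr>carrier := P\<rparr>\<^esub> h \<otimes>\<^bsub>G\<lparr>carrier := P\<rparr>\<^esub> inv\<^bsub>G\<lparr>carrier := P\<rparr>\<^esub> x \<in> H"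
      using assms S(2) by (simp add: normal_in_def)
  qed
qed

lemma power_chain_in:
  assumes "prime p" "card P = p ^ e" "normal_in H P" "card H = p ^ a" "i \<le> a"
  shows "\<exists>R. subgroup R G \<and> R \<subseteq> H \<and> card R = p ^ i \<and>
    (\<forall>c\<in>P. \<forall>r\<in>R. (c \<otimes> r) [^] (p ^ i) = c [^] (p ^ i))"
proof -
  have S: "subgroup P G" using assms by (auto simp: normal_in_def)
  interpret P: group "G\<lparr>carrier := P\<rparr>" using subgroup.subgroup_is_group[OF S is_group] .
  have "order (G\<lparr>carrier := P\<rparr>) = p ^ e" using assms(2) by (simp add: order_def)
  from P.normal_power_chain[OF assms(1) this normal_in_imp_normal[OF assms(3)] assms(4,5)]
  obtain R where R: "R \<lhd> G\<lparr>carrier := P\<rparr>" "R \<subseteq> H" "card R = p ^ i"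
    "\<forall>c\<in>P. \<forall>r\<in>R. (c \<otimes> r) [^] (p ^ i) = c [^] (p ^ i)"
    by (auto simp flip: nat_pow_consistent)
  moreover have "subgroup R G" using incl_subgroup[OF S, of R] R(1) by (simp add: normal_def)
  ultimately show ?thesis by blast
qed

lemma central_element_in:
  assumes "prime p" "card P = p ^ e" "normal_in H P" "H \<noteq> {\<one>}"
  shows "\<exists>y\<in>H. y \<noteq> \<one> \<and> (\<forall>g\<in>P. g \<otimes> y = y \<otimes> g)"
proof -
  have S: "subgroup P G" using assms by (auto simp: normal_in_def)
  interpret P: group "G\<lparr>carrier := P\<rparr>" using subgroup.subgroup_is_group[OF S is_group] .
  have "order (G\<lparr>carrier := P\<rparr>) = p ^ e" using assms(2) by (simp add: order_def)
  from P.central_element[OF assms(1) this normal_in_imp_normal[OF assms(3)]] assms(4)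
  show ?thesis by simp
qed


section \<open>Divisibility from orbits of conjugation and translation\<close>

text \<open>Right translation by \<open>N\<close> is free, so all orbits have length
  \<open>card N\<close>.\<close>

lemma rmult_sum_dvd:
  fixes w :: "'a \<Rightarrow> nat"
  assumes N: "subgroup N G" "finite N" and S: "finite S" "S \<subseteq> carrier G"
    and cl: "\<And>x z. x \<in> S \<Longrightarrow> z \<in> N \<Longrightarrow> x \<otimes> z \<in> S"
    and w: "\<And>x z. x \<in> S \<Longrightarrow> z \<in> N \<Longrightarrow> w (x \<otimes> z) = w x"
    and d: "\<And>x. x \<in> S \<Longrightarrow> d dvd card N * w x"
  shows "d dvd sum w S"
proof -
  have NG: "z \<in> carrier G" if "z \<in> N" for z using that subgroup.mem_carrier[OF N(1)] by simp
  have Ni: "inv z \<in> N" if "z \<in> N" for z using that subgroup.m_inv_closed[OF N(1)] by simp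
  interpret GN: group "G\<lparr>carrier := N\<rparr>" using subgroup.subgroup_is_group[OF N(1) is_group] .
  interpret act: finite_action "G\<lparr>carrier := N\<rparr>" "\<lambda>z x. x \<otimes> inv z" S
  proof
    fix a b s assume "a \<in> carrier (G\<lparr>carrier := N\<rparr>)" "b \<in> carrier (G\<lparr>carrier := N\<rparr>)" "s \<in> S"
    then show "s \<otimes> inv (a \<otimes>\<^bsub>G\<lparr>carrier := N\<rparr>\<^esub> b) = s \<otimes> inv b \<otimes> inv a"
      using S(2) NG by (auto simp: inv_mult_group m_assoc subset_iff)
  qed (use N S cl Ni in auto)
  show ?thesis
  proof (rule act.sum_dvd)
    fix s assume s: "s \<in> S"
    then have sG: "s \<in> carrier G" using S by auto
    have "act.stab s = {\<one>}"
    proof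
      show "act.stab s \<subseteq> {\<one>}"
        using NG sG by (auto simp: act.stab_def)
      show "{\<one>} \<subseteq> act.stab s" using subgroup.one_closed[OF N(1)] sG by (auto simp: act.stab_def)
    qed
    then have "card (act.orb s) = card N" using act.card_orb_stab[OF s] by (simp add: order_def)
    then show "d dvd card (act.orb s) * w s" using d s by simp
  qed (use w Ni in auto)
qed

text \<open>The stabilizer of \<open>x\<close> is \<open>H \<inter> cent G x\<close>. A weight
  divisible by its order makes up exactly for what the orbit length lacks to
  \<open>card H\<close>.\<close>

lemma cnj_sum_dvd:
  fixes w :: "'a \<Rightarrow> nat"
  assumes H: "subgroup H G" "finite H" and S: "finite S" "S \<subseteq> carrier G"
    and cl: "\<And>h x. h \<in> H \<Longrightarrow> x \<in> S \<Longrightarrow> cnj h x \<in> S"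
    and w: "\<And>h x. h \<in> H \<Longrightarrow> x \<in> S \<Longrightarrow> w (cnj h x) = w x"
    and d: "\<And>x. x \<in> S \<Longrightarrow> card (H \<inter> cent G x) dvd w x"
  shows "card H dvd sum w S"
proof -
  interpret act: finite_action "G\<lparr>carrier := H\<rparr>" cnj S
    by (rule finite_action_cnj[OF H S cl])
  show ?thesis
  proof (rule act.sum_dvd)
    fix s assume s: "s \<in> S"
    have "act.stab s = H \<inter> cent G s"
      using cent_iff[of _ s] subgroup.mem_carrier[OF H(1)] s S(2) by (auto simp: act.stab_def)
    then have "card (act.orb s) * card (H \<inter> cent G s) = card H"
      using act.card_orb_stab[OF s] by (simp add: order_def)
    moreover have "card (act.orb s) * card (H \<inter> cent G s) dvd card (act.orb s) * w s"
      using d[OF s] by simp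
    ultimately show "card H dvd card (act.orb s) * w s" by simp
  qed (use w in auto)
qed

text \<open>The direct product of \<open>H\<close> and \<open>N\<close> acts, since conjugation by
  \<open>H\<close> fixes \<open>N\<close> pointwise. The orbit of \<open>x\<close> contains the
  \<open>p\<close> translates of \<open>x\<close> by \<open>N\<close>, and by \<open>out\<close> one
  element more; being a power of \<open>p\<close>, its length is then a multiple of
  \<open>p\<^sup>2\<close>.\<close>

lemma cnj_rmult_sum_dvd:
  fixes w :: "'a \<Rightarrow> nat"
  assumes p: "prime p" and H: "subgroup H G" "card H = p ^ a" and N: "subgroup N G" "card N = p" "N \<subseteq> H"
    and comm: "\<And>h z. h \<in> H \<Longrightarrow> z \<in> N \<Longrightarrow> h \<otimes> z = z \<otimes> h"
    and S: "finite S" "S \<subseteq> carrier G"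
    and cl: "\<And>h x. h \<in> H \<Longrightarrow> x \<in> S \<Longrightarrow> cnj h x \<in> S" "\<And>x z. x \<in> S \<Longrightarrow> z \<in> N \<Longrightarrow> x \<otimes> z \<in> S"
    and w: "\<And>h x. h \<in> H \<Longrightarrow> x \<in> S \<Longrightarrow> w (cnj h x) = w x"
      "\<And>x z. x \<in> S \<Longrightarrow> z \<in> N \<Longrightarrow> w (x \<otimes> z) = w x"
    and d: "\<And>x. x \<in> S \<Longrightarrow> m dvd w x"
    and out: "\<And>x. x \<in> S \<Longrightarrow> \<exists>h\<in>H. inv x \<otimes> cnj h x \<notin> N"
  shows "p\<^sup>2 * m dvd sum w S"
proof -
  have HG: "h \<in> carrier G" if "h \<in> H" for h using that subgroup.mem_carrier[OF H(1)] by simp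
  have NG: "h \<in> carrier G" if "h \<in> N" for h using that subgroup.mem_carrier[OF N(1)] by simp
  have SG: "h \<in> carrier G" if "h \<in> S" for h using that S by auto
  have p0: "p > 0" using p prime_gt_0_nat by blast
  have fH: "finite H" using H(2) p0 by (metis card_ge_0_finite zero_less_power)
  have fN: "finite N" using N(2) p0 by (metis card_ge_0_finite)
  interpret GH: group "G\<lparr>carrier := H\<rparr>" using subgroup.subgroup_is_group[OF H(1) is_group] .
  interpret GN: group "G\<lparr>carrier := N\<rparr>" using subgroup.subgroup_is_group[OF N(1) is_group] .
  define A where "A = G\<lparr>carrier := H\<rparr> \<times>\<times> G\<lparr>carrier := N\<rparr>"
  interpret A: group A unfolding A_def by (rule DirProd_group[OF GH.is_group GN.is_group])
  have cA: "carrier A = H \<times> N" by (simp add: A_def DirProd_def)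
  have oA: "order A = p ^ Suc a" by (simp add: order_def cA card_cartesian_product H(2) N(2))
  define f where "f = (\<lambda>(h, z) x. cnj h x \<otimes> z)"
  interpret act: finite_action A f S
  proof
    show "finite (carrier A)" using cA fH fN by simp
    show "finite S" by fact
    show "f t s \<in> S" if "t \<in> carrier A" "s \<in> S" for t s using that cl cA by (auto simp: f_def)
    show "f \<one>\<^bsub>A\<^esub> s = s" if "s \<in> S" for s using that SG by (simp add: f_def A_def)
    fix s t x assume "s \<in> carrier A" "t \<in> carrier A" and x: "x \<in> S"
    then obtain h z k y where st: "s = (h, z)" "t = (k, y)" "h \<in> H" "z \<in> N" "k \<in> H" "y \<in> N"
      using cA by auto
    note G = SG[OF x] HG[OF st(3)] HG[OF st(5)] NG[OF st(4)] NG[OF st(6)]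
    have "cnj h y = y" using comm[OF st(3,6)] cnj_eq_iff[of h y] G by blast
    then have "cnj h (cnj k x \<otimes> y) \<otimes> z = cnj (h \<otimes> k) x \<otimes> y \<otimes> z"
      using cnj_mult[of h "cnj k x" y] cnj_cnj[of h k x] G by simp
    also have "\<dots> = cnj (h \<otimes> k) x \<otimes> (z \<otimes> y)"
      using comm[of y z] st(4,6) N(3) G by (simp add: m_assoc subset_iff)
    finally show "f (s \<otimes>\<^bsub>A\<^esub> t) x = f s (f t x)" using st by (simp add: f_def A_def)
  qed
  show ?thesis
  proof (rule act.sum_dvd)
    fix t x assume "t \<in> carrier A" and x: "x \<in> S"
    then show "w (f t x) = w x" using cA w cl(1) by (auto simp: f_def)
  next
    fix x assume x: "x \<in> S"
    obtain h where h: "h \<in> H" "inv x \<otimes> cnj h x \<notin> N" using out[OF x] by blast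
    have "(\<lambda>z. x \<otimes> z) ` N \<subseteq> act.orb x"
    proof
      fix y assume "y \<in> (\<lambda>z. x \<otimes> z) ` N"
      then obtain z where z: "z \<in> N" "y = x \<otimes> z" by auto
      then have "y = f (\<one>, z) x" using SG[OF x] by (simp add: f_def)
      then show "y \<in> act.orb x" unfolding act.orb_def cA using z subgroup.one_closed[OF H(1)] by auto
    qed
    moreover have "cnj h x \<in> act.orb x"
    proof -
      have "cnj h x = f (h, \<one>) x" using SG[OF x] HG[OF h(1)] by (simp add: f_def)
      then show ?thesis unfolding act.orb_def cA using h subgroup.one_closed[OF N(1)] by auto
    qed
    moreover have "cnj h x \<notin> (\<lambda>z. x \<otimes> z) ` N"
    proof
      assume "cnj h x \<in> (\<lambda>z. x \<otimes> z) ` N"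
      then obtain z where "z \<in> N" "cnj h x = x \<otimes> z" by auto
      then show False using h(2) SG[OF x] NG by (simp add: m_assoc[symmetric])
    qed
    moreover have "card ((\<lambda>z. x \<otimes> z) ` N) = p"
      using N(2) SG[OF x] NG by (subst card_image) (auto simp: inj_on_def)
    ultimately have "Suc p \<le> card (act.orb x)"
      using card_mono[OF act.finite_orb, of "insert (cnj h x) ((\<lambda>z. x \<otimes> z) ` N)" x] fN by simp
    then have "p ^ 1 < card (act.orb x)" by simp
    from act.prime_power_dvd_card_orb[OF p oA x this] have "p\<^sup>2 dvd card (act.orb x)"
      by (simp add: numeral_2_eq_2)
    then show "p\<^sup>2 * m dvd card (act.orb x) * w x" using d[OF x] by (rule mult_dvd_mono)
  qed
qed

lemma gcd_prime_powers: "gcd (p ^ a) (p ^ b) = (p ^ min a b :: nat)"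
  by (cases "a \<le> b") (simp_all add: le_imp_power_dvd gcd_nat.absorb1 gcd_nat.absorb2 min_def)

text \<open>The solutions are permuted freely by translation with a subgroup \<open>R\<close> of
  \<open>H\<close> whose order is the gcd and whose elements leave \<open>p ^ i\<close>-th powers
  unchanged. \<open>R\<close> may be noncentral, because there are no further entries whose
  commutation with \<open>x\<close> has to survive.\<close>

lemma hall_prime_power:
  assumes p: "prime p" and P: "card P = p ^ e" and HP: "normal_in H P" and K: "coset_in H P K"
  shows "gcd (card H) (p ^ n) dvd card {x \<in> K. x [^] (p ^ n) = \<one>}"
proof -
  have S: "subgroup H G" "subgroup P G" "H \<subseteq> P" using HP by (auto simp: normal_in_def)
  have p0: "p > 0" using p prime_gt_0_nat by blast
  obtain a where a: "card H = p ^ a"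
    using card_subgroup_prime_power[OF p P S] by blast
  define i where "i = min a n"
  have g: "gcd (card H) (p ^ n) = p ^ i" unfolding a i_def by (rule gcd_prime_powers)
  obtain R where R: "subgroup R G" "R \<subseteq> H" "card R = p ^ i"
    and RP: "\<forall>c\<in>P. \<forall>r\<in>R. (c \<otimes> r) [^] (p ^ i) = c [^] (p ^ i)"
    using power_chain_in[OF p P HP a, of i] by (auto simp: i_def)
  have KP: "K \<subseteq> P" using K by (simp add: coset_in_def)
  have PG: "P \<subseteq> carrier G" using S(2) subgroup.subset by blast
  have fP: "finite P" using P p0 by (metis card_ge_0_finite zero_less_power)
  have "p ^ i dvd (\<Sum>x\<in>{x \<in> K. x [^] (p ^ n) = \<one>}. 1)"
  proof (rule rmult_sum_dvd[OF R(1)])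
    show "finite R" by (rule finite_subset[OF subset_trans[OF R(2) S(3)] fP])
    show "finite {x \<in> K. x [^] (p ^ n) = \<one>}" by (rule finite_subset[OF _ fP]) (use KP in auto)
    show "{x \<in> K. x [^] (p ^ n) = \<one>} \<subseteq> carrier G" using KP PG by auto
  next
    fix x z assume x: "x \<in> {x \<in> K. x [^] (p ^ n) = \<one>}" and z: "z \<in> R"
    then have G: "x \<in> carrier G" "z \<in> carrier G" "x \<in> P" using KP PG R(2) S(3) by auto
    have n: "p ^ n = p ^ i * p ^ (n - i)" by (simp add: i_def flip: power_add)
    have "(x \<otimes> z) [^] (p ^ n) = ((x \<otimes> z) [^] (p ^ i)) [^] (p ^ (n - i))"
      unfolding n using G by (simp add: nat_pow_pow)
    also have "\<dots> = (x [^] (p ^ i)) [^] (p ^ (n - i))" using RP G z by simp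
    also have "\<dots> = x [^] (p ^ n)" unfolding n using G by (simp add: nat_pow_pow)
    finally have "(x \<otimes> z) [^] (p ^ n) = \<one>" using x by simp
    moreover have "x \<otimes> z \<in> K" using coset_in_mult[OF HP K] x z R(2) by blast
    ultimately show "x \<otimes> z \<in> {x \<in> K. x [^] (p ^ n) = \<one>}" by simp
  qed (simp_all add: R(3))
  then show ?thesis unfolding g by simp
qed

text \<open>The collection formula in class two. Moving \<open>x\<close> to the left past
  \<open>z [^] j\<close> leaves \<open>n [^] j\<close>, so the exponents of \<open>n\<close> add up
  to a binomial coefficient.\<close>

lemma power_commutator:
  assumes G: "x \<in> carrier G" "z \<in> carrier G" "n \<in> carrier G"
    and c: "z \<otimes> x = x \<otimes> z \<otimes> n" "n \<otimes> x = x \<otimes> n" "n \<otimes> z = z \<otimes> n"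
  shows "(x \<otimes> z) [^] (k::nat) = x [^] k \<otimes> z [^] k \<otimes> n [^] (\<Sum>i<k. i)"
proof -
  have nx: "n [^] (j::nat) \<otimes> y = y \<otimes> n [^] j" if "n \<otimes> y = y \<otimes> n" "y \<in> carrier G" for y j
    using subgroup_nat_pow[OF subgroup_cent, of y n j] that G by (simp add: cent_def)
  have zx: "z [^] (j::nat) \<otimes> x = x \<otimes> z [^] j \<otimes> n [^] j" for j
  proof (induction j)
    case (Suc j)
    have "z [^] Suc j \<otimes> x = z [^] j \<otimes> x \<otimes> z \<otimes> n" using G c(1) by (simp add: m_assoc)
    also have "\<dots> = x \<otimes> z [^] j \<otimes> (n [^] j \<otimes> z) \<otimes> n" using Suc G by (simp add: m_assoc)
    also have "\<dots> = x \<otimes> z [^] Suc j \<otimes> n [^] Suc j" using nx[OF c(3) G(2), of j] G by (simp add: m_assoc)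
    finally show ?case .
  qed (use G in simp)
  show ?thesis
  proof (induction k)
    case (Suc k)
    let ?t = "\<Sum>i<k. i"
    have "(x \<otimes> z) [^] Suc k = x [^] k \<otimes> z [^] k \<otimes> (n [^] ?t \<otimes> x) \<otimes> z" using Suc G by (simp add: m_assoc)
    also have "\<dots> = x [^] k \<otimes> (z [^] k \<otimes> x) \<otimes> (n [^] ?t \<otimes> z)" using nx[OF c(2) G(1)] G by (simp add: m_assoc)
    also have "\<dots> = x [^] k \<otimes> (z [^] k \<otimes> x) \<otimes> (z \<otimes> n [^] ?t)" unfolding nx[OF c(3) G(2)] ..
    also have "\<dots> = x [^] k \<otimes> x \<otimes> z [^] k \<otimes> (n [^] k \<otimes> z) \<otimes> n [^] ?t"
      unfolding zx using G by (simp add: m_assoc)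
    also have "\<dots> = x [^] Suc k \<otimes> z [^] Suc k \<otimes> (n [^] k \<otimes> n [^] ?t)"
      unfolding nx[OF c(3) G(2)] using G by (simp add: m_assoc)
    also have "n [^] k \<otimes> n [^] ?t = n [^] (\<Sum>i<Suc k. i)" using G by (simp add: nat_pow_mult add.commute)
    finally show ?case .
  qed (use G in simp)
qed

lemma power_square_commutator:
  assumes G: "x \<in> carrier G" "z \<in> carrier G" "n \<in> carrier G"
    and c: "z \<otimes> x = x \<otimes> z \<otimes> n" "n \<otimes> x = x \<otimes> n" "n \<otimes> z = z \<otimes> n"
    and o: "n [^] p = \<one>" "z [^] p\<^sup>2 = \<one>"
  shows "(x \<otimes> z) [^] p\<^sup>2 = x [^] (p\<^sup>2 :: nat)"
proof -
  \<comment> \<open>Halving \<open>p\<^sup>2 * (p\<^sup>2 - 1)\<close> leaves at least one factor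
    \<open>p\<close>, also for \<open>p = 2\<close>. With exponent \<open>p\<close> instead of
    \<open>p\<^sup>2\<close> this would fail at \<open>p = 2\<close>.\<close>
  have "even (p * (p\<^sup>2 - 1))" by (cases "even p") auto
  then obtain t where t: "p * (p\<^sup>2 - 1) = 2 * t" by blast
  have "2 * (\<Sum>i<m. i) = m * (m - 1)" for m :: nat
    by (induction m) (auto simp: algebra_simps)
  from this[of "p\<^sup>2"] have "2 * (\<Sum>i<p\<^sup>2. i) = p * (p * (p\<^sup>2 - 1))" by (simp add: power2_eq_square)
  then have "(\<Sum>i<p\<^sup>2. i) = p * t" unfolding t by simp
  then have "n [^] (\<Sum>i<p\<^sup>2. i) = \<one>" using G o(1) by (simp flip: nat_pow_pow)
  then show ?thesis using power_commutator[OF G c, of "p\<^sup>2"] o(2) G by simp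
qed


section \<open>Invariance of the number of completions\<close>

lemma coset_in_carrier: "normal_in H P \<Longrightarrow> coset_in H P K \<Longrightarrow> K \<subseteq> carrier G"
  using normal_in_carrier(2)[of H P] by (auto simp: coset_in_def)

lemma com_tuples_in:
  assumes "normal_in H P" "\<forall>s\<in>set r. coset_in H P (fst s)" "xs \<in> com_tuples G r"
  shows "set xs \<subseteq> carrier G"
  using com_tuples_set[OF assms(3)] coset_in_carrier[OF assms(1)] assms(2) by blast

text \<open>Conjugation by \<open>h\<close> preserves the prescribed cosets and carries tuples
  inside \<open>C\<close> to tuples inside \<open>C'\<close>. The pair \<open>C\<close>,
  \<open>C'\<close> is kept general because both centralizers of elements and stabilizers of lists
  of cosets occur; in both cases the lemma makes a weight constant on orbits.\<close>

lemma card_com_tuples_restr_cnj: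
  assumes HP: "normal_in H P" and r: "\<forall>s\<in>set r. coset_in H P (fst s)" and h: "h \<in> H"
    and C: "\<And>y. y \<in> carrier G \<Longrightarrow> cnj h y \<in> C' \<longleftrightarrow> y \<in> C"
  shows "card (com_tuples G (restr C' r)) = card (com_tuples G (restr C r))"
proof -
  have hG: "h \<in> carrier G" and hi: "inv h \<in> H"
    using HP h normal_in_carrier[OF HP] subgroup.m_inv_closed[of H G h] by (auto simp: normal_in_def)
  have cl: "\<forall>s\<in>set r. fst s \<subseteq> carrier G \<and> (\<forall>k\<in>fst s. cnj g k \<in> fst s)" if "g \<in> H" for g
    using that r coset_in_cnj[OF HP] coset_in_carrier[OF HP] by blast
  have G: "set xs \<subseteq> carrier G" if "xs \<in> com_tuples G (restr C r)" for xs C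
    using com_tuples_in[OF HP r] that by (simp add: com_tuples_restr)
  have conj_back: "map (cnj h) (map (cnj (inv h)) a) = a" if "set a \<subseteq> carrier G" for a
    using subsetD[OF that] cnj_inv_cancel(1)[OF hG] unfolding map_map comp_def by (intro map_idI) blast
  have "bij_betw (map (cnj h)) (com_tuples G (restr C r)) (com_tuples G (restr C' r))"
  proof (rule bij_betw_byWitness[where f' = "map (cnj (inv h))"])
    show "\<forall>a\<in>com_tuples G (restr C r). map (cnj (inv h)) (map (cnj h) a) = a"
    proof
      fix a assume "a \<in> com_tuples G (restr C r)"
      then have "\<forall>y\<in>set a. cnj (inv h) (cnj h y) = y" using G[of a] cnj_inv_cancel(2)[OF hG] by blast
      then show "map (cnj (inv h)) (map (cnj h) a) = a"
        unfolding map_map comp_def by (intro map_idI) blast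
    qed
    show "\<forall>a\<in>com_tuples G (restr C' r). map (cnj h) (map (cnj (inv h)) a) = a"
      using conj_back G by blast
    show "map (cnj h) ` com_tuples G (restr C r) \<subseteq> com_tuples G (restr C' r)"
    proof
      fix b assume "b \<in> map (cnj h) ` com_tuples G (restr C r)"
      then obtain a where a: "a \<in> com_tuples G r" "set a \<subseteq> C" "b = map (cnj h) a" "set a \<subseteq> carrier G"
        using G by (auto simp: com_tuples_restr)
      have "b \<in> com_tuples G r" using com_tuples_cnj[OF hG a(1) cl[OF h]] a(3) by simp
      then show "b \<in> com_tuples G (restr C' r)" using a C by (auto simp: com_tuples_restr)
    qed
    show "map (cnj (inv h)) ` com_tuples G (restr C' r) \<subseteq> com_tuples G (restr C r)"
    proof
      fix b assume "b \<in> map (cnj (inv h)) ` com_tuples G (restr C' r)"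
      then obtain a where a: "a \<in> com_tuples G r" "set a \<subseteq> C'" "b = map (cnj (inv h)) a" "set a \<subseteq> carrier G"
        using G by (auto simp: com_tuples_restr)
      have "b \<in> com_tuples G r" using com_tuples_cnj[OF _ a(1) cl[OF hi]] hG a(3) by simp
      moreover have "cnj (inv h) y \<in> C" if "y \<in> set a" for y
      proof -
        have yG: "y \<in> carrier G" using that a(4) by blast
        have "cnj h (cnj (inv h) y) = y" by (rule cnj_inv_cancel(1)[OF hG yG])
        then have "cnj h (cnj (inv h) y) \<in> C'" using that a(2) by auto
        then show ?thesis using C[of "cnj (inv h) y"] hG yG by blast
      qed
      ultimately show "b \<in> com_tuples G (restr C r)" using a(3) by (auto simp: com_tuples_restr)
    qed
  qed
  then show ?thesis by (simp add: bij_betw_same_card)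
qed

lemma cnj_cent_iff:
  assumes "g \<in> carrier G" "x \<in> carrier G" "y \<in> carrier G"
  shows "cnj g y \<in> cent G (cnj g x) \<longleftrightarrow> y \<in> cent G x"
proof
  assume "cnj g y \<in> cent G (cnj g x)"
  then have "cnj (inv g) (cnj g y) \<in> cent G (cnj (inv g) (cnj g x))"
    using cnj_cent[of "inv g" "cnj g x" "cnj g y"] assms by blast
  then show "y \<in> cent G x" unfolding cnj_inv_cancel(2)[OF assms(1,3)] cnj_inv_cancel(2)[OF assms(1,2)] .
qed (rule cnj_cent[OF assms(1,2)])

lemma card_cent_cnj:
  assumes HP: "normal_in H P" and h: "h \<in> H" and x: "x \<in> carrier G"
  shows "card (H \<inter> cent G (cnj h x)) = card (H \<inter> cent G x)"
proof -
  have sH: "subgroup H G" using HP by (simp add: normal_in_def)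
  have hG: "h \<in> carrier G" and hi: "inv h \<in> H"
    using h subgroup.mem_carrier[OF sH] subgroup.m_inv_closed[OF sH] by auto
  have cl: "cnj g k \<in> H" if "g \<in> H" "k \<in> H" for g k
    using that subgroup.m_closed[OF sH] subgroup.m_inv_closed[OF sH] by simp
  have "bij_betw (cnj h) (H \<inter> cent G x) (H \<inter> cent G (cnj h x))"
  proof (rule bij_betw_byWitness[where f' = "cnj (inv h)"])
    show "\<forall>a\<in>H \<inter> cent G x. cnj (inv h) (cnj h a) = a" 
      "\<forall>a\<in>H \<inter> cent G (cnj h x). cnj h (cnj (inv h) a) = a"
      using cnj_inv_cancel[OF hG] subgroup.mem_carrier[OF sH] by blast+
    show "cnj h ` (H \<inter> cent G x) \<subseteq> H \<inter> cent G (cnj h x)"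
      using cl[OF h] cnj_cent[OF hG x] by blast
    show "cnj (inv h) ` (H \<inter> cent G (cnj h x)) \<subseteq> H \<inter> cent G x"
      using cl[OF hi] cnj_cent[of "inv h" "cnj h x"] cnj_inv_cancel(2)[OF hG x] hG x by auto
  qed
  then show ?thesis by (simp add: bij_betw_same_card)
qed

lemma cent_mult_iff:
  assumes "y \<in> carrier G" "x \<in> carrier G" "z \<in> carrier G" "y \<otimes> z = z \<otimes> y"
  shows "y \<in> cent G (x \<otimes> z) \<longleftrightarrow> y \<in> cent G x"
proof -
  have "y \<otimes> (x \<otimes> z) = (y \<otimes> x) \<otimes> z" "(x \<otimes> z) \<otimes> y = (x \<otimes> y) \<otimes> z"
    using assms by (simp_all add: m_assoc)
  then show ?thesis using assms by (simp add: cent_def)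
qed

text \<open>This is the class equation for the action of \<open>H\<close> on the tuples: the elements of \<open>K\<close>
  commuting with a given tuple form a coset of its stabilizer, if there are any.\<close>

lemma unrestricted_sum_dvd:
  assumes HP: "normal_in H P" and fP: "finite P" and K: "coset_in H P K"
    and r: "\<forall>s\<in>set r. coset_in H P (fst s)"
  shows "card H dvd (\<Sum>x\<in>K. card (com_tuples G (restr (cent G x) r)))"
proof -
  have sH: "subgroup H G" "H \<subseteq> P" using HP by (auto simp: normal_in_def)
  have HG: "h \<in> carrier G" if "h \<in> H" for h using that subgroup.mem_carrier[OF sH(1)] by simp
  have KG: "k \<in> carrier G" if "k \<in> K" for k using that coset_in_carrier[OF HP K] by blast
  have fK: "finite K" using K fP finite_subset by (auto simp: coset_in_def)
  have fr: "finite (com_tuples G r)"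
    by (rule finite_com_tuples) (use r fP in \<open>meson coset_in_def finite_subset\<close>)
  have fH: "finite H" using sH(2) fP finite_subset by blast
  have inG: "set xs \<subseteq> carrier G" if "xs \<in> com_tuples G r" for xs using com_tuples_in[OF HP r that] .
  \<comment> \<open>Pairs of an \<open>x\<close> and a commuting tuple are counted by the tuple
    instead of by \<open>x\<close>.\<close>
  define w where "w xs = card {x \<in> K. set xs \<subseteq> cent G x}" for xs
  have "(\<Sum>x\<in>K. card (com_tuples G (restr (cent G x) r))) =
      (\<Sum>x\<in>K. \<Sum>xs\<in>com_tuples G r. of_bool (set xs \<subseteq> cent G x))"
    using fr by (simp add: com_tuples_restr sum.If_cases of_bool_def Int_def conj_commute)
  also have "\<dots> = (\<Sum>xs\<in>com_tuples G r. \<Sum>x\<in>K. of_bool (set xs \<subseteq> cent G x))" by (rule sum.swap)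
  also have "\<dots> = sum w (com_tuples G r)"
    using fK by (simp add: w_def sum.If_cases of_bool_def Int_def conj_commute)
  also have "card H dvd \<dots>"
  proof -
    interpret act: finite_action "G\<lparr>carrier := H\<rparr>" "\<lambda>h. map (cnj h)" "com_tuples G r"
    proof (rule finite_action.intro)
      show "group (G\<lparr>carrier := H\<rparr>)" using subgroup.subgroup_is_group[OF sH(1) is_group] .
      show "finite_action_axioms (G\<lparr>carrier := H\<rparr>) (\<lambda>h. map (cnj h)) (com_tuples G r)"
      proof
        show "finite (carrier (G\<lparr>carrier := H\<rparr>))" "finite (com_tuples G r)" using fH fr by auto
        fix a xs assume a: "a \<in> carrier (G\<lparr>carrier := H\<rparr>)" and xs: "xs \<in> com_tuples G r"
        have "\<forall>s\<in>set r. fst s \<subseteq> carrier G \<and> (\<forall>k\<in>fst s. cnj a k \<in> fst s)"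
          using a r coset_in_cnj[OF HP] coset_in_carrier[OF HP] by auto
        then show "map (cnj a) xs \<in> com_tuples G r" using com_tuples_cnj[OF _ xs] a HG by auto
        fix b assume b: "b \<in> carrier (G\<lparr>carrier := H\<rparr>)"
        show "map (cnj (a \<otimes>\<^bsub>G\<lparr>carrier := H\<rparr>\<^esub> b)) xs = map (cnj a) (map (cnj b) xs)"
          using a b HG inG[OF xs] cnj_cnj[of a b] by (auto simp: subset_iff)
      next
        fix xs assume "xs \<in> com_tuples G r"
        then show "map (cnj \<one>\<^bsub>G\<lparr>carrier := H\<rparr>\<^esub>) xs = xs"
          using subsetD[OF inG] by (auto intro!: map_idI)
      qed
    qed
    show ?thesis
    proof (rule act.sum_dvd)
      fix h xs assume "h \<in> carrier (G\<lparr>carrier := H\<rparr>)" and xs: "xs \<in> com_tuples G r"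
      then have h: "h \<in> H" "h \<in> carrier G" "inv h \<in> H"
        using HG subgroup.m_inv_closed[OF sH(1)] by auto
      have sub: "cnj g x \<in> {x \<in> K. set (map (cnj g) ys) \<subseteq> cent G x}"
        if "g \<in> H" "x \<in> {x \<in> K. set ys \<subseteq> cent G x}" for g x ys
        using that coset_in_cnj[OF HP K] cnj_cent[OF HG KG] by auto
      have canc: "map (cnj (inv h)) (map (cnj h) xs) = xs"
        using inG[OF xs] cnj_inv_cancel(2)[OF h(2)] by (auto intro!: map_idI)
      have "bij_betw (cnj h) {x \<in> K. set xs \<subseteq> cent G x} {x \<in> K. set (map (cnj h) xs) \<subseteq> cent G x}"
      proof (rule bij_betw_byWitness[where f' = "cnj (inv h)"])
        show "\<forall>a\<in>{x \<in> K. set xs \<subseteq> cent G x}. cnj (inv h) (cnj h a) = a"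
          "\<forall>a\<in>{x \<in> K. set (map (cnj h) xs) \<subseteq> cent G x}. cnj h (cnj (inv h) a) = a"
          using KG cnj_inv_cancel[OF h(2)] by blast+
        show "cnj h ` {x \<in> K. set xs \<subseteq> cent G x} \<subseteq> {x \<in> K. set (map (cnj h) xs) \<subseteq> cent G x}"
          using sub[OF h(1)] by blast
        show "cnj (inv h) ` {x \<in> K. set (map (cnj h) xs) \<subseteq> cent G x} \<subseteq> {x \<in> K. set xs \<subseteq> cent G x}"
          using sub[OF h(3), of _ "map (cnj h) xs"] unfolding canc by blast
      qed
      then show "w (map (cnj h) xs) = w xs" unfolding w_def by (simp add: bij_betw_same_card)
    next
      fix xs assume xs: "xs \<in> com_tuples G r"
      show "card H dvd card (act.orb xs) * w xs"
      proof (cases "{x \<in> K. set xs \<subseteq> cent G x} = {}")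
        case True then show ?thesis unfolding w_def by (simp only: card.empty) simp
      next
        case False
        then obtain k where k: "k \<in> K" "set xs \<subseteq> cent G k" by blast
        have st: "act.stab xs = {h \<in> H. set xs \<subseteq> cent G h}"
        proof -
          have "map (cnj h) xs = xs \<longleftrightarrow> set xs \<subseteq> cent G h" if "h \<in> H" for h
          proof -
            have "map (cnj h) xs = xs \<longleftrightarrow> (\<forall>y\<in>set xs. cnj h y = y)" 
              using map_eq_conv[of "cnj h" xs "\<lambda>y. y"] by simp
            then show ?thesis using inG[OF xs] cent_iff[OF HG[OF that]] cent_sym[OF HG[OF that]] by blast
          qed
          then show ?thesis by (auto simp: act.stab_def)
        qed
        have "bij_betw (\<lambda>h. k \<otimes> h) {h \<in> H. set xs \<subseteq> cent G h} {x \<in> K. set xs \<subseteq> cent G x}"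
        proof (rule bij_betw_byWitness[where f' = "\<lambda>h. inv k \<otimes> h"])
          show "\<forall>a\<in>{h \<in> H. set xs \<subseteq> cent G h}. inv k \<otimes> (k \<otimes> a) = a"
            using HG KG[OF k(1)] by (simp flip: m_assoc)
          show "\<forall>a\<in>{x \<in> K. set xs \<subseteq> cent G x}. k \<otimes> (inv k \<otimes> a) = a"
            using KG k(1) by (simp flip: m_assoc)
          show "(\<lambda>h. k \<otimes> h) ` {h \<in> H. set xs \<subseteq> cent G h} \<subseteq> {x \<in> K. set xs \<subseteq> cent G x}"
          proof safe
            fix h assume h: "h \<in> H" "set xs \<subseteq> cent G h"
            show "k \<otimes> h \<in> K" using coset_in_mult[OF HP K k(1) h(1)] .
            fix y assume y: "y \<in> set xs"
            then have "y \<otimes> h = h \<otimes> y" using h(2) by (auto simp: cent_def)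
            then show "y \<in> cent G (k \<otimes> h)"
              using cent_mult_iff[of y k h] y inG[OF xs] KG[OF k(1)] HG[OF h(1)] k(2) by blast
          qed
          show "(\<lambda>h. inv k \<otimes> h) ` {x \<in> K. set xs \<subseteq> cent G x} \<subseteq> {h \<in> H. set xs \<subseteq> cent G h}"
          proof safe
            fix x assume x: "x \<in> K" "set xs \<subseteq> cent G x"
            show "inv k \<otimes> x \<in> H" using K x(1) k(1) by (auto simp: coset_in_def)
            fix y assume y: "y \<in> set xs"
            have yG: "y \<in> carrier G" using y inG[OF xs] by blast
            have "subgroup (cent G y) G" by (rule subgroup_cent[OF yG])
            moreover have "k \<in> cent G y" "x \<in> cent G y"
              using y k x cent_sym[OF yG KG] by blast+
            ultimately have "inv k \<otimes> x \<in> cent G y"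
              by (simp add: subgroup.m_closed subgroup.m_inv_closed)
            then show "y \<in> cent G (inv k \<otimes> x)"
              using cent_sym[OF yG, of "inv k \<otimes> x"] KG x(1) k(1) by simp
          qed
        qed
        then have "w xs = card (act.stab xs)" unfolding st w_def by (simp add: bij_betw_same_card)
        moreover have "card (act.orb xs) * card (act.stab xs) = card H"
          using act.card_orb_stab[OF xs] by (simp add: order_def)
        ultimately show ?thesis by simp
      qed
    qed
  qed
  finally show ?thesis .
qed

end

section \<open>Prime power groups\<close>

text \<open>If \<open>x\<close> has a completion at all, this supplies an element commuting with
  \<open>x\<close> in each of the remaining prescribed cosets.\<close>

lemma com_tuples_meet: "xs \<in> com_tuples G r \<Longrightarrow> s \<in> set r \<Longrightarrow> \<exists>y\<in>set xs. y \<in> fst s"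
proof (induction r arbitrary: xs)
  case (Cons t r)
  then obtain x ys where x: "xs = x # ys" "x \<in> fst t" "ys \<in> com_tuples G r" by auto
  then show ?case using Cons.IH[OF x(3)] Cons.prems(2) by auto
qed simp

text \<open>The orders of the cyclic factors in the order of splitting off. Only the last, which is
  left to Hall's theorem, may be an arbitrary power of \<open>p\<close>.\<close>

inductive admissible :: "nat \<Rightarrow> nat list \<Rightarrow> bool" for p where
  admissible_Nil: "admissible p []"
| admissible_single: "admissible p [p ^ n]"
| admissible_Cons: "admissible p qs \<Longrightarrow> q = p \<or> q = p\<^sup>2 \<Longrightarrow> admissible p (q # qs)"

lemma admissible_prod: "admissible p qs \<Longrightarrow> \<exists>b. prod_list qs = p ^ b"
proof (induction rule: admissible.induct)
  case (admissible_Cons qs q)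
  then show ?case by (metis power_Suc power_add prod_list.Cons)
qed (auto intro: exI[of _ 0])

lemma admissible_power: "admissible p qs \<Longrightarrow> q \<in> set qs \<Longrightarrow> \<exists>b. q = p ^ b"
proof (induction rule: admissible.induct)
  case (admissible_Cons qs q')
  have "p = p ^ 1" by simp
  then show ?case using admissible_Cons by (metis set_ConsD)
qed auto

context group
begin

text \<open>The library theorem \<open>sylow_thm\<close> allows the cofactor to contain further
  factors \<open>p\<close>, so it yields subgroups of every prime power order dividing the group
  order.\<close>

lemma subgroup_of_prime_power_order:
  assumes "prime p" "subgroup Y G" "card Y = p ^ c" "i \<le> c"
  shows "\<exists>N. subgroup N G \<and> N \<subseteq> Y \<and> card N = p ^ i"
proof -
  interpret Y: group "G\<lparr>carrier := Y\<rparr>" using subgroup.subgroup_is_group[OF assms(2) is_group] .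
  have o: "order (G\<lparr>carrier := Y\<rparr>) = p ^ i * p ^ (c - i)"
    using assms(3,4) by (simp add: order_def flip: power_add)
  have "finite (carrier (G\<lparr>carrier := Y\<rparr>))"
    by (rule Y.finite_carrier_prime_power[OF assms(1), of c]) (simp add: order_def assms(3))
  from sylow_thm[OF assms(1) Y.is_group o this]
  obtain N where N: "subgroup N (G\<lparr>carrier := Y\<rparr>)" "card N = p ^ i" by blast
  then show ?thesis using incl_subgroup[OF assms(2) N(1)] subgroup.subset[OF N(1)] by auto
qed

lemma pow_card_subgroup:
  assumes "subgroup N G" "x \<in> N" 
  shows "x [^] card N = \<one>"
proof -
  interpret N: group "G\<lparr>carrier := N\<rparr>" using subgroup.subgroup_is_group[OF assms(1) is_group] .
  show ?thesis using N.pow_order_eq_1[of x] assms(2) by (simp add: order_def flip: nat_pow_consistent)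
qed

text \<open>Here \<open>w x\<close> counts the tuples completing the first entry \<open>x\<close>. An \<open>x\<close> with small centralizer in
  \<open>H\<close> (the set \<open>small\<close>) is handled by its \<open>H\<close>-orbit, the others by multiplication with central
  elements (\<open>Y\<close>), combined with conjugation if \<open>Y\<close> has order \<open>p\<close> but \<open>q = p\<^sup>2\<close>. This last step fails for
  the set \<open>X\<close> of elements that act trivially on \<open>H\<close> modulo \<open>Y\<close>. All \<open>x \<in> X\<close> with \<open>w x \<noteq> 0\<close> have the same
  \<open>q\<close>-th power, so the condition \<open>x [^] q = \<one>\<close> can be dropped on \<open>X\<close>, and \<open>unrestricted_sum_dvd\<close>
  applies.\<close>

lemma peel_factor:
  fixes r :: "('a set \<times> nat) list"
  defines "w \<equiv> \<lambda>x. card (com_tuples G (restr (cent G x) r))"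
  assumes p: "prime p" and P: "card P = p ^ e" and HP: "normal_in H P" and K: "coset_in H P K"
    and r: "\<forall>s\<in>set r. coset_in H P (fst s)"
    and IH: "\<And>x. x \<in> K \<Longrightarrow> gcd (card (H \<inter> cent G x)) (p ^ b) dvd w x"
    and q: "q = p \<or> q = p\<^sup>2"
  shows "gcd (card H) (q * p ^ b) dvd (\<Sum>x | x \<in> K \<and> x [^] q = \<one>. w x)"
proof (cases "H = {\<one>}")
  case False
  have S: "subgroup H G" "subgroup P G" "H \<subseteq> P" using HP by (auto simp: normal_in_def)
  have p0: "p > 0" using p prime_gt_0_nat by blast
  have fP: "finite P" using P p0 by (metis card_ge_0_finite zero_less_power)
  have fH: "finite H" using finite_subset[OF S(3) fP] .
  have KG: "x \<in> carrier G" if "x \<in> K" for x using that coset_in_carrier[OF HP K] by blast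
  have HG: "x \<in> carrier G" if "x \<in> H" for x using that subgroup.mem_carrier[OF S(1)] by blast
  have fK: "finite K" using K finite_subset[OF _ fP] by (simp add: coset_in_def)
  obtain a where a: "card H = p ^ a" using card_subgroup_prime_power[OF p P S] by blast
  have ccnj: "cnj h x \<in> K" if "h \<in> H" "x \<in> K" for h x using coset_in_cnj[OF HP K that(2,1)] .
  have wcnj: "w (cnj h x) = w x" if "h \<in> H" "x \<in> K" for h x
    unfolding w_def
    by (rule card_com_tuples_restr_cnj[OF HP r that(1)]) (rule cnj_cent_iff[OF HG[OF that(1)] KG[OF that(2)]])
  have ckcnj: "card (H \<inter> cent G (cnj h x)) = card (H \<inter> cent G x)" if "h \<in> H" "x \<in> K" for h x
    using card_cent_cnj[OF HP that(1) KG[OF that(2)]] .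
  have cpow: "\<exists>c. card (H \<inter> cent G x) = p ^ c" if "x \<in> K" for x
    using card_subgroup_prime_power[OF p P subgroups_Inter_pair[OF S(1) subgroup_cent[OF KG[OF that]]] S(2)] S(3)
    by blast
  \<comment> \<open>The threshold decides which argument of the gcd in \<open>IH\<close> wins: on
    \<open>small\<close> the order of the centralizer divides \<open>w x\<close>, elsewhere
    \<open>p ^ b\<close> does.\<close>
  define small where "small = {x \<in> K. card (H \<inter> cent G x) \<le> p ^ b}"
  have small_cl: "cnj h x \<in> small" if "h \<in> H" "x \<in> small" for h x
    using that ccnj ckcnj by (simp add: small_def)
  have small_dvd: "card H dvd sum w A"
    if A: "A \<subseteq> small" "\<And>h x. h \<in> H \<Longrightarrow> x \<in> A \<Longrightarrow> cnj h x \<in> A" for A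
  proof (rule cnj_sum_dvd[OF S(1) fH])
    have AK: "A \<subseteq> K" using A(1) by (auto simp: small_def)
    show "finite A" using finite_subset[OF AK fK] .
    show "A \<subseteq> carrier G" using AK KG by blast
    show "w (cnj h x) = w x" if "h \<in> H" "x \<in> A" for h x using wcnj that AK by blast
    fix x assume x: "x \<in> A"
    then have xK: "x \<in> K" and le: "card (H \<inter> cent G x) \<le> p ^ b" using A(1) by (auto simp: small_def)
    obtain c where c: "card (H \<inter> cent G x) = p ^ c" using cpow[OF xK] by blast
    have "c \<le> b" using le unfolding c by (rule power_le_imp_le_exp[OF prime_gt_1_nat[OF p]])
    then show "card (H \<inter> cent G x) dvd w x" using IH[OF xK] unfolding c gcd_prime_powers by simp
  qed (use A(2) in blast)
  have big_dvd: "p ^ b dvd w x" if xK: "x \<in> K - small" for x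
  proof -
    obtain c where c: "card (H \<inter> cent G x) = p ^ c" using cpow[of x] xK by blast
    have "p ^ b \<le> p ^ c" using xK c by (auto simp: small_def)
    then have "b \<le> c" by (rule power_le_imp_le_exp[OF prime_gt_1_nat[OF p]])
    then show ?thesis using IH[of x] xK unfolding c gcd_prime_powers by simp
  qed
  \<comment> \<open>\<open>T\<close> contains every element that can occur as an entry, and
    translations need only commute with these. Centralizing all of \<open>P\<close> would be too
    strong a demand on \<open>Y\<close>: later \<open>z [^] p\<close> has to be shown to lie in
    \<open>Y\<close>, and only its behaviour under \<open>T\<close> is known.\<close>
  define T where "T = H \<union> K \<union> \<Union>(fst ` set r)"
  have TG: "T \<subseteq> carrier G"
    using HG KG r coset_in_carrier[OF HP] unfolding T_def by blast
  define Y where "Y = {h \<in> H. \<forall>g\<in>T. g \<otimes> h = h \<otimes> g}"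
  have sY: "subgroup Y G"
  proof
    show "Y \<subseteq> carrier G" using HG by (auto simp: Y_def)
    show "\<one> \<in> Y" using subgroup.one_closed[OF S(1)] TG by (auto simp: Y_def)
  next
    fix x y assume "x \<in> Y" "y \<in> Y"
    then have *: "x \<in> H" "y \<in> H" "\<And>g. g \<in> T \<Longrightarrow> x \<in> cent G g" "\<And>g. g \<in> T \<Longrightarrow> y \<in> cent G g"
      using HG by (auto simp: Y_def cent_def)
    have "x \<otimes> y \<in> cent G g" if "g \<in> T" for g
      using subgroup.m_closed[OF subgroup_cent] * TG that by blast
    then show "x \<otimes> y \<in> Y" using subgroup.m_closed[OF S(1) *(1,2)] by (auto simp: Y_def cent_def)
  next
    fix x assume "x \<in> Y"
    then have *: "x \<in> H" "\<And>g. g \<in> T \<Longrightarrow> x \<in> cent G g"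
      using HG by (auto simp: Y_def cent_def)
    have "inv x \<in> cent G g" if "g \<in> T" for g
      using subgroup.m_inv_closed[OF subgroup_cent] * TG that by blast
    then show "inv x \<in> Y" using subgroup.m_inv_closed[OF S(1) *(1)] by (auto simp: Y_def cent_def)
  qed
  have YH: "Y \<subseteq> H" by (auto simp: Y_def)
  have YT: "g \<otimes> y = y \<otimes> g" if "y \<in> Y" "g \<in> T" for g y using that by (simp add: Y_def)
  have YK: "x \<otimes> z \<in> K" if "x \<in> K" "z \<in> Y" for x z using coset_in_mult[OF HP K that(1)] that(2) YH by blast
  have wY: "w (x \<otimes> z) = w x" if "x \<in> K" "z \<in> Y" for x z
  proof -
    have "set xs \<subseteq> cent G (x \<otimes> z) \<longleftrightarrow> set xs \<subseteq> cent G x" if "xs \<in> com_tuples G r" for xs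
    proof -
      have "y \<in> cent G (x \<otimes> z) \<longleftrightarrow> y \<in> cent G x" if "y \<in> set xs" for y
      proof (rule cent_mult_iff)
        have yT: "y \<in> T" using com_tuples_set[OF \<open>xs \<in> com_tuples G r\<close> that] by (auto simp: T_def)
        show "y \<in> carrier G" using yT TG by blast
        show "x \<in> carrier G" "z \<in> carrier G" using \<open>x \<in> K\<close> \<open>z \<in> Y\<close> KG HG YH by auto
        show "y \<otimes> z = z \<otimes> y" using YT[OF \<open>z \<in> Y\<close> yT] .
      qed
      then show ?thesis by blast
    qed
    then have "com_tuples G (restr (cent G (x \<otimes> z)) r) = com_tuples G (restr (cent G x) r)"
      unfolding com_tuples_restr by blast
    then show ?thesis by (simp add: w_def)
  qed
  have smallY: "x \<otimes> z \<in> K - small" if "x \<in> K - small" "z \<in> Y" for x z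
  proof -
    have "H \<inter> cent G (x \<otimes> z) = H \<inter> cent G x"
      using cent_mult_iff[of _ x z] HG KG YT[OF that(2)] that YH by (auto simp: T_def)
    then show ?thesis using that YK by (auto simp: small_def)
  qed
  define Kq where "Kq = {x. x \<in> K \<and> x [^] q = \<one>}"
  have fKq: "finite Kq" "Kq \<subseteq> K" using fK by (auto simp: Kq_def)
  have Kq_cnj: "cnj h x \<in> Kq" if "h \<in> H" "x \<in> Kq" for h x
    using that ccnj cnj_pow[OF HG[OF that(1)] KG, of x q] HG by (auto simp: Kq_def)
  have small_part: "gcd (card H) (q * p ^ b) dvd sum w (A \<inter> small)"
    if "A \<subseteq> K" "\<And>h x. h \<in> H \<Longrightarrow> x \<in> A \<Longrightarrow> cnj h x \<in> A" for A
    using dvd_trans[OF gcd_dvd1 small_dvd[of "A \<inter> small"]] small_cl that by blast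
  have split: "sum w A = sum w (A \<inter> small) + sum w (A - small)" if "A \<subseteq> K" for A
    using sum.Int_Diff[OF finite_subset[OF that fK]] .
  obtain c where c: "card Y = p ^ c"
    using card_subgroup_prime_power[OF p P sY S(2)] YH S(3) by blast
  \<comment> \<open>A nontrivial normal subgroup of the \<open>p\<close>-group \<open>P\<close>
    contains a nontrivial element central in \<open>P\<close>, and \<open>T\<close> lies in
    \<open>P\<close>.\<close>
  have "c \<noteq> 0"
  proof
    assume "c = 0"
    then have "card Y = 1" using c by simp
    obtain y where y: "y \<in> H" "y \<noteq> \<one>" "\<forall>g\<in>P. g \<otimes> y = y \<otimes> g"
      using central_element_in[OF p P HP False] by blast
    have "T \<subseteq> P" using S(3) K r by (auto simp: T_def coset_in_def)
    then have "y \<in> Y" using y by (auto simp: Y_def)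
    moreover have "\<one> \<in> Y" using subgroup.one_closed[OF sY] .
    ultimately show False using \<open>card Y = 1\<close> y(2) by (metis card_1_singletonE singletonD)
  qed
  show ?thesis
  proof (cases "q = p \<or> 2 \<le> c")
    case True
    obtain i where i: "q = p ^ i" "i \<le> c"
    proof (cases "q = p")
      case True then show thesis using that[of 1] \<open>c \<noteq> 0\<close> by simp
    next
      case False then show thesis using that[of 2] True q by simp
    qed
    \<comment> \<open>The order of \<open>N\<close> is exactly \<open>q\<close>: this gives the
      factor \<open>q\<close> and ensures \<open>z [^] q = \<one>\<close>, so that translation
      respects the power condition.\<close>
    obtain N where N: "subgroup N G" "N \<subseteq> Y" "card N = q"
      using subgroup_of_prime_power_order[OF p sY c i(2)] i(1) by blast
    have "q * p ^ b dvd sum w (Kq - small)"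
    proof (rule rmult_sum_dvd[OF N(1)])
      show "finite N" using finite_subset[OF subset_trans[OF N(2) YH] fH] .
      show "finite (Kq - small)" using fKq by simp
      show "Kq - small \<subseteq> carrier G" using fKq KG by blast
      show "x \<otimes> z \<in> Kq - small" if x: "x \<in> Kq - small" and z: "z \<in> N" for x z
      proof -
        have zY: "z \<in> Y" using z N by blast
        have G: "x \<in> carrier G" "z \<in> carrier G" using x zY fKq KG HG YH by auto
        have "x \<otimes> z = z \<otimes> x" using YT[OF zY, of x] x by (auto simp: T_def Kq_def)
        then have "(x \<otimes> z) [^] q = x [^] q \<otimes> z [^] q" using pow_mult_distrib G by blast
        also have "\<dots> = \<one>" using x pow_card_subgroup[OF N(1) z] N(3) by (simp add: Kq_def)
        finally show ?thesis using smallY[OF _ zY, of x] x by (auto simp: Kq_def)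
      qed
      show "w (x \<otimes> z) = w x" if "x \<in> Kq - small" "z \<in> N" for x z
        using wY[of x z] that N(2) fKq by blast
      show "q * p ^ b dvd card N * w x" if "x \<in> Kq - small" for x
        using big_dvd[of x] that fKq N(3) by auto
    qed
    then have "gcd (card H) (q * p ^ b) dvd sum w (Kq - small)" by (rule dvd_trans[OF gcd_dvd2])
    then show ?thesis
      using split[OF fKq(2)] small_part[OF fKq(2) Kq_cnj] unfolding Kq_def by simp
  next
    case False
    then have q2: "q = p\<^sup>2" and "c = 1" using q \<open>c \<noteq> 0\<close> by auto
    then have cY: "card Y = p" using c by simp
    \<comment> \<open>\<open>D x\<close> says that all conjugates of \<open>x\<close> under
      \<open>H\<close> are translates of \<open>x\<close> by \<open>Y\<close>, so conjugation does
      not enlarge the orbit of length \<open>p\<close> obtained by translation.\<close>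
    define D where "D x \<longleftrightarrow> (\<forall>h\<in>H. inv x \<otimes> cnj h x \<in> Y)" for x
    \<comment> \<open>This and \<open>DY\<close> are used in contrapositive form: the elements
      violating \<open>D\<close> are closed under conjugation by \<open>H\<close> and translation by
      \<open>Y\<close>.\<close>
    have Dcnj: "D x" if D: "D (cnj k x)" and k: "k \<in> H" and x: "x \<in> K" for k x
      unfolding D_def
    proof
      fix h assume h: "h \<in> H"
      note G = HG[OF h] HG[OF k] KG[OF x]
      let ?g = "k \<otimes> h \<otimes> inv k" and ?y = "inv x \<otimes> cnj h x"
      have "?g \<in> H" using h k subgroup.m_closed[OF S(1)] subgroup.m_inv_closed[OF S(1)] by simp
      then have "inv (cnj k x) \<otimes> cnj ?g (cnj k x) \<in> Y" using D unfolding D_def by blast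
      moreover have "inv (cnj k x) \<otimes> cnj ?g (cnj k x) = cnj k ?y"
        using G by (simp add: m_assoc inv_mult_group) (simp add: m_assoc[symmetric])
      ultimately have kY: "cnj k ?y \<in> Y" by simp
      have "k \<otimes> cnj k ?y = cnj k ?y \<otimes> k" using YT[OF kY] k by (simp add: T_def)
      then have "cnj k (cnj k ?y) = cnj k ?y" using cnj_eq_iff[of k "cnj k ?y"] G by simp
      then have "cnj (inv k) (cnj k (cnj k ?y)) = cnj (inv k) (cnj k ?y)" by simp
      then have "cnj k ?y = ?y" using cnj_inv_cancel(2)[of k "cnj k ?y"] cnj_inv_cancel(2)[of k ?y] G by simp
      then show "?y \<in> Y" using kY by simp
    qed
    have DY: "D x" if D: "D (x \<otimes> z)" and x: "x \<in> K" and z: "z \<in> Y" for x z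
      unfolding D_def
    proof
      fix h assume h: "h \<in> H"
      have zH: "z \<in> H" using z YH by blast
      note G = HG[OF h] HG[OF zH] KG[OF x]
      have cz: "cnj h z = z" using YT[OF z, of h] h cnj_eq_iff[of h z] G unfolding T_def by blast
      have "inv (x \<otimes> z) \<otimes> cnj h (x \<otimes> z) \<in> Y" using D h unfolding D_def by blast
      moreover have "inv (x \<otimes> z) \<otimes> cnj h (x \<otimes> z) = inv z \<otimes> (inv x \<otimes> cnj h x) \<otimes> z"
        using G cnj_mult[of h x z] cz by (simp add: m_assoc inv_mult_group)
      ultimately have "inv z \<otimes> (inv x \<otimes> cnj h x) \<otimes> z \<in> Y" by simp
      then have "z \<otimes> (inv z \<otimes> (inv x \<otimes> cnj h x) \<otimes> z) \<otimes> inv z \<in> Y"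
        using z sY by (simp add: subgroup.m_closed subgroup.m_inv_closed)
      then show "inv x \<otimes> cnj h x \<in> Y" using cnj_inv_cancel(1)[of z "inv x \<otimes> cnj h x"] G by simp
    qed
    define Z where "Z = {x \<in> K - small. \<not> D x}"
    define X where "X = {x \<in> K - small. D x}"
    have fX: "finite X" "X \<subseteq> K" using fK by (auto simp: X_def)
    \<comment> \<open>The set \<open>A\<close> is a parameter because the same bound is needed for
      \<open>Kq\<close> and, with the power condition dropped, for \<open>K\<close>.\<close>
    have Z_dvd: "gcd (card H) (q * p ^ b) dvd sum w (A \<inter> Z)"
      if A: "A \<subseteq> K" "\<And>h x. h \<in> H \<Longrightarrow> x \<in> A \<Longrightarrow> cnj h x \<in> A"
        "\<And>x z. x \<in> A \<Longrightarrow> z \<in> Y \<Longrightarrow> x \<otimes> z \<in> A" for A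
    proof -
      have "p\<^sup>2 * p ^ b dvd sum w (A \<inter> Z)"
      proof (rule cnj_rmult_sum_dvd[OF p S(1) a sY cY YH])
        show "h \<otimes> z = z \<otimes> h" if "h \<in> H" "z \<in> Y" for h z using YT[OF that(2)] that(1) by (simp add: T_def)
        show "finite (A \<inter> Z)" using finite_subset[OF _ fK] A(1) by blast
        show "A \<inter> Z \<subseteq> carrier G" using A(1) KG by blast
        show "cnj h x \<in> A \<inter> Z" if "h \<in> H" "x \<in> A \<inter> Z" for h x
          using that A(2) ccnj ckcnj Dcnj by (auto simp: Z_def small_def)
        show "x \<otimes> z \<in> A \<inter> Z" if "x \<in> A \<inter> Z" "z \<in> Y" for x z
          using that A(3) smallY DY by (auto simp: Z_def)
        show "w (cnj h x) = w x" if "h \<in> H" "x \<in> A \<inter> Z" for h x using wcnj that A(1) by blast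
        show "w (x \<otimes> z) = w x" if "x \<in> A \<inter> Z" "z \<in> Y" for x z using wY that A(1) by blast
        show "p ^ b dvd w x" if "x \<in> A \<inter> Z" for x using big_dvd that by (auto simp: Z_def)
        show "\<exists>h\<in>H. inv x \<otimes> cnj h x \<notin> Y" if "x \<in> A \<inter> Z" for x using that by (auto simp: Z_def D_def)
      qed
      then show ?thesis unfolding q2 by (rule dvd_trans[OF gcd_dvd2])
    qed
    have split3: "sum w A = sum w (A \<inter> small) + sum w (A \<inter> Z) + sum w (A \<inter> X)" if "A \<subseteq> K" for A
    proof -
      have "A - small = (A \<inter> Z) \<union> (A \<inter> X)" using that by (auto simp: Z_def X_def)
      moreover have "sum w ((A \<inter> Z) \<union> (A \<inter> X)) = sum w (A \<inter> Z) + sum w (A \<inter> X)"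
        by (rule sum.union_disjoint) (use finite_subset[OF that fK] in \<open>auto simp: Z_def X_def\<close>)
      ultimately show ?thesis using split[OF that] by simp
    qed
    \<comment> \<open>Nonzero weights provide completions of \<open>x\<close> and \<open>x'\<close>.
      They put into each remaining coset an element commuting with \<open>x\<close> and one
      commuting with \<open>x'\<close>, which controls how that coset acts on the quotient
      \<open>z\<close> of \<open>x'\<close> by \<open>x\<close>. The commutator of \<open>z\<close>
      and \<open>x\<close> lies in \<open>Y\<close>, so \<open>power_square_commutator\<close>
      finally applies to \<open>x \<otimes> z\<close>.\<close>
    have sameq: "x' [^] q = x [^] q" if x: "x \<in> X" "w x \<noteq> 0" and x': "x' \<in> X" "w x' \<noteq> 0" for x x'
    proof -
      have xK: "x \<in> K" "x' \<in> K" and DD: "D x" "D x'" using x x' by (auto simp: X_def)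
      note xG = KG[OF xK(1)] KG[OF xK(2)]
      have xT: "x \<in> T" "x' \<in> T" using xK by (auto simp: T_def)
      have HT: "h \<in> T" if "h \<in> H" for h using that by (simp add: T_def)
      have YG: "y \<in> carrier G" if "y \<in> Y" for y using that YH HG by blast
      \<comment> \<open>\<open>z\<close> commutes modulo \<open>Y\<close> with everything in \<open>T\<close>, hence \<open>z [^] p \<in> Y\<close> and \<open>z [^] p\<^sup>2 = \<one>\<close>.\<close>
      define z where "z = inv x \<otimes> x'"
      have zH: "z \<in> H" using K xK by (auto simp: coset_in_def z_def)
      have zG: "z \<in> carrier G" using HG[OF zH] .
      have x'_eq: "x' = x \<otimes> z" using xG by (simp add: z_def flip: m_assoc)
      obtain xs where xs: "xs \<in> com_tuples G r" "set xs \<subseteq> cent G x"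
        using x(2) unfolding w_def com_tuples_restr by (metis (lifting) Collect_empty_eq card.empty)
      obtain xs' where xs': "xs' \<in> com_tuples G r" "set xs' \<subseteq> cent G x'"
        using x'(2) unfolding w_def com_tuples_restr by (metis (lifting) Collect_empty_eq card.empty)
      have move: "\<exists>m\<in>Y. cnj h u = u \<otimes> m" if u: "D u" "u \<in> carrier G" and h: "h \<in> H" for h u
      proof (rule bexI[of _ "inv u \<otimes> cnj h u"])
        show "inv u \<otimes> cnj h u \<in> Y" using u(1) h unfolding D_def by blast
        show "cnj h u = u \<otimes> (inv u \<otimes> cnj h u)" using u(2) HG[OF h] by (simp flip: m_assoc)
      qed
      \<comment> \<open>An element that moves \<open>x\<close> and \<open>x'\<close> only within
        their cosets of \<open>Y\<close> also moves their quotient \<open>z\<close> only within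
        \<open>z\<close> times \<open>Y\<close>.\<close>
      have both: "cnj g z = z \<otimes> (inv m \<otimes> m')"
        if g: "g \<in> carrier G" and m: "m \<in> Y" "cnj g x = x \<otimes> m" and m': "m' \<in> Y" "cnj g x' = x' \<otimes> m'"
        for g m m'
      proof -
        have "x \<otimes> m \<otimes> cnj g z = x' \<otimes> m'" using m m' cnj_mult[OF g xG(1) zG] by (simp add: x'_eq)
        also have "\<dots> = x \<otimes> (z \<otimes> (m \<otimes> (inv m \<otimes> m')))"
          unfolding x'_eq using xG zG YG[OF m(1)] YG[OF m'(1)] m_assoc[of m "inv m" m', symmetric]
          by (simp add: m_assoc[of x])
        also have "\<dots> = x \<otimes> (m \<otimes> z) \<otimes> (inv m \<otimes> m')"
          using xG zG YG[OF m(1)] YG[OF m'(1)]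
          unfolding YT[OF m(1) HT[OF zH], symmetric] by (simp add: m_assoc)
        finally have "x \<otimes> m \<otimes> cnj g z = x \<otimes> m \<otimes> (z \<otimes> (inv m \<otimes> m'))"
          using xG zG YG[OF m(1)] YG[OF m'(1)] by (simp add: m_assoc)
        then show ?thesis using xG zG YG[OF m(1)] YG[OF m'(1)] g by (simp only: Units_l_cancel Units_eq m_closed inv_closed)
      qed
      have Yi: "inv m \<otimes> m' \<in> Y" if "m \<in> Y" "m' \<in> Y" for m m'
        using that sY by (simp add: subgroup.m_closed subgroup.m_inv_closed)
      have zH_cnj: "\<exists>n\<in>Y. cnj h z = z \<otimes> n" if h: "h \<in> H" for h
        using move[OF DD(1) xG(1) h] move[OF DD(2) xG(2) h] both[OF HG[OF h]] Yi by blast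
      \<comment> \<open>Moving \<open>z\<close> only by elements of \<open>Y\<close> is a property
        of whole cosets of \<open>H\<close>, so one good representative \<open>y\<close> per coset
        suffices. For \<open>K\<close> it is \<open>x\<close> itself.\<close>
      have z_mult: "\<exists>n\<in>Y. cnj g z = z \<otimes> n"
        if y: "y \<in> T" "\<exists>n\<in>Y. cnj y z = z \<otimes> n" and g: "g \<in> carrier G" "inv y \<otimes> g \<in> H" for y g
      proof -
        have yG: "y \<in> carrier G" using y(1) TG by blast
        obtain n where n: "n \<in> Y" "cnj y z = z \<otimes> n" using y(2) by blast
        obtain k where k: "k \<in> Y" "cnj (inv y \<otimes> g) z = z \<otimes> k" using zH_cnj[OF g(2)] by blast
        have "g = y \<otimes> (inv y \<otimes> g)" using yG g(1) by (simp flip: m_assoc)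
        then have "cnj g z = cnj y (cnj (inv y \<otimes> g) z)" using cnj_cnj[OF yG _ zG, of "inv y \<otimes> g"] yG g(1) by simp
        also have "\<dots> = z \<otimes> n \<otimes> cnj y k" using k cnj_mult[OF yG zG YG[OF k(1)]] n by simp
        also have "cnj y k = k" using YT[OF k(1) y(1)] cnj_eq_iff[OF yG YG[OF k(1)]] by blast
        finally have "cnj g z = z \<otimes> (n \<otimes> k)" using zG YG n(1) k(1) by (simp add: m_assoc)
        then show ?thesis using subgroup.m_closed[OF sY n(1) k(1)] by blast
      qed
      obtain m where m: "m \<in> Y" "cnj z x = x \<otimes> m" using move[OF DD(1) xG(1) zH] by blast
      note mG = YG[OF m(1)]
      have mx: "m \<otimes> x = x \<otimes> m" and mz: "m \<otimes> z = z \<otimes> m"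
        using YT[OF m(1) xT(1)] YT[OF m(1) HT[OF zH]] by simp_all
      have zx: "z \<otimes> x = x \<otimes> z \<otimes> m"
      proof -
        have "z \<otimes> x = cnj z x \<otimes> z" using zG xG by (simp add: m_assoc)
        also have "\<dots> = x \<otimes> (m \<otimes> z)" using m(2) mG xG zG by (simp add: m_assoc)
        finally show ?thesis unfolding mz using mG xG zG by (simp add: m_assoc)
      qed
      have z_x: "cnj x z = z \<otimes> inv m"
      proof -
        have "z \<otimes> inv m \<otimes> x = x \<otimes> z"
        proof -
          have "inv m \<otimes> x = x \<otimes> inv m"
            using YT[OF subgroup.m_inv_closed[OF sY m(1)] xT(1)] by simp
          then have "z \<otimes> inv m \<otimes> x = (z \<otimes> x) \<otimes> inv m" using mG xG zG by (simp add: m_assoc)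
          then show ?thesis unfolding zx using mG xG zG by (simp add: m_assoc)
        qed
        then show ?thesis using mG xG zG by (metis inv_closed inv_solve_right' m_closed)
      qed
      have zT: "\<exists>n\<in>Y. cnj g z = z \<otimes> n" if "g \<in> T" for g
      proof -
        have gG: "g \<in> carrier G" using that TG by blast
        consider "g \<in> H" | "g \<in> K" | s where "s \<in> set r" "g \<in> fst s" using \<open>g \<in> T\<close> by (auto simp: T_def)
        then show ?thesis
        proof cases
          case 1 then show ?thesis by (rule zH_cnj)
        next
          case 2
          have "inv x \<otimes> g \<in> H" using K 2 xK by (auto simp: coset_in_def)
          then show ?thesis
            using z_mult[OF xT(1) _ gG] z_x subgroup.m_inv_closed[OF sY m(1)] by blast
        next
          \<comment> \<open>\<open>y\<close> commutes with \<open>x\<close>, and \<open>y'\<close>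
            with \<open>x'\<close>. Lying in one coset, they differ by an element of
            \<open>H\<close>, which moves \<open>x'\<close> only within \<open>Y\<close> because of
            \<open>D x'\<close>. So \<open>y\<close> is the representative needed for
            \<open>z_mult\<close>.\<close>
          case 3
          have cs: "coset_in H P (fst s)" using r 3 by blast
          obtain y where y: "y \<in> set xs" "y \<in> fst s" using com_tuples_meet[OF xs(1) 3(1)] by blast
          obtain y' where y': "y' \<in> set xs'" "y' \<in> fst s" using com_tuples_meet[OF xs'(1) 3(1)] by blast
          have yT: "y \<in> T" "y' \<in> T" using y y' 3(1) by (auto simp: T_def)
          then have yG: "y \<in> carrier G" "y' \<in> carrier G" using TG by auto
          have yH: "inv y' \<otimes> y \<in> H" "inv y \<otimes> g \<in> H" using cs y y' 3 by (auto simp: coset_in_def)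
          have 1: "cnj y x = x \<otimes> \<one>" using cent_iff[OF yG(1) xG(1)] xs(2) y(1) xG by auto
          have 2: "cnj y' x' = x'" using cent_iff[OF yG(2) xG(2)] xs'(2) y'(1) by blast
          obtain k where k: "k \<in> Y" "cnj (inv y' \<otimes> y) x' = x' \<otimes> k" using move[OF DD(2) xG(2) yH(1)] by blast
          have "y = y' \<otimes> (inv y' \<otimes> y)" using yG by (simp flip: m_assoc)
          then have "cnj y x' = cnj y' (x' \<otimes> k)"
            using cnj_cnj[OF yG(2) _ xG(2), of "inv y' \<otimes> y"] k(2) yG by simp
          also have "\<dots> = x' \<otimes> cnj y' k" using cnj_mult[OF yG(2) xG(2) YG[OF k(1)]] 2 by simp
          also have "cnj y' k = k" using YT[OF k(1) yT(2)] cnj_eq_iff[OF yG(2) YG[OF k(1)]] by blast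
          finally have "cnj y z = z \<otimes> (inv \<one> \<otimes> k)"
            using both[OF yG(1) subgroup.one_closed[OF sY] 1 k(1)] by blast
          then have "\<exists>n\<in>Y. cnj y z = z \<otimes> n" using Yi[OF subgroup.one_closed[OF sY] k(1)] by blast
          then show ?thesis using z_mult[OF yT(1) _ gG yH(2)] by blast
        qed
      qed
      \<comment> \<open>Each \<open>g\<close> in \<open>T\<close> multiplies \<open>z\<close> by
        some \<open>n\<close> in \<open>Y\<close>. As \<open>n\<close> commutes with
        \<open>z\<close> and satisfies \<open>n [^] p = \<one>\<close>, it disappears from the
        \<open>p\<close>-th power.\<close>
      have zpY: "z [^] p \<in> Y"
      proof -
        have "g \<otimes> z [^] p = z [^] p \<otimes> g" if gT: "g \<in> T" for g
        proof -
          have gG: "g \<in> carrier G" using gT TG by blast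
          obtain n where n: "n \<in> Y" "cnj g z = z \<otimes> n" using zT[OF gT] by blast
          have "cnj g (z [^] p) = (z \<otimes> n) [^] p" using cnj_pow[OF gG zG] n by simp
          also have "\<dots> = z [^] p \<otimes> n [^] p"
            using pow_mult_distrib[OF YT[OF n(1) HT[OF zH]] zG YG[OF n(1)]] .
          also have "n [^] p = \<one>" using pow_card_subgroup[OF sY n(1)] cY by simp
          finally have "cnj g (z [^] p) = z [^] p" using zG by simp
          then show ?thesis using cnj_eq_iff[OF gG, of "z [^] p"] zG by simp
        qed
        then show ?thesis using subgroup_nat_pow[OF S(1) zH] by (simp add: Y_def)
      qed
      have "z [^] p\<^sup>2 = (z [^] p) [^] p" using zG by (simp add: nat_pow_pow power2_eq_square)
      also have "\<dots> = \<one>" using pow_card_subgroup[OF sY zpY] cY by simp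
      finally have "z [^] p\<^sup>2 = \<one>" .
      moreover have "m [^] p = \<one>" using pow_card_subgroup[OF sY m(1)] cY by simp
      ultimately show ?thesis unfolding x'_eq q2
        using power_square_commutator[OF xG(1) zG mG zx mx mz] by simp
    qed
    have KY: "x \<otimes> z \<in> Kq" if "x \<in> Kq" "z \<in> Y" for x z
    proof -
      have G: "x \<in> carrier G" "z \<in> carrier G" using that fKq KG HG YH by auto
      have "x \<otimes> z = z \<otimes> x" using YT[OF that(2), of x] that(1) by (auto simp: T_def Kq_def)
      then have "(x \<otimes> z) [^] q = x [^] q \<otimes> z [^] q" using pow_mult_distrib G by blast
      also have "z [^] q = \<one>" using pow_card_subgroup[OF sY that(2)] cY G unfolding q2
        by (simp add: power2_eq_square flip: nat_pow_pow)
      finally show ?thesis using that YK G by (auto simp: Kq_def)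
    qed
    \<comment> \<open>The sum over all of \<open>K\<close> is divisible, and so are its parts on
      \<open>small\<close> and on \<open>Z\<close>; hence so is the part on
      \<open>X\<close>.\<close>
    have all: "gcd (card H) (q * p ^ b) dvd sum w X"
    proof -
      have "gcd (card H) (q * p ^ b) dvd sum w K"
        using dvd_trans[OF gcd_dvd1 unrestricted_sum_dvd[OF HP fP K r]] by (simp add: w_def)
      moreover have "K \<inter> X = X" using fX by blast
      ultimately show ?thesis
        using split3[of K] small_part[of K] Z_dvd[of K] ccnj YK
        by (simp add: dvd_add_right_iff)
    qed
    have "gcd (card H) (q * p ^ b) dvd sum w (Kq \<inter> X)"
    \<comment> \<open>By \<open>sameq\<close>, as soon as one element of \<open>X\<close> of nonzero
      weight satisfies the power condition, all of them do, and the two sums over \<open>X\<close>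
      agree. Otherwise the restricted sum vanishes.\<close>
    proof (cases "\<exists>x\<in>Kq \<inter> X. w x \<noteq> 0")
      case True
      then obtain x where x: "x \<in> Kq" "x \<in> X" "w x \<noteq> 0" by blast
      have "sum w (Kq \<inter> X) = sum w X"
      proof (rule sum.mono_neutral_left[OF fX(1)])
        show "\<forall>y\<in>X - Kq \<inter> X. w y = 0"
          using sameq[OF x(2,3)] x(1) fX by (auto simp: Kq_def)
      qed simp
      then show ?thesis using all by simp
    next
      case False
      then have "sum w (Kq \<inter> X) = 0" by simp
      then show ?thesis by simp
    qed
    then show ?thesis
      using split3[OF fKq(2)] small_part[OF fKq(2) Kq_cnj] Z_dvd[OF fKq(2) Kq_cnj KY]
      unfolding Kq_def by simp
  qed
qed simp


text \<open>Fixing the first entry \<open>x\<close> replaces \<open>H\<close>, \<open>P\<close> and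
  the cosets by their intersections with \<open>cent G x\<close>, so all of them vary in the
  induction. \<open>peel_factor\<close> is the step and \<open>hall_prime_power\<close> the
  base.\<close>

theorem card_com_tuples_prime_power_group:
  assumes p: "prime p"
  shows "admissible p qs \<Longrightarrow> qs = map snd r \<Longrightarrow> card P = p ^ e \<Longrightarrow> normal_in H P \<Longrightarrow>
    \<forall>s\<in>set r. coset_in H P (fst s) \<Longrightarrow> gcd (card H) (prod_list qs) dvd card (com_tuples G r)"
proof (induction arbitrary: r H P e rule: admissible.induct)
  case (admissible_single n)
  then obtain K where r: "r = [(K, p ^ n)]" by (cases r) auto
  have "com_tuples G r = (\<lambda>x. [x]) ` {x \<in> K. x [^] (p ^ n) = \<one>}" unfolding r by auto
  then have "card (com_tuples G r) = card {x \<in> K. x [^] (p ^ n) = \<one>}"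
    by (simp add: card_image inj_on_def)
  then show ?case using hall_prime_power[OF p admissible_single(2,3), of K n] admissible_single(4) r by simp
next
  case (admissible_Cons qs q)
  obtain K r' where r: "r = (K, q) # r'" and r': "qs = map snd r'"
    using admissible_Cons.prems(1) by (cases r) auto
  note P = \<open>card P = p ^ e\<close> and HP = \<open>normal_in H P\<close>
  have K: "coset_in H P K" and cr: "\<forall>s\<in>set r'. coset_in H P (fst s)" using admissible_Cons.prems(4) r by auto
  obtain b where b: "prod_list qs = p ^ b" using admissible_prod[OF admissible_Cons(1)] by blast
  have sP: "subgroup P G" using HP by (simp add: normal_in_def)
  have fP: "finite P" using P p by (metis card_ge_0_finite prime_gt_0_nat zero_less_power)
  have "gcd (card (H \<inter> cent G x)) (p ^ b) dvd card (com_tuples G (restr (cent G x) r'))" if x: "x \<in> K" for x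
  proof -
    have xG: "x \<in> carrier G" using x coset_in_carrier[OF HP K] by blast
    note C = subgroup_cent[OF xG]
    obtain e' where e': "card (P \<inter> cent G x) = p ^ e'"
      using card_subgroup_prime_power[OF p P subgroups_Inter_pair[OF sP C] sP] by blast
    have "\<forall>s\<in>set (restr (cent G x) r'). coset_in (H \<inter> cent G x) (P \<inter> cent G x) (fst s)"
      using cr coset_in_Int[OF _ C] by (auto simp: restr_def)
    then show ?thesis
      using admissible_Cons.IH[OF _ e' normal_in_Int[OF HP C], of "restr (cent G x) r'"] r' b by simp
  qed
  from peel_factor[OF p P HP K cr this admissible_Cons(2)]
  have "gcd (card H) (q * p ^ b) dvd
    (\<Sum>x | x \<in> K \<and> x [^] q = \<one>. card (com_tuples G (restr (cent G x) r')))" .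
  also have "\<dots> = card (com_tuples G r)"
    unfolding r
  proof (subst card_com_tuples_Cons)
    show "finite (fst (K, q))" using K finite_subset[OF _ fP] by (simp add: coset_in_def)
    show "finite (com_tuples G r')"
      by (rule finite_com_tuples) (use cr fP in \<open>meson coset_in_def finite_subset\<close>)
  qed simp
  finally show ?case using b by simp
qed simp

end

section \<open>Finite groups\<close>

text \<open>The iterates of \<open>f\<close> are an action of the cyclic group of order
  \<open>p ^ b\<close>, whose fixed points are those of \<open>f\<close>.\<close>

lemma funpow_fixed_points_cong:
  assumes p: "prime p" and F: "finite F" "\<And>s. s \<in> F \<Longrightarrow> f s \<in> F" "\<And>s. s \<in> F \<Longrightarrow> (f ^^ (p ^ b)) s = s"
  shows "[card {s \<in> F. f s = s} = card F] (mod p)"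
proof -
  define N where "N = p ^ b"
  have N0: "N \<noteq> 0" using p by (simp add: N_def)
  interpret A: group "integer_mod_group N" by simp
  interpret act: finite_action "integer_mod_group N" "\<lambda>k. f ^^ nat k" F
  proof
    show "finite (carrier (integer_mod_group N))" using N0 by (simp add: carrier_integer_mod_group)
    have cl: "(f ^^ n) s \<in> F" if "s \<in> F" for n s using that F(2) by (induction n) auto
    then show "(f ^^ nat k) s \<in> F" if "k \<in> carrier (integer_mod_group N)" "s \<in> F" for k s using that(2) .
    fix k l :: int and s
    assume k: "k \<in> carrier (integer_mod_group N)" "l \<in> carrier (integer_mod_group N)" and s: "s \<in> F"
    then have kl: "k \<ge> 0" "l \<ge> 0" using N0 by (auto simp: carrier_integer_mod_group)
    have "nat ((k + l) mod int N) = (nat k + nat l) mod N"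
      using kl by (simp add: nat_mod_distrib nat_add_distrib)
    then show "(f ^^ nat (k \<otimes>\<^bsub>integer_mod_group N\<^esub> l)) s = (f ^^ nat k) ((f ^^ nat l) s)"
      using funpow_mod_eq[OF F(3)[OF s, folded N_def], of "nat k + nat l"] by (simp add: funpow_add)
  qed (use F in auto)
  have "order (integer_mod_group N) = p ^ b"
    using N0 by (simp add: order_def carrier_integer_mod_group flip: N_def)
  from act.fixed_points_cong[OF p this]
  have "[card {s \<in> F. \<forall>a\<in>carrier (integer_mod_group N). (f ^^ nat a) s = s} = card F] (mod p)" .
  moreover have "(\<forall>a\<in>carrier (integer_mod_group N). (f ^^ nat a) s = s) \<longleftrightarrow> f s = s" if s: "s \<in> F" for s
  proof
    assume a: "\<forall>a\<in>carrier (integer_mod_group N). (f ^^ nat a) s = s"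
    show "f s = s"
    \<comment> \<open>For \<open>N = 1\<close> the residue \<open>1\<close> is not in the carrier,
      but then the hypothesis on iterates already says \<open>f s = s\<close>.\<close>
    proof (cases "N = 1")
      case True then show ?thesis using F(3)[OF s, folded N_def] by simp
    next
      case False
      then have "1 \<in> carrier (integer_mod_group N)" by simp
      then show ?thesis using bspec[OF a, of 1] by simp
    qed
  next
    assume "f s = s"
    then have "(f ^^ n) s = s" for n by (induction n) auto
    then show "\<forall>a\<in>carrier (integer_mod_group N). (f ^^ nat a) s = s" by blast
  qed
  ultimately show ?thesis by (simp cong: conj_cong)
qed

context group
begin

section \<open>Fixed points on the cosets of a subgroup\<close>

lemma stabilizer_subgroup:
  assumes S: "subgroup S G" and P: "subgroup P G" and L: "L \<subseteq> (\<lambda>g. S #> g) ` P"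
  shows "subgroup {g \<in> P. \<forall>C\<in>L. C #> g = C} G"
proof
  have PG: "P \<subseteq> carrier G" using subgroup.subset[OF P] .
  have CG: "C \<subseteq> carrier G" if "C \<in> L" for C
    using that L PG r_coset_subset_G[OF subgroup.subset[OF S]] by blast
  show "{g \<in> P. \<forall>C\<in>L. C #> g = C} \<subseteq> carrier G" using PG by blast
  show "\<one> \<in> {g \<in> P. \<forall>C\<in>L. C #> g = C}"
    using subgroup.one_closed[OF P] coset_mult_one CG by simp
  fix x assume x: "x \<in> {g \<in> P. \<forall>C\<in>L. C #> g = C}"
  then have xG: "x \<in> carrier G" using PG by blast
  have "C #> inv x = C" if C: "C \<in> L" for C
  proof -
    have "C #> inv x = (C #> x) #> inv x" using x C by simp
    also have "\<dots> = C" using coset_mult_assoc[OF CG[OF C] xG inv_closed[OF xG]] xG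
        coset_mult_one[OF CG[OF C]] by simp
    finally show ?thesis .
  qed
  then show "inv x \<in> {g \<in> P. \<forall>C\<in>L. C #> g = C}"
    using x subgroup.m_inv_closed[OF P] by simp
  fix y assume y: "y \<in> {g \<in> P. \<forall>C\<in>L. C #> g = C}"
  then have yG: "y \<in> carrier G" using PG by blast
  show "x \<otimes> y \<in> {g \<in> P. \<forall>C\<in>L. C #> g = C}"
    using x y subgroup.m_closed[OF P] coset_mult_assoc[OF CG xG yG] by auto
qed

text \<open>The first entry commutes with the others, hence permutes their common fixed points, and
  it has \<open>p\<close>-power order there. So each additional entry changes the number of common
  fixed points by a multiple of \<open>p\<close>.\<close>

lemma com_tuples_fixed_points_cong:
  assumes p: "prime p" and X: "finite X"
    and XG: "\<And>C. C \<in> X \<Longrightarrow> C \<subseteq> carrier G"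
    and P: "P \<subseteq> carrier G" "\<And>C g. C \<in> X \<Longrightarrow> g \<in> P \<Longrightarrow> C #> g \<in> X"
  shows "xs \<in> com_tuples G r \<Longrightarrow> \<forall>s\<in>set r. fst s \<subseteq> P \<and> (\<exists>b. snd s = p ^ b) \<Longrightarrow>
    [card {C \<in> X. \<forall>y\<in>set xs. C #> y = C} = card X] (mod p)"
proof (induction r arbitrary: xs)
  case (Cons s r)
  then obtain x ys where x: "xs = x # ys" "x \<in> fst s" "x [^] snd s = \<one>" "ys \<in> com_tuples G r"
    "set ys \<subseteq> cent G x" by auto
  obtain b where b: "snd s = p ^ b" using Cons.prems(2) by auto
  have xP: "x \<in> P" using x(2) Cons.prems(2) by auto
  then have xG: "x \<in> carrier G" using P by blast
  define F where "F = {C \<in> X. \<forall>y\<in>set ys. C #> y = C}"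
  have FX: "F \<subseteq> X" by (auto simp: F_def)
  have pow: "((\<lambda>C. C #> x) ^^ n) C = C #> (x [^] n)" if "C \<in> X" for n C
  proof (induction n)
    case 0 show ?case using coset_mult_one[OF XG[OF that]] by simp
  next
    case (Suc n)
    then show ?case using coset_mult_assoc[OF XG[OF that] nat_pow_closed[OF xG, of n] xG] by simp
  qed
  have 1: "[card {C \<in> F. C #> x = C} = card F] (mod p)"
  proof (rule funpow_fixed_points_cong[OF p])
    show "finite F" using finite_subset[OF FX X] .
    fix C assume C: "C \<in> F"
    then have CX: "C \<in> X" using FX by blast
    show "((\<lambda>C. C #> x) ^^ (p ^ b)) C = C"
      unfolding pow[OF CX] using x(3) b coset_mult_one[OF XG[OF CX]] by simp
    have "(C #> x) #> y = C #> x" if y: "y \<in> set ys" for y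
    proof -
      have yG: "y \<in> carrier G" and c: "y \<otimes> x = x \<otimes> y" using y x(5) by (auto simp: cent_def)
      have "(C #> x) #> y = C #> (y \<otimes> x)" using coset_mult_assoc[OF XG[OF CX] xG yG] c by simp
      also have "\<dots> = (C #> y) #> x" using coset_mult_assoc[OF XG[OF CX] yG xG] by simp
      finally show ?thesis using C y by (simp add: F_def)
    qed
    then show "C #> x \<in> F" using P(2)[OF CX xP] by (simp add: F_def)
  qed
  have 2: "[card F = card X] (mod p)"
    unfolding F_def using Cons.IH[OF x(4)] Cons.prems(2) by simp
  have "{C \<in> F. C #> x = C} = {C \<in> X. \<forall>y\<in>set xs. C #> y = C}" by (auto simp: F_def x(1))
  then show ?case using cong_trans[OF 1 2] by simp
qed simp

lemma coset_mult_inv_iff: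
  assumes "C \<subseteq> carrier G" "g \<in> carrier G"
  shows "C #> inv g = C \<longleftrightarrow> C #> g = C"
proof
  assume "C #> inv g = C"
  then have "C #> g = (C #> inv g) #> g" by simp
  then show "C #> g = C" using assms coset_mult_assoc[OF assms(1) inv_closed assms(2)] by simp
next
  assume "C #> g = C"
  then have "C #> inv g = (C #> g) #> inv g" by simp
  then show "C #> inv g = C" using assms coset_mult_assoc[OF assms(1,2) inv_closed] by simp
qed

text \<open>The action of \<open>P\<close> on the cosets is transitive, so every stabilizer has the
  order of \<open>S\<close>.\<close>

lemma right_coset_action:
  assumes S: "subgroup S G" and P: "subgroup P G" "finite P" and SP: "S \<subseteq> P"
  defines "X \<equiv> (\<lambda>g. S #> g) ` P"
  shows "C \<in> X \<Longrightarrow> C \<subseteq> carrier G" "C \<in> X \<Longrightarrow> g \<in> P \<Longrightarrow> C #> g \<in> X" "card X * card S = card P"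
    "C \<in> X \<Longrightarrow> card {g \<in> P. C #> g = C} = card S"
proof -
  have PG: "P \<subseteq> carrier G" using subgroup.subset[OF P(1)] .
  show sub: "C \<subseteq> carrier G" if "C \<in> X" for C
    using that PG r_coset_subset_G[OF subgroup.subset[OF S]] unfolding X_def by blast
  show cl: "C #> g \<in> X" if C: "C \<in> X" and g: "g \<in> P" for C g
  proof -
    obtain k where k: "k \<in> P" "C = S #> k" using C unfolding X_def by blast
    then have "C #> g = S #> (k \<otimes> g)"
      using coset_mult_assoc[OF subgroup.subset[OF S], of k g] PG g by auto
    then show ?thesis unfolding X_def using subgroup.m_closed[OF P(1) k(1) g] by blast
  qed
  interpret GP: group "G\<lparr>carrier := P\<rparr>" using subgroup.subgroup_is_group[OF P(1) is_group] .
  have "rcosets\<^bsub>G\<lparr>carrier := P\<rparr>\<^esub> S = X" by (auto simp: RCOSETS_def X_def r_coset_def)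
  then show cX: "card X * card S = card P"
    using GP.lagrange_finite[of S] subgroup_incl[OF S P(1) SP] P(2) by (simp add: order_def)
  show "card {g \<in> P. C #> g = C} = card S" if C: "C \<in> X" for C
  proof -
    interpret act: finite_action "G\<lparr>carrier := P\<rparr>" "\<lambda>g C. C #> inv g" X
    proof
      show "finite (carrier (G\<lparr>carrier := P\<rparr>))" "finite X" using P(2) by (auto simp: X_def)
      fix g D assume g: "g \<in> carrier (G\<lparr>carrier := P\<rparr>)" and D: "D \<in> X"
      show "D #> inv g \<in> X" using cl[OF D] subgroup.m_inv_closed[OF P(1)] g by simp
      fix h assume h: "h \<in> carrier (G\<lparr>carrier := P\<rparr>)"
      have "g \<in> carrier G" "h \<in> carrier G" using g h PG by auto
      then show "D #> inv (g \<otimes>\<^bsub>G\<lparr>carrier := P\<rparr>\<^esub> h) = (D #> inv h) #> inv g"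
        using coset_mult_assoc[OF sub[OF D], of "inv h" "inv g"] by (simp add: inv_mult_group)
    next
      fix D assume "D \<in> X"
      then show "D #> inv \<one>\<^bsub>G\<lparr>carrier := P\<rparr>\<^esub> = D" using coset_mult_one[OF sub] by simp
    qed
    obtain k where k: "k \<in> P" "C = S #> k" using C unfolding X_def by blast
    have "X \<subseteq> act.orb C"
    proof
      fix D assume "D \<in> X"
      then obtain l where l: "l \<in> P" "D = S #> l" unfolding X_def by blast
      have G: "k \<in> carrier G" "l \<in> carrier G" using k(1) l(1) PG by auto
      have "C #> inv (inv l \<otimes> k) = S #> (k \<otimes> (inv k \<otimes> l))"
        using k(2) coset_mult_assoc[OF subgroup.subset[OF S], of k "inv k \<otimes> l"] G by (simp add: inv_mult_group)
      also have "k \<otimes> (inv k \<otimes> l) = l" using G by (simp flip: m_assoc)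
      finally have "D = C #> inv (inv l \<otimes> k)" using l(2) by simp
      moreover have "inv l \<otimes> k \<in> P" using k(1) l(1) P(1) by (simp add: subgroup.m_closed subgroup.m_inv_closed)
      ultimately show "D \<in> act.orb C" by (auto simp: act.orb_def)
    qed
    then have "act.orb C = X" using act.orb_subset[OF C] by blast
    moreover have "act.stab C = {g \<in> P. C #> g = C}"
      using coset_mult_inv_iff[OF sub[OF C]] PG by (auto simp: act.stab_def)
    ultimately have "card X * card {g \<in> P. C #> g = C} = card X * card S"
      using act.card_orb_stab[OF C] cX by (simp add: order_def)
    moreover have "card X \<noteq> 0" using C P(2) by (auto simp: X_def)
    ultimately show ?thesis by simp
  qed
qed

text \<open>Let \<open>S\<close> be a Sylow \<open>p\<close>-subgroup. The number of fixed points of a tuple on the cosets of \<open>S\<close> is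
  prime to \<open>p\<close>, so its \<open>j\<close>-th power is 1 modulo the required divisor, where \<open>j\<close> is a totient. The sum of
  these powers counts the tuples in the stabilizers of \<open>j\<close>-tuples of cosets, which are
  \<open>p\<close>-groups.\<close>

theorem card_com_tuples_finite_group:
  assumes p: "prime p" and adm: "admissible p (map snd r)" and HP: "normal_in H P" and fP: "finite P"
    and r: "\<forall>s\<in>set r. coset_in H P (fst s)"
  shows "gcd (card H) (prod_list (map snd r)) dvd card (com_tuples G r)"
proof -
  have sH: "subgroup H G" and sP: "subgroup P G" and HsubP: "H \<subseteq> P" using HP by (auto simp: normal_in_def)
  have PG: "P \<subseteq> carrier G" using subgroup.subset[OF sP] .
  have HG: "H \<subseteq> carrier G" using subgroup.subset[OF sH] .
  have fH: "finite H" using finite_subset[OF HsubP fP] .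
  interpret GP: group "G\<lparr>carrier := P\<rparr>" using subgroup.subgroup_is_group[OF sP is_group] .
  have "card P \<noteq> 0" using fP subgroup.one_closed[OF sP] by auto
  moreover have "\<not> is_unit p" using p by auto
  ultimately obtain m where m: "card P = p ^ multiplicity p (card P) * m" "\<not> p dvd m"
    by (rule multiplicity_decompose')
  define a where "a = multiplicity p (card P)"
  have "order (G\<lparr>carrier := P\<rparr>) = p ^ a * m" using m(1) by (simp add: order_def a_def)
  from sylow_thm[OF p GP.is_group this] fP
  obtain S where S: "subgroup S (G\<lparr>carrier := P\<rparr>)" "card S = p ^ a" by auto
  have sS: "subgroup S G" using incl_subgroup[OF sP S(1)] .
  have SP: "S \<subseteq> P" using subgroup.subset[OF S(1)] by simp
  define X where "X = (\<lambda>g. S #> g) ` P"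
  note X = right_coset_action[OF sS sP fP SP, folded X_def]
  have fX: "finite X" using fP by (simp add: X_def)
  have "card X * p ^ a = m * p ^ a" using X(3) S(2) m(1) by (simp add: a_def mult.commute)
  then have cX: "card X = m" using p by simp
  define T where "T = com_tuples G r"
  have fT: "finite T"
    unfolding T_def by (rule finite_com_tuples) (use r fP in \<open>meson coset_in_def finite_subset\<close>)
  have TP: "set xs \<subseteq> P" if xs: "xs \<in> T" for xs
  proof
    fix y assume "y \<in> set xs"
    then obtain s where "s \<in> set r" "y \<in> fst s" using com_tuples_set[OF xs[unfolded T_def]] by blast
    then show "y \<in> P" using r unfolding coset_in_def by blast
  qed
  obtain b where b: "prod_list (map snd r) = p ^ b" using admissible_prod[OF adm] by blast
  define j where "j = totient (p ^ b)"
  \<comment> \<open>The lists of cosets below must be nonempty: the empty list has stabilizer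
    \<open>P\<close>, which need not be a \<open>p\<close>-group.\<close>
  have j0: "j > 0" using p by (simp add: j_def prime_gt_0_nat)
  define n where "n xs = card {C \<in> X. \<forall>y\<in>set xs. C #> y = C}" for xs
  have n1: "[n xs ^ j = 1] (mod p ^ b)" if xs: "xs \<in> T" for xs
  proof -
    have "\<forall>s\<in>set r. fst s \<subseteq> P \<and> (\<exists>b. snd s = p ^ b)"
      using r admissible_power[OF adm] by (simp add: coset_in_def)
    then have "[n xs = card X] (mod p)"
      unfolding n_def using com_tuples_fixed_points_cong[OF p fX X(1) PG X(2)] xs[unfolded T_def] by blast
    then have "\<not> p dvd n xs" using m(2) cX cong_dvd_iff by blast
    then have "coprime (n xs) (p ^ b)" using p by (simp add: prime_imp_coprime coprime_commute)
    then show ?thesis unfolding j_def by (rule euler_theorem)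
  qed
  have sum1: "[(\<Sum>xs\<in>T. n xs ^ j) = card T] (mod p ^ b)"
    using cong_sum[of T "\<lambda>xs. n xs ^ j" "\<lambda>_. 1" "p ^ b"] n1 by simp
  define LL where "LL = {L. set L \<subseteq> X \<and> length L = j}"
  define R where "R L = {g \<in> P. \<forall>C\<in>set L. C #> g = C}" for L
  have fLL: "finite LL" unfolding LL_def using finite_lists_length_eq[OF fX] .
  have sR: "subgroup (R L) G" if "L \<in> LL" for L
    unfolding R_def by (rule stabilizer_subgroup[OF sS sP]) (use that in \<open>simp add: LL_def X_def\<close>)
  have RP: "R L \<subseteq> P" for L by (auto simp: R_def)
  define w where "w L = card (com_tuples G (restr (R L) r))" for L
  have "(\<Sum>xs\<in>T. n xs ^ j) = (\<Sum>xs\<in>T. \<Sum>L\<in>LL. of_bool (set xs \<subseteq> R L))"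
  proof (rule sum.cong[OF refl])
    fix xs assume xs: "xs \<in> T"
    have "n xs ^ j = card {L. set L \<subseteq> {C \<in> X. \<forall>y\<in>set xs. C #> y = C} \<and> length L = j}"
      unfolding n_def by (rule card_lists_length_eq[symmetric]) (use fX in simp)
    also have "{L. set L \<subseteq> {C \<in> X. \<forall>y\<in>set xs. C #> y = C} \<and> length L = j} = {L \<in> LL. set xs \<subseteq> R L}"
      using TP[OF xs] by (auto simp: LL_def R_def)
    also have "card \<dots> = (\<Sum>L\<in>LL. of_bool (set xs \<subseteq> R L))"
      using fLL by (simp add: sum.If_cases of_bool_def Int_def conj_commute)
    finally show "n xs ^ j = (\<Sum>L\<in>LL. of_bool (set xs \<subseteq> R L))" .
  qed
  also have "\<dots> = (\<Sum>L\<in>LL. \<Sum>xs\<in>T. of_bool (set xs \<subseteq> R L))" by (rule sum.swap)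
  also have "\<dots> = sum w LL"
    using fT by (simp add: w_def com_tuples_restr T_def[symmetric] sum.If_cases of_bool_def Int_def conj_commute)
  finally have sum2: "(\<Sum>xs\<in>T. n xs ^ j) = sum w LL" .
  have LLG: "C \<subseteq> carrier G" if "L \<in> LL" "C \<in> set L" for L C using that X(1) by (auto simp: LL_def)
  interpret GH: group "G\<lparr>carrier := H\<rparr>" using subgroup.subgroup_is_group[OF sH is_group] .
  interpret act: finite_action "G\<lparr>carrier := H\<rparr>" "\<lambda>h. map (\<lambda>C. C #> inv h)" LL
  proof
    show "finite (carrier (G\<lparr>carrier := H\<rparr>))" "finite LL" using fH fLL by auto
    fix g L assume g: "g \<in> carrier (G\<lparr>carrier := H\<rparr>)" and L: "L \<in> LL"
    have "inv g \<in> P" using g HsubP subgroup.m_inv_closed[OF sP] by auto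
    then show "map (\<lambda>C. C #> inv g) L \<in> LL" using L X(2) by (auto simp: LL_def)
    fix h assume h: "h \<in> carrier (G\<lparr>carrier := H\<rparr>)"
    have "g \<in> carrier G" "h \<in> carrier G" using g h HG by auto
    then have "C #> inv (g \<otimes> h) = (C #> inv h) #> inv g" if "C \<in> set L" for C
      using coset_mult_assoc[OF LLG[OF L that], of "inv h" "inv g"] by (simp add: inv_mult_group)
    then show "map (\<lambda>C. C #> inv (g \<otimes>\<^bsub>G\<lparr>carrier := H\<rparr>\<^esub> h)) L = map (\<lambda>C. C #> inv g) (map (\<lambda>C. C #> inv h) L)"
      by simp
  next
    fix L assume "L \<in> LL"
    then show "map (\<lambda>C. C #> inv \<one>\<^bsub>G\<lparr>carrier := H\<rparr>\<^esub>) L = L"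
      using coset_mult_one[OF LLG] by (auto intro!: map_idI)
  qed
  have "gcd (card H) (p ^ b) dvd sum w LL"
  proof (rule act.sum_dvd)
    fix h L assume "h \<in> carrier (G\<lparr>carrier := H\<rparr>)" and L: "L \<in> LL"
    then have h: "h \<in> H" "h \<in> carrier G" "h \<in> P" "inv h \<in> P"
      using HG HsubP subgroup.m_inv_closed[OF sP] by auto
    show "w (map (\<lambda>C. C #> inv h) L) = w L"
      unfolding w_def
    proof (rule card_com_tuples_restr_cnj[OF HP r h(1)])
      fix y assume y: "y \<in> carrier G"
      have "cnj h y \<in> P \<longleftrightarrow> y \<in> P"
      proof
        assume "cnj h y \<in> P"
        then have "inv h \<otimes> cnj h y \<otimes> h \<in> P" using h sP by (simp add: subgroup.m_closed)
        then show "y \<in> P" using cnj_inv_cancel(2)[OF h(2) y] h(2) by simp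
      qed (use h sP in \<open>simp add: subgroup.m_closed\<close>)
      moreover have "(C #> inv h) #> cnj h y = C #> inv h \<longleftrightarrow> C #> y = C" if C: "C \<in> set L" for C
      proof -
        note CG = LLG[OF L C]
        have "inv h \<otimes> cnj h y = y \<otimes> inv h" using h(2) y by (simp flip: m_assoc)
        then have e: "(C #> inv h) #> cnj h y = (C #> y) #> inv h"
          using coset_mult_assoc[OF CG, of "inv h" "cnj h y"] coset_mult_assoc[OF CG, of y "inv h"] h(2) y by simp
        have undo: "(D #> inv h) #> h = D" if "D \<subseteq> carrier G" for D
          using coset_mult_assoc[OF that, of "inv h" h] h(2) that by simp
        show ?thesis
          unfolding e
        proof
          assume "(C #> y) #> inv h = C #> inv h"
          then have "((C #> y) #> inv h) #> h = (C #> inv h) #> h" by simp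
          then show "C #> y = C" unfolding undo[OF CG] undo[OF r_coset_subset_G[OF CG y]] .
        qed simp
      qed
      ultimately show "cnj h y \<in> R (map (\<lambda>C. C #> inv h) L) \<longleftrightarrow> y \<in> R L" by (simp add: R_def)
    qed
  next
    fix L assume L: "L \<in> LL"
    have "L \<noteq> []" using L j0 by (auto simp: LL_def)
    then obtain C where C: "C \<in> set L" by (cases L) auto
    then have CX: "C \<in> X" using L by (auto simp: LL_def)
    \<comment> \<open>\<open>R L\<close> fixes the coset \<open>C\<close>, so it lies in a
      stabilizer of order \<open>p ^ a\<close>.\<close>
    have "subgroup {g \<in> P. \<forall>D\<in>{C}. D #> g = D} G"
      by (rule stabilizer_subgroup[OF sS sP]) (use CX in \<open>simp add: X_def\<close>)
    moreover have "card {g \<in> P. \<forall>D\<in>{C}. D #> g = D} = p ^ a" using X(4)[OF CX] S(2) by simp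
    moreover have "R L \<subseteq> {g \<in> P. \<forall>D\<in>{C}. D #> g = D}" using C by (auto simp: R_def)
    ultimately obtain e where e: "card (R L) = p ^ e"
      using card_subgroup_prime_power[OF p _ sR[OF L]] by blast
    have PR: "P \<inter> R L = R L" using RP by blast
    have "\<forall>s\<in>set (restr (R L) r). coset_in (H \<inter> R L) (R L) (fst s)"
      using r coset_in_Int[OF _ sR[OF L], of H P] unfolding PR by (auto simp: restr_def)
    then have d: "gcd (card (H \<inter> R L)) (p ^ b) dvd w L"
      using card_com_tuples_prime_power_group[OF p adm _ e normal_in_Int[OF HP sR[OF L], unfolded PR], of "restr (R L) r"]
      by (simp add: w_def b)
    have "act.stab L = H \<inter> R L"
    proof -
      have "map (\<lambda>C. C #> inv h) L = L \<longleftrightarrow> (\<forall>C\<in>set L. C #> h = C)" if "h \<in> H" for h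
      proof -
        have "map (\<lambda>C. C #> inv h) L = L \<longleftrightarrow> (\<forall>C\<in>set L. C #> inv h = C)"
          using map_eq_conv[of "\<lambda>C. C #> inv h" L "\<lambda>C. C"] by simp
        also have "\<dots> \<longleftrightarrow> (\<forall>C\<in>set L. C #> h = C)"
          using coset_mult_inv_iff[OF LLG[OF L] subsetD[OF HG that]] by (rule ball_cong[OF refl])
        finally show ?thesis .
      qed
      then show ?thesis using HsubP by (auto simp: act.stab_def R_def)
    qed
    then have os: "card (act.orb L) * card (H \<inter> R L) = card H" using act.card_orb_stab[OF L] by (simp add: order_def)
    \<comment> \<open>The prime power case only gives a gcd with
      \<open>card (H \<inter> R L)\<close>. The lost index in \<open>H\<close> comes back as the
      length of the orbit of \<open>L\<close>.\<close>
    have "gcd (card H) (p ^ b) dvd gcd (card (act.orb L) * card (H \<inter> R L)) (card (act.orb L) * p ^ b)"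
      unfolding os by (intro gcd_mono) auto
    also have "\<dots> = card (act.orb L) * gcd (card (H \<inter> R L)) (p ^ b)" by (simp add: gcd_mult_distrib_nat)
    also have "\<dots> dvd card (act.orb L) * w L" using d by simp
    finally show "gcd (card H) (p ^ b) dvd card (act.orb L) * w L" .
  qed
  then have "gcd (card H) (p ^ b) dvd (\<Sum>xs\<in>T. n xs ^ j)" using sum2 by simp
  moreover have "[(\<Sum>xs\<in>T. n xs ^ j) = card T] (mod gcd (card H) (p ^ b))"
    using cong_dvd_modulus_nat[OF sum1] by simp
  ultimately have "gcd (card H) (p ^ b) dvd card T" using cong_dvd_iff by blast
  then show ?thesis unfolding b T_def .
qed

end

section \<open>Infinite groups\<close>

lemma com_tuples_pow:
  "xs \<in> com_tuples G r \<Longrightarrow> y \<in> set xs \<Longrightarrow> \<exists>s\<in>set r. y \<in> fst s \<and> y [^]\<^bsub>G\<^esub> snd s = \<one>\<^bsub>G\<^esub>"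
proof (induction r arbitrary: xs)
  case (Cons t r)
  then obtain x ys where x: "xs = x # ys" "x \<in> fst t" "x [^]\<^bsub>G\<^esub> snd t = \<one>\<^bsub>G\<^esub>" "ys \<in> com_tuples G r" by auto
  then show ?case using Cons.IH[OF x(4)] Cons.prems(2) by auto
qed simp

lemma dvd_prod_list: "x \<in> set xs \<Longrightarrow> x dvd prod_list (xs :: nat list)"
  by (induction xs) auto

context group
begin

section \<open>Words in a normal set and Dietzmann's lemma\<close>

definition word :: "'a list \<Rightarrow> 'a" where "word w = foldr (\<otimes>) w \<one>"

lemma word_simps [simp]: "word [] = \<one>" "word (a # w) = a \<otimes> word w"
  by (simp_all add: word_def)

lemma word_closed [simp]: "set w \<subseteq> carrier G \<Longrightarrow> word w \<in> carrier G"
  by (induction w) auto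

lemma word_append: "set v \<subseteq> carrier G \<Longrightarrow> set w \<subseteq> carrier G \<Longrightarrow> word (v @ w) = word v \<otimes> word w"
  by (induction v) (auto simp: m_assoc)

lemma word_replicate: "y \<in> carrier G \<Longrightarrow> word (replicate n y) = y [^] n"
proof (induction n)
  case (Suc n)
  then show ?case using nat_pow_Suc2[of y n] by simp
qed simp

text \<open>Pulling occurrences of \<open>y\<close> to the front conjugates the letters they pass by
  powers of \<open>y\<close>. The new letters stay in \<open>Y\<close>, which is invariant under
  conjugation, and the total length is kept.\<close>

lemma word_collect:
  assumes Y: "Y \<subseteq> carrier G" "\<And>h g. h \<in> Y \<Longrightarrow> g \<in> carrier G \<Longrightarrow> cnj g h \<in> Y" and y: "y \<in> Y"
  shows "set w \<subseteq> Y \<Longrightarrow> \<exists>v. set v \<subseteq> Y \<and> length v + count_list w y = length w \<and>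
    word w = y [^] count_list w y \<otimes> word v"
proof (induction w)
  case (Cons a w)
  then obtain v where v: "set v \<subseteq> Y" "length v + count_list w y = length w"
    "word w = y [^] count_list w y \<otimes> word v" by auto
  have G: "y \<in> carrier G" "a \<in> carrier G" "word v \<in> carrier G" using y Y(1) Cons.prems v(1) by auto
  show ?case
  proof (cases "a = y")
    case True
    have "word (a # w) = y [^] Suc (count_list w y) \<otimes> word v"
      using v(3) True G nat_pow_Suc2[OF G(1), of "count_list w y"] by (simp add: m_assoc del: nat_pow_Suc)
    then show ?thesis using v True by (intro exI[of _ v]) simp
  next
    case False
    let ?u = "y [^] count_list w y"
    have "word (a # w) = ?u \<otimes> (inv ?u \<otimes> a \<otimes> inv (inv ?u) \<otimes> word v)"
      using v(3) G by (simp flip: m_assoc)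
    moreover have "inv ?u \<otimes> a \<otimes> inv (inv ?u) \<in> Y" using Y(2)[of a "inv ?u"] Cons.prems G by simp
    ultimately show ?thesis
      using v False by (intro exI[of _ "(inv ?u \<otimes> a \<otimes> inv (inv ?u)) # v"]) simp
  qed
qed simp

text \<open>Dietzmann's lemma: in a shortest word no letter occurs \<open>N\<close> times, since its occurrences can be
  collected at the front, so the length of shortest words is bounded.\<close>

lemma finite_generate_torsion:
  assumes fY: "finite Y" and Y: "Y \<subseteq> carrier G" "\<And>h g. h \<in> Y \<Longrightarrow> g \<in> carrier G \<Longrightarrow> cnj g h \<in> Y"
    and N: "N > 0" "\<And>y. y \<in> Y \<Longrightarrow> y [^] (N::nat) = \<one>"
  shows "finite (generate G Y)"
proof -
  have w: "\<exists>w. set w \<subseteq> Y \<and> word w = x" if "x \<in> generate G Y" for x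
    using that
  proof induction
    case one show ?case by (intro exI[of _ "[]"]) simp
  next
    case (incl h) then show ?case using Y(1) by (intro exI[of _ "[h]"]) auto
  next
    case (inv h)
    then have hG: "h \<in> carrier G" using Y(1) by blast
    \<comment> \<open>Torsion allows an inverse to be written as a word in \<open>Y\<close>
      itself.\<close>
    have "h [^] (N - 1) \<otimes> h = \<one>" using N(2)[OF inv] N(1) by (simp flip: nat_pow_Suc)
    then have "h [^] (N - 1) = inv h" using hG by (simp add: inv_equality)
    then show ?case using inv word_replicate[OF hG]
      by (intro exI[of _ "replicate (N - 1) h"]) auto
  next
    case (eng h1 h2)
    then obtain v w where "set v \<subseteq> Y" "word v = h1" "set w \<subseteq> Y" "word w = h2" by blast
    then show ?case using word_append[of v w] Y(1) by (intro exI[of _ "v @ w"]) auto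
  qed
  have short: "\<exists>w. set w \<subseteq> Y \<and> length w \<le> card Y * N \<and> word w = x" if x: "x \<in> generate G Y" for x
  proof -
    obtain w where w: "set w \<subseteq> Y \<and> word w = x"
      and min: "\<And>v. set v \<subseteq> Y \<and> word v = x \<Longrightarrow> length w \<le> length v"
      using ex_has_least_nat[of "\<lambda>w. set w \<subseteq> Y \<and> word w = x" _ length] w[OF x] by metis
    have "count_list w y \<le> N" if y: "y \<in> Y" for y
    proof (rule ccontr)
      assume "\<not> count_list w y \<le> N"
      then have c: "N < count_list w y" by simp
      obtain v where v: "set v \<subseteq> Y" "length v + count_list w y = length w"
        "word w = y [^] count_list w y \<otimes> word v"
        using word_collect[OF Y y] w by blast
      have yG: "y \<in> carrier G" using y Y(1) by blast
      have "y [^] count_list w y = y [^] N \<otimes> y [^] (count_list w y - N)"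
        using yG c by (simp add: nat_pow_mult)
      moreover have "set (replicate (count_list w y - N) y) \<subseteq> carrier G" "set v \<subseteq> carrier G"
        using yG v(1) Y(1) by auto
      ultimately have "word (replicate (count_list w y - N) y @ v) = word w"
        using v(3) word_append word_replicate[OF yG] N(2)[OF y] yG by simp
      moreover have "set (replicate (count_list w y - N) y @ v) \<subseteq> Y" using v(1) y by auto
      ultimately have "length w \<le> length (replicate (count_list w y - N) y @ v)" using min w by blast
      then show False using v(2) c N(1) by simp
    qed
    then have "(\<Sum>y\<in>Y. count_list w y) \<le> card Y * N" using sum_bounded_above[of Y "count_list w" N] by simp
    then show ?thesis using sum_count_set[of w Y] w fY by auto
  qed
  have "generate G Y \<subseteq> word ` {w. set w \<subseteq> Y \<and> length w \<le> card Y * N}" using short by blast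
  then show ?thesis using finite_lists_length_le[OF fY] finite_subset by blast
qed

text \<open>The invariance \<open>rc\<close> under all of \<open>G\<close> makes the set of entries
  normal, so it generates a finite normal subgroup \<open>J\<close>. The finite theorem is applied
  in the product of \<open>J\<close> and \<open>K\<close>: it contains all tuples, and
  \<open>K\<close> is adjoined so that \<open>card K\<close> divides the order of its intersection
  with \<open>H\<close>.\<close>

theorem card_subgroup_dvd_card_com_tuples:
  assumes p: "prime p" and adm: "admissible p (map snd r)" and H: "normal_in H (carrier G)"
    and r: "\<forall>s\<in>set r. coset_in H (carrier G) (fst s)"
    and rc: "\<And>s g k. s \<in> set r \<Longrightarrow> g \<in> carrier G \<Longrightarrow> k \<in> fst s \<Longrightarrow> cnj g k \<in> fst s"
    and fin: "finite (com_tuples G r)"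
    and K: "subgroup K G" "finite K" "K \<subseteq> H" "card K dvd prod_list (map snd r)"
  shows "card K dvd card (com_tuples G r)"
proof -
  define Y where "Y = \<Union>(set ` com_tuples G r)"
  obtain b where b: "prod_list (map snd r) = p ^ b" using admissible_prod[OF adm] by blast
  have fY: "finite Y" using fin by (simp add: Y_def)
  have rG: "\<forall>s\<in>set r. fst s \<subseteq> carrier G" using r by (simp add: coset_in_def)
  have YG: "Y \<subseteq> carrier G" using com_tuples_set[of _ G r] rG unfolding Y_def by blast
  have Yc: "cnj g h \<in> Y" if h: "h \<in> Y" and g: "g \<in> carrier G" for h g
  proof -
    obtain xs where xs: "xs \<in> com_tuples G r" "h \<in> set xs" using h by (auto simp: Y_def)
    have "map (cnj g) xs \<in> com_tuples G r" using com_tuples_cnj[OF g xs(1)] rG rc g by blast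
    moreover have "cnj g h \<in> set (map (cnj g) xs)" using xs(2) by simp
    ultimately show ?thesis unfolding Y_def by blast
  qed
  have Yp: "y [^] (p ^ b) = \<one>" if y: "y \<in> Y" for y
  proof -
    have yG: "y \<in> carrier G" using y YG by blast
    obtain xs where "xs \<in> com_tuples G r" "y \<in> set xs" using y by (auto simp: Y_def)
    then obtain s where s: "s \<in> set r" "y [^] snd s = \<one>" using com_tuples_pow by metis
    then have "snd s dvd p ^ b" using dvd_prod_list[of "snd s" "map snd r"] b by simp
    then obtain t where "p ^ b = snd s * t" by blast
    then show ?thesis using s(2) yG by (simp flip: nat_pow_pow)
  qed
  define J where "J = generate G Y"
  have nJ: "J \<lhd> G" unfolding J_def by (rule normal_generateI[OF YG]) (rule Yc)
  have sJ: "subgroup J G" using nJ by (rule normal_imp_subgroup)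
  have fJ: "finite J" unfolding J_def
    by (rule finite_generate_torsion[OF fY YG Yc, of "p ^ b"]) (use p Yp in \<open>auto simp: prime_gt_0_nat\<close>)
  define P where "P = J <#> K"
  have sP: "subgroup P G" unfolding P_def by (rule mult_norm_subgroup[OF nJ K(1)])
  have fP: "finite P" using fJ K(2) by (simp add: P_def set_mult_def)
  have KP: "K \<subseteq> P"
  proof
    fix k assume k: "k \<in> K"
    have "k = \<one> \<otimes> k" using subgroup.mem_carrier[OF K(1) k] by simp
    then show "k \<in> P" using k subgroup.one_closed[OF sJ] by (auto simp: P_def set_mult_def)
  qed
  have YP: "Y \<subseteq> P"
  proof
    fix y assume y: "y \<in> Y"
    then have "y = y \<otimes> \<one>" using YG by auto
    moreover have "y \<in> J" using y by (simp add: J_def generate.incl)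
    ultimately show "y \<in> P" using subgroup.one_closed[OF K(1)] by (auto simp: P_def set_mult_def)
  qed
  have CP: "carrier G \<inter> P = P" using subgroup.subset[OF sP] by blast
  have nP: "normal_in (H \<inter> P) P" using normal_in_Int[OF H sP] unfolding CP .
  have rP: "\<forall>s\<in>set (restr P r). coset_in (H \<inter> P) P (fst s)"
    using r coset_in_Int[OF _ sP, of H "carrier G"] unfolding CP by (auto simp: restr_def)
  have "com_tuples G (restr P r) = com_tuples G r" using YP by (auto simp: com_tuples_restr Y_def)
  moreover have "gcd (card (H \<inter> P)) (prod_list (map snd r)) dvd card (com_tuples G (restr P r))"
    using card_com_tuples_finite_group[OF p _ nP fP rP] adm by simp
  moreover have "card K dvd card (H \<inter> P)"
    by (rule card_subgroup_dvd[OF K(1)]) (use nP K(3) KP fP in \<open>auto simp: normal_in_def\<close>)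
  ultimately show ?thesis using K(4) by (metis dvd_trans gcd_greatest)
qed

end

section \<open>Crossed homomorphisms as commuting tuples\<close>

lemma com_tuples_iff:
  "xs \<in> com_tuples G r \<longleftrightarrow> length xs = length r \<and>
    (\<forall>i<length r. xs ! i \<in> fst (r ! i) \<and> xs ! i [^]\<^bsub>G\<^esub> snd (r ! i) = \<one>\<^bsub>G\<^esub> \<and>
      (\<forall>j<length r. i < j \<longrightarrow> xs ! j \<in> cent G (xs ! i)))"
proof (induction r arbitrary: xs)
  case (Cons s r)
  show ?case
  proof (cases xs)
    case (Cons x ys)
    have "set ys \<subseteq> cent G x \<longleftrightarrow> (\<forall>j<length r. ys ! j \<in> cent G x)" if "length ys = length r"
      using that by (auto simp: in_set_conv_nth subset_iff)
    then show ?thesis using Cons.IH[of ys] unfolding Cons by (auto simp: All_less_Suc2)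
  qed simp
qed simp

text \<open>The pair \<open>(h, a)\<close> stands for the product of \<open>a\<close> and
  \<open>h\<close> in this order. With the right action, moving \<open>h\<close> past
  \<open>b\<close> turns it into \<open>act h b\<close>, which gives this multiplication and makes
  \<open>\<alpha>\<close> crossed exactly when \<open>a \<mapsto> (\<alpha> a, a)\<close> is
  multiplicative.\<close>

definition semidirect ::
    "('a, 'c) monoid_scheme \<Rightarrow> ('b, 'd) monoid_scheme \<Rightarrow> ('b \<Rightarrow> 'a \<Rightarrow> 'b) \<Rightarrow> ('b \<times> 'a) monoid" where
  "semidirect M H act = \<lparr>carrier = carrier H \<times> carrier M,
     monoid.mult = (\<lambda>(h, a) (k, b). (act h b \<otimes>\<^bsub>H\<^esub> k, a \<otimes>\<^bsub>M\<^esub> b)), one = (\<one>\<^bsub>H\<^esub>, \<one>\<^bsub>M\<^esub>)\<rparr>"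

locale automorphism_action = M: comm_group M + H: group H
  for M :: "('a, 'c) monoid_scheme" and H :: "('b, 'd) monoid_scheme" +
  fixes act :: "'b \<Rightarrow> 'a \<Rightarrow> 'b"
  assumes action: "right_action_by_automorphisms M H act"
begin

abbreviation "S \<equiv> semidirect M H act"

lemma act_closed [simp]: "h \<in> carrier H \<Longrightarrow> a \<in> carrier M \<Longrightarrow> act h a \<in> carrier H"
  using action by (auto simp: right_action_by_automorphisms_def iso_def hom_def)

lemma act_hom: "h \<in> carrier H \<Longrightarrow> k \<in> carrier H \<Longrightarrow> a \<in> carrier M \<Longrightarrow>
    act (h \<otimes>\<^bsub>H\<^esub> k) a = act h a \<otimes>\<^bsub>H\<^esub> act k a"
  using action by (auto simp: right_action_by_automorphisms_def iso_def hom_def)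

lemma act_one [simp]: "h \<in> carrier H \<Longrightarrow> act h \<one>\<^bsub>M\<^esub> = h"
  using action by (simp add: right_action_by_automorphisms_def)

lemma act_mult: "h \<in> carrier H \<Longrightarrow> a \<in> carrier M \<Longrightarrow> b \<in> carrier M \<Longrightarrow>
    act h (a \<otimes>\<^bsub>M\<^esub> b) = act (act h a) b"
  using action by (simp add: right_action_by_automorphisms_def)

lemma one_act [simp]: "a \<in> carrier M \<Longrightarrow> act \<one>\<^bsub>H\<^esub> a = \<one>\<^bsub>H\<^esub>"
  using act_hom[of "\<one>\<^bsub>H\<^esub>" "\<one>\<^bsub>H\<^esub>" a] H.l_cancel_one[of "act \<one>\<^bsub>H\<^esub> a" "act \<one>\<^bsub>H\<^esub> a"] by simp

lemma carrier_semidirect [simp]: "carrier S = carrier H \<times> carrier M"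
  by (simp add: semidirect_def)

lemma one_semidirect [simp]: "\<one>\<^bsub>S\<^esub> = (\<one>\<^bsub>H\<^esub>, \<one>\<^bsub>M\<^esub>)"
  by (simp add: semidirect_def)

lemma mult_semidirect [simp]: "(h, a) \<otimes>\<^bsub>S\<^esub> (k, b) = (act h b \<otimes>\<^bsub>H\<^esub> k, a \<otimes>\<^bsub>M\<^esub> b)"
  by (simp add: semidirect_def)

sublocale S: group S
proof (rule groupI)
  fix x y z assume "x \<in> carrier S" "y \<in> carrier S" "z \<in> carrier S"
  then show "x \<otimes>\<^bsub>S\<^esub> y \<otimes>\<^bsub>S\<^esub> z = x \<otimes>\<^bsub>S\<^esub> (y \<otimes>\<^bsub>S\<^esub> z)"
    by (cases x; cases y; cases z) (simp add: act_hom act_mult H.m_assoc M.m_assoc)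
next
  fix x assume "x \<in> carrier S"
  then obtain h a where x: "x = (h, a)" "h \<in> carrier H" "a \<in> carrier M" by auto
  have "act (act (inv\<^bsub>H\<^esub> h) (inv\<^bsub>M\<^esub> a)) a = inv\<^bsub>H\<^esub> h"
    using x act_mult[of "inv\<^bsub>H\<^esub> h" "inv\<^bsub>M\<^esub> a" a] by simp
  then show "\<exists>y\<in>carrier S. y \<otimes>\<^bsub>S\<^esub> x = \<one>\<^bsub>S\<^esub>"
    using x by (intro bexI[of _ "(act (inv\<^bsub>H\<^esub> h) (inv\<^bsub>M\<^esub> a), inv\<^bsub>M\<^esub> a)"]) auto
qed auto

lemma inv_semidirect:
  "h \<in> carrier H \<Longrightarrow> a \<in> carrier M \<Longrightarrow> snd (inv\<^bsub>S\<^esub> (h, a)) = inv\<^bsub>M\<^esub> a"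
proof -
  assume *: "h \<in> carrier H" "a \<in> carrier M"
  then have "inv\<^bsub>S\<^esub> (h, a) \<in> carrier S" "inv\<^bsub>S\<^esub> (h, a) \<otimes>\<^bsub>S\<^esub> (h, a) = \<one>\<^bsub>S\<^esub>"
    using S.inv_closed[of "(h, a)"] S.l_inv[of "(h, a)"] by auto
  then show ?thesis using * by (cases "inv\<^bsub>S\<^esub> (h, a)") (auto simp: M.inv_equality)
qed

lemma snd_hom: "snd \<in> hom S M"
  by (rule homI) auto

text \<open>\<open>M\<close> is commutative, so conjugation in \<open>S\<close> is invisible in the
  second component. Hence the cosets of \<open>kernel\<close> are invariant under all of
  \<open>S\<close>, as the reduction by Dietzmann's lemma requires.\<close>

lemma snd_cnj: "x \<in> carrier S \<Longrightarrow> y \<in> carrier S \<Longrightarrow> snd (S.cnj x y) = snd y"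
proof -
  assume *: "x \<in> carrier S" "y \<in> carrier S"
  then have "snd (S.cnj x y) = snd x \<otimes>\<^bsub>M\<^esub> snd y \<otimes>\<^bsub>M\<^esub> inv\<^bsub>M\<^esub> (snd x)"
    using hom_mult[OF snd_hom, of "x \<otimes>\<^bsub>S\<^esub> y" "inv\<^bsub>S\<^esub> x"] hom_mult[OF snd_hom, of x y]
      S.m_closed[of x y] S.inv_closed[of x] inv_semidirect[of "fst x" "snd x"] by (cases x) auto
  then show ?thesis using * M.m_comm[of "snd x" "snd y"] by (auto simp: M.m_assoc)
qed

definition kernel where "kernel = carrier H \<times> {\<one>\<^bsub>M\<^esub>}"

lemma in_kernel: "x \<in> carrier S \<Longrightarrow> x \<in> kernel \<longleftrightarrow> snd x = \<one>\<^bsub>M\<^esub>"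
  by (auto simp: kernel_def)

lemma kernel_normal: "S.normal_in kernel (carrier S)"
proof -
  have "subgroup kernel S"
  proof
    fix x y assume "x \<in> kernel" "y \<in> kernel"
    then show "x \<otimes>\<^bsub>S\<^esub> y \<in> kernel" by (auto simp: kernel_def)
  next
    fix x assume x: "x \<in> kernel"
    then have "inv\<^bsub>S\<^esub> x \<in> carrier S" "snd (inv\<^bsub>S\<^esub> x) = \<one>\<^bsub>M\<^esub>"
      using S.inv_closed[of x] inv_semidirect[of "fst x" "snd x"] by (auto simp: kernel_def)
    then show "inv\<^bsub>S\<^esub> x \<in> kernel" by (cases "inv\<^bsub>S\<^esub> x") (auto simp: kernel_def)
  qed (auto simp: kernel_def)
  moreover have "\<forall>g\<in>carrier S. \<forall>h\<in>kernel. S.cnj g h \<in> kernel"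
  proof (intro ballI)
    fix g h assume that: "g \<in> carrier S" "h \<in> kernel"
    have h: "h \<in> carrier S" "snd h = \<one>\<^bsub>M\<^esub>" using that(2) by (auto simp: kernel_def)
    have "S.cnj g h \<in> carrier S" using that(1) h(1) S.m_closed S.inv_closed by blast
    then show "S.cnj g h \<in> kernel" using snd_cnj[OF that(1) h(1)] h(2) in_kernel by simp
  qed
  moreover have "kernel \<subseteq> carrier S" by (auto simp: kernel_def)
  ultimately show ?thesis unfolding S.normal_in_def using S.subgroup_self by blast
qed

lemma coset_in_kernel:
  assumes e: "e \<in> carrier M"
  shows "S.coset_in kernel (carrier S) (carrier H \<times> {e})"
  unfolding S.coset_in_def
proof (intro conjI ballI)
  fix x y assume x: "x \<in> carrier H \<times> {e}" and y: "y \<in> carrier S"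
  have xS: "x \<in> carrier S" using x e by auto
  have "inv\<^bsub>S\<^esub> x \<otimes>\<^bsub>S\<^esub> y \<in> carrier S" using xS y S.m_closed S.inv_closed by blast
  moreover have "snd (inv\<^bsub>S\<^esub> x \<otimes>\<^bsub>S\<^esub> y) = inv\<^bsub>M\<^esub> e \<otimes>\<^bsub>M\<^esub> snd y"
    using hom_mult[OF snd_hom S.inv_closed[OF xS] y] inv_semidirect[of "fst x" e] x e by auto
  moreover have "inv\<^bsub>M\<^esub> e \<otimes>\<^bsub>M\<^esub> b = \<one>\<^bsub>M\<^esub> \<longleftrightarrow> b = e" if b: "b \<in> carrier M" for b
  proof
    assume "inv\<^bsub>M\<^esub> e \<otimes>\<^bsub>M\<^esub> b = \<one>\<^bsub>M\<^esub>"
    then have "e \<otimes>\<^bsub>M\<^esub> (inv\<^bsub>M\<^esub> e \<otimes>\<^bsub>M\<^esub> b) = e" using e by simp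
    then show "b = e" using e b by (simp flip: M.m_assoc)
  qed (use e in simp)
  moreover have "snd y \<in> carrier M" "fst y \<in> carrier H" using y by auto
  moreover have "y \<in> carrier H \<times> {e} \<longleftrightarrow> fst y \<in> carrier H \<and> snd y = e" by (cases y) simp
  ultimately show "y \<in> carrier H \<times> {e} \<longleftrightarrow> inv\<^bsub>S\<^esub> x \<otimes>\<^bsub>S\<^esub> y \<in> kernel"
    using in_kernel by simp
qed (use e in auto)

end

text \<open>The order of the factors is fixed by a list because these products are also formed in
  the noncommutative group \<open>S\<close>, where only the family \<open>x\<close> is known to
  commute.\<close>

definition pow_prod ::
    "('a, 'b) monoid_scheme \<Rightarrow> ('i \<Rightarrow> 'a) \<Rightarrow> ('i \<Rightarrow> int) \<Rightarrow> 'i list \<Rightarrow> 'a" where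
  "pow_prod G x k is = foldr (\<lambda>i y. x i [^]\<^bsub>G\<^esub> k i \<otimes>\<^bsub>G\<^esub> y) is \<one>\<^bsub>G\<^esub>"

lemma pow_prod_simps [simp]:
  "pow_prod G x k [] = \<one>\<^bsub>G\<^esub>"
  "pow_prod G x k (i # is) = x i [^]\<^bsub>G\<^esub> k i \<otimes>\<^bsub>G\<^esub> pow_prod G x k is"
  by (simp_all add: pow_prod_def)

lemma pow_prod_cong:
  "(\<And>i. i \<in> set is \<Longrightarrow> x i [^]\<^bsub>G\<^esub> k i = y i [^]\<^bsub>G\<^esub> l i) \<Longrightarrow> pow_prod G x k is = pow_prod G y l is"
  by (induction "is") auto

context group
begin

lemma pow_prod_subgroup:
  "subgroup T G \<Longrightarrow> (\<And>i. i \<in> set is \<Longrightarrow> x i \<in> T) \<Longrightarrow> pow_prod G x k is \<in> T"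
  by (induction "is") (auto simp: subgroup.one_closed subgroup.m_closed subgroup_int_pow_closed)

lemma pow_prod_closed:
  "(\<And>i. i \<in> set is \<Longrightarrow> x i \<in> carrier G) \<Longrightarrow> pow_prod G x k is \<in> carrier G"
  by (rule pow_prod_subgroup[OF subgroup_self])

lemma pow_prod_hom:
  assumes "group K" "f \<in> hom G K"
  shows "(\<And>i. i \<in> set is \<Longrightarrow> x i \<in> carrier G) \<Longrightarrow>
    f (pow_prod G x k is) = pow_prod K (\<lambda>i. f (x i)) k is"
proof (induction "is")
  case Nil then show ?case using hom_one[OF assms(2) is_group assms(1)] by simp
next
  case (Cons i "is")
  then have "x i \<in> carrier G" "pow_prod G x k is \<in> carrier G" by (auto intro!: pow_prod_closed)
  then show ?case
    using Cons hom_mult[OF assms(2), of "x i [^] k i" "pow_prod G x k is"]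
      hom_int_pow[OF assms(2) _ is_group assms(1), of "x i" "k i"] by simp
qed

lemma pow_prod_mult:
  "(\<And>i. i \<in> set is \<Longrightarrow> x i \<in> carrier G) \<Longrightarrow>
    (\<And>i j. i \<in> set is \<Longrightarrow> j \<in> set is \<Longrightarrow> x i \<otimes> x j = x j \<otimes> x i) \<Longrightarrow>
    pow_prod G x (\<lambda>i. k i + l i) is = pow_prod G x k is \<otimes> pow_prod G x l is"
proof (induction "is")
  case (Cons i "is")
  have G: "x i \<in> carrier G" "pow_prod G x k is \<in> carrier G" "pow_prod G x l is \<in> carrier G"
    using Cons.prems(1) by (auto intro!: pow_prod_closed)
  have "pow_prod G x k is \<in> cent G (x i)"
    by (rule pow_prod_subgroup[OF subgroup_cent[OF G(1)]]) (use Cons.prems in \<open>auto simp: cent_def\<close>)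
  then have "x i \<in> cent G (pow_prod G x k is)" using cent_sym[OF G(2,1)] by blast
  then have "x i [^] l i \<in> cent G (pow_prod G x k is)"
    by (rule subgroup_int_pow_closed[OF subgroup_cent[OF G(2)]])
  then have c: "x i [^] l i \<otimes> pow_prod G x k is = pow_prod G x k is \<otimes> x i [^] l i" by (simp add: cent_def)
  have "pow_prod G x (\<lambda>i. k i + l i) (i # is) =
      x i [^] k i \<otimes> (x i [^] l i \<otimes> pow_prod G x k is) \<otimes> pow_prod G x l is"
    using Cons G by (simp add: int_pow_mult m_assoc)
  also have "\<dots> = pow_prod G x k (i # is) \<otimes> pow_prod G x l (i # is)"
    unfolding c using G by (simp add: m_assoc)
  finally show ?case .
qed simp

lemma pow_prod_single:
  "distinct is \<Longrightarrow> (\<And>j. j \<in> set is \<Longrightarrow> x j \<in> carrier G) \<Longrightarrow> (\<And>j. j \<noteq> i \<Longrightarrow> k j = 0) \<Longrightarrow>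
    pow_prod G x k is = (if i \<in> set is then x i [^] k i else \<one>)"
proof (induction "is")
  case (Cons j "is")
  then show ?case by (cases "j = i") auto
qed simp

lemma int_pow_mod:
  assumes "x \<in> carrier G" "x [^] (q::nat) = \<one>"
  shows "x [^] (k mod int q) = x [^] k"
proof -
  have "x [^] k = x [^] (int q * (k div int q) + k mod int q)" by simp
  also have "\<dots> = (x [^] int q) [^] (k div int q) \<otimes> x [^] (k mod int q)"
    by (simp only: int_pow_mult[OF assms(1)] int_pow_pow[OF assms(1)])
  finally show ?thesis using assms by (simp add: int_pow_int)
qed

end

text \<open>\<open>M\<close> is the direct product of the cyclic groups of order \<open>q i\<close> generated by \<open>e i\<close>, and
  \<open>\<kappa> i\<close> reads off the exponent of \<open>e i\<close>.\<close>

locale automorphism_action_basis = automorphism_action M H act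
  for M :: "('a, 'c) monoid_scheme" and H :: "('b, 'd) monoid_scheme" and act +
  fixes n :: nat and q :: "nat \<Rightarrow> nat" and e :: "nat \<Rightarrow> 'a" and \<kappa> :: "nat \<Rightarrow> 'a \<Rightarrow> int"
  assumes q_pos: "i < n \<Longrightarrow> q i > 0"
    and e_closed: "i < n \<Longrightarrow> e i \<in> carrier M"
    and exponent_hom: "i < n \<Longrightarrow> \<kappa> i \<in> hom M (integer_mod_group (q i))"
    and exponent_basis: "i < n \<Longrightarrow> j < n \<Longrightarrow> \<kappa> i (e j) = (if i = j then 1 mod int (q i) else 0)"
    and exponent_inj: "a \<in> carrier M \<Longrightarrow> b \<in> carrier M \<Longrightarrow> (\<And>i. i < n \<Longrightarrow> \<kappa> i a = \<kappa> i b) \<Longrightarrow> a = b"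
begin

lemma exponent_range: "i < n \<Longrightarrow> a \<in> carrier M \<Longrightarrow> \<kappa> i a mod int (q i) = \<kappa> i a"
  using hom_in_carrier[OF exponent_hom, of i a] q_pos[of i] by (simp add: carrier_integer_mod_group)

text \<open>Under \<open>\<kappa> j\<close> every factor except the \<open>j\<close>-th becomes
  neutral.\<close>

lemma exponent_pow_prod:
  assumes j: "j < n"
  shows "\<kappa> j (pow_prod M e k [0..<n]) = k j mod int (q j)"
proof -
  let ?Z = "integer_mod_group (q j)"
  interpret Z: group ?Z by simp
  let ?k = "\<lambda>i. if i = j then k j else 0"
  have "\<kappa> j (pow_prod M e k [0..<n]) = pow_prod ?Z (\<lambda>i. \<kappa> j (e i)) k [0..<n]"
    by (rule M.pow_prod_hom[OF Z.is_group exponent_hom[OF j]]) (simp add: e_closed)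
  also have "\<dots> = pow_prod ?Z (\<lambda>i. \<kappa> j (e i)) ?k [0..<n]"
    by (rule pow_prod_cong) (use j in \<open>auto simp: exponent_basis int_pow_integer_mod_group\<close>)
  also have "\<dots> = \<kappa> j (e j) [^]\<^bsub>?Z\<^esub> k j"
    using Z.pow_prod_single[of "[0..<n]" "\<lambda>i. \<kappa> j (e i)" j ?k] j hom_in_carrier[OF exponent_hom[OF j] e_closed]
    by simp
  also have "\<dots> = k j mod int (q j)"
    using j by (simp add: exponent_basis int_pow_integer_mod_group mod_mult_right_eq)
  finally show ?thesis .
qed

lemma pow_prod_exponents:
  assumes a: "a \<in> carrier M"
  shows "pow_prod M e (\<lambda>i. \<kappa> i a) [0..<n] = a"
  by (rule exponent_inj) (use a in \<open>auto simp: exponent_pow_prod exponent_range e_closed intro!: M.pow_prod_closed\<close>)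

lemma basis_order:
  assumes i: "i < n"
  shows "e i [^]\<^bsub>M\<^esub> q i = \<one>\<^bsub>M\<^esub>"
proof (rule exponent_inj)
  fix j assume j: "j < n"
  have "\<kappa> j (e i [^]\<^bsub>M\<^esub> q i) = \<kappa> j (e i) [^]\<^bsub>integer_mod_group (q j)\<^esub> q i"
    by (rule hom_nat_pow[OF exponent_hom[OF j] e_closed[OF i]]) simp_all
  also have "\<dots> = 0" using i j by (auto simp: exponent_basis)
  also have "\<dots> = \<kappa> j \<one>\<^bsub>M\<^esub>"
    using hom_one[OF exponent_hom[OF j]] by simp
  finally show "\<kappa> j (e i [^]\<^bsub>M\<^esub> q i) = \<kappa> j \<one>\<^bsub>M\<^esub>" .
qed (use e_closed[OF i] in auto)

definition lifts where "lifts = map (\<lambda>i. (carrier H \<times> {e i}, q i)) [0..<n]"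

lemma crossed_hom_lift:
  assumes "\<alpha> \<in> crossed_homs M H act"
  shows "(\<lambda>a. (\<alpha> a, a)) \<in> hom M S"
  using assms by (intro homI) (auto simp: crossed_homs_def)

text \<open>A crossed homomorphism amounts to a homomorphic section of the projection from
  \<open>S\<close> to \<open>M\<close>, which is determined by the lifts of the basis. Conversely,
  commuting lifts killed by the orders of the basis elements extend to a section by taking products
  of powers.\<close>

lemma crossed_homs_bij:
  "bij_betw (\<lambda>\<alpha>. map (\<lambda>i. (\<alpha> (e i), e i)) [0..<n]) (crossed_homs M H act) (com_tuples S lifts)"
  unfolding bij_betw_def
proof
  show "inj_on (\<lambda>\<alpha>. map (\<lambda>i. (\<alpha> (e i), e i)) [0..<n]) (crossed_homs M H act)"
  proof (rule inj_onI)
    fix \<alpha> \<beta> assume \<alpha>: "\<alpha> \<in> crossed_homs M H act" and \<beta>: "\<beta> \<in> crossed_homs M H act"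
      and eq: "map (\<lambda>i. (\<alpha> (e i), e i)) [0..<n] = map (\<lambda>i. (\<beta> (e i), e i)) [0..<n]"
    have "\<alpha> a = \<beta> a" if a: "a \<in> carrier M" for a
    proof -
      have *: "(\<gamma> a, a) = pow_prod S (\<lambda>i. (\<gamma> (e i), e i)) (\<lambda>i. \<kappa> i a) [0..<n]"
        if "\<gamma> \<in> crossed_homs M H act" for \<gamma>
        using M.pow_prod_hom[OF S.is_group crossed_hom_lift[OF that], of "[0..<n]" e "\<lambda>i. \<kappa> i a"]
        by (simp add: pow_prod_exponents[OF a] e_closed)
      have "pow_prod S (\<lambda>i. (\<alpha> (e i), e i)) (\<lambda>i. \<kappa> i a) [0..<n] =
          pow_prod S (\<lambda>i. (\<beta> (e i), e i)) (\<lambda>i. \<kappa> i a) [0..<n]"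
        by (rule pow_prod_cong) (use eq in simp)
      then have "(\<alpha> a, a) = (\<beta> a, a)" unfolding *[OF \<alpha>, symmetric] *[OF \<beta>, symmetric] .
      then show ?thesis by simp
    qed
    moreover have "\<alpha> \<in> carrier M \<rightarrow>\<^sub>E carrier H" "\<beta> \<in> carrier M \<rightarrow>\<^sub>E carrier H"
      using \<alpha> \<beta> by (auto simp: crossed_homs_def)
    ultimately show "\<alpha> = \<beta>" by (metis PiE_ext)
  qed
next
  have len: "length lifts = n" by (simp add: lifts_def)
  have nth: "lifts ! i = (carrier H \<times> {e i}, q i)" if "i < n" for i using that by (simp add: lifts_def)
  have "map (\<lambda>i. (\<alpha> (e i), e i)) [0..<n] \<in> com_tuples S lifts" if \<alpha>: "\<alpha> \<in> crossed_homs M H act" for \<alpha>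
  proof -
    note hom = crossed_hom_lift[OF \<alpha>]
    have in_S: "(\<alpha> a, a) \<in> carrier S" if "a \<in> carrier M" for a using hom_in_carrier[OF hom that] .
    have "(\<alpha> (e i), e i) [^]\<^bsub>S\<^esub> q i = \<one>\<^bsub>S\<^esub>" if i: "i < n" for i
      using hom_nat_pow[OF hom e_closed[OF i] M.is_group S.is_group, of "q i"] basis_order[OF i]
        hom_one[OF hom M.is_group S.is_group] by simp
    moreover have "(\<alpha> (e j), e j) \<in> cent S (\<alpha> (e i), e i)" if "i < n" "j < n" for i j
      using hom_mult[OF hom e_closed[OF that(1)] e_closed[OF that(2)]]
        hom_mult[OF hom e_closed[OF that(2)] e_closed[OF that(1)]]
        M.m_comm[OF e_closed[OF that(1)] e_closed[OF that(2)]] in_S[OF e_closed[OF that(2)]]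
      by (simp add: cent_def)
    ultimately show ?thesis
      using in_S e_closed unfolding com_tuples_iff len by (auto simp: nth)
  qed
  moreover have "xs \<in> (\<lambda>\<alpha>. map (\<lambda>i. (\<alpha> (e i), e i)) [0..<n]) ` crossed_homs M H act"
    if xs: "xs \<in> com_tuples S lifts" for xs
  proof -
    define x where "x i = xs ! i" for i
    have l: "length xs = n" using xs unfolding com_tuples_iff len by blast
    have xi: "x i \<in> carrier H \<times> {e i}" "x i [^]\<^bsub>S\<^esub> q i = \<one>\<^bsub>S\<^esub>" if "i < n" for i
      using xs that nth unfolding com_tuples_iff len x_def by auto
    have xS: "x i \<in> carrier S" if "i < n" for i using xi(1)[OF that] e_closed[OF that] by auto
    have comm: "x i \<otimes>\<^bsub>S\<^esub> x j = x j \<otimes>\<^bsub>S\<^esub> x i" if "i < n" "j < n" for i j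
    \<comment> \<open>The tuples record commutation only for \<open>i < j\<close>; symmetry gives
      the rest.\<close>
    proof -
      have "x j \<in> cent S (x i)" if "i < n" "j < n" "i < j" for i j
        using xs that unfolding com_tuples_iff len x_def by blast
      then show ?thesis using that by (cases i j rule: linorder_cases) (force simp: cent_def)+
    qed
    define \<phi> where "\<phi> a = pow_prod S x (\<lambda>i. \<kappa> i a) [0..<n]" for a
    have \<phi>S: "\<phi> a \<in> carrier S" for a unfolding \<phi>_def by (rule S.pow_prod_closed) (use xS in auto)
    have snd: "snd (\<phi> a) = a" if a: "a \<in> carrier M" for a
    proof -
      have "snd (\<phi> a) = pow_prod M (\<lambda>i. snd (x i)) (\<lambda>i. \<kappa> i a) [0..<n]"
        unfolding \<phi>_def by (rule S.pow_prod_hom[OF M.is_group snd_hom]) (use xS in auto)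
      also have "\<dots> = pow_prod M e (\<lambda>i. \<kappa> i a) [0..<n]"
        by (rule pow_prod_cong) (use xi(1) in force)
      finally show ?thesis using pow_prod_exponents[OF a] by simp
    qed
    have mult: "\<phi> (a \<otimes>\<^bsub>M\<^esub> b) = \<phi> a \<otimes>\<^bsub>S\<^esub> \<phi> b" if ab: "a \<in> carrier M" "b \<in> carrier M" for a b
    proof -
      have "\<phi> (a \<otimes>\<^bsub>M\<^esub> b) = pow_prod S x (\<lambda>i. \<kappa> i a + \<kappa> i b) [0..<n]"
        unfolding \<phi>_def
      proof (rule pow_prod_cong)
        fix i assume "i \<in> set [0..<n]"
        then have i: "i < n" by simp
        \<comment> \<open>\<open>\<kappa> i\<close> is additive only modulo \<open>q i\<close>, and
          the relation killing \<open>x i\<close> absorbs the difference.\<close>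
        show "x i [^]\<^bsub>S\<^esub> \<kappa> i (a \<otimes>\<^bsub>M\<^esub> b) = x i [^]\<^bsub>S\<^esub> (\<kappa> i a + \<kappa> i b)"
          using hom_mult[OF exponent_hom[OF i] ab] S.int_pow_mod[OF xS[OF i] xi(2)[OF i]] by simp
      qed
      also have "\<dots> = \<phi> a \<otimes>\<^bsub>S\<^esub> \<phi> b"
        unfolding \<phi>_def by (rule S.pow_prod_mult) (use xS comm in auto)
      finally show ?thesis .
    qed
    have basis: "\<phi> (e i) = x i" if i: "i < n" for i
    proof -
      have "\<phi> (e i) = pow_prod S x (\<lambda>j. if j = i then 1 mod int (q i) else 0) [0..<n]"
        unfolding \<phi>_def by (rule pow_prod_cong) (use i in \<open>auto simp: exponent_basis\<close>)
      also have "\<dots> = x i [^]\<^bsub>S\<^esub> (1 mod int (q i))"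
        using S.pow_prod_single[of "[0..<n]" x i "\<lambda>j. if j = i then 1 mod int (q i) else 0"] i xS by simp
      finally show ?thesis
        using S.int_pow_mod[OF xS[OF i] xi(2)[OF i], of 1] S.int_pow_1[OF xS[OF i]] by simp
    qed
    define \<alpha> where "\<alpha> = (\<lambda>a\<in>carrier M. fst (\<phi> a))"
    have \<phi>_eq: "\<phi> a = (\<alpha> a, a)" if "a \<in> carrier M" for a
      using snd[OF that] that by (simp add: \<alpha>_def prod_eq_iff)
    have "\<alpha> \<in> crossed_homs M H act"
    proof -
      have "\<alpha> (a \<otimes>\<^bsub>M\<^esub> b) = act (\<alpha> a) b \<otimes>\<^bsub>H\<^esub> \<alpha> b" if ab: "a \<in> carrier M" "b \<in> carrier M" for a b
        using mult[OF ab] ab by (simp add: \<phi>_eq)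
      moreover have "\<alpha> \<in> carrier M \<rightarrow>\<^sub>E carrier H"
        using \<phi>S by (auto simp: \<alpha>_def mem_Times_iff)
      ultimately show ?thesis by (simp add: crossed_homs_def)
    qed
    moreover have "xs = map (\<lambda>i. (\<alpha> (e i), e i)) [0..<n]"
    proof (rule nth_equalityI)
      fix i assume "i < length xs"
      then have i: "i < n" using l by simp
      show "xs ! i = map (\<lambda>i. (\<alpha> (e i), e i)) [0..<n] ! i"
        using basis[OF i] \<phi>_eq[OF e_closed[OF i]] i by (simp add: x_def)
    qed (simp add: l)
    ultimately show ?thesis by blast
  qed
  ultimately show "(\<lambda>\<alpha>. map (\<lambda>i. (\<alpha> (e i), e i)) [0..<n]) ` crossed_homs M H act = com_tuples S lifts"
    by blast
qed

theorem card_subgroup_dvd_card_crossed_homs: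
  assumes p: "prime p" and adm: "admissible p (map q [0..<n])"
    and fin: "finite (crossed_homs M H act)"
    and K: "subgroup K H" "finite K" "card K dvd prod_list (map q [0..<n])"
  shows "card K dvd card (crossed_homs M H act)"
proof -
  have snds: "map snd lifts = map q [0..<n]" by (simp add: lifts_def)
  have cosets: "\<forall>s\<in>set lifts. S.coset_in kernel (carrier S) (fst s)"
    using coset_in_kernel[OF e_closed] by (auto simp: lifts_def)
  have conj: "S.cnj g k \<in> fst s" if s: "s \<in> set lifts" and g: "g \<in> carrier S" and k: "k \<in> fst s" for s g k
  proof -
    obtain i where i: "i < n" "fst s = carrier H \<times> {e i}" using s by (auto simp: lifts_def)
    have kS: "k \<in> carrier S" using k i e_closed[OF i(1)] by auto
    have "S.cnj g k \<in> carrier S" using g kS S.m_closed S.inv_closed by blast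
    moreover have "snd k \<in> {e i}" using k unfolding i(2) by auto
    then have "snd (S.cnj g k) \<in> {e i}" unfolding snd_cnj[OF g kS] .
    ultimately show ?thesis unfolding i(2) carrier_semidirect mem_Times_iff by blast
  qed
  have fin': "finite (com_tuples S lifts)" using fin bij_betw_finite[OF crossed_homs_bij] by blast
  let ?K = "K \<times> {\<one>\<^bsub>M\<^esub>}"
  have KH: "h \<in> carrier H" if "h \<in> K" for h using that subgroup.mem_carrier[OF K(1)] by blast
  have "subgroup ?K S"
  proof
    fix x y assume "x \<in> ?K" "y \<in> ?K"
    then show "x \<otimes>\<^bsub>S\<^esub> y \<in> ?K" using KH subgroup.m_closed[OF K(1)] by auto
  next
    fix x assume "x \<in> ?K"
    then obtain h where h: "h \<in> K" "x = (h, \<one>\<^bsub>M\<^esub>)" by auto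
    have "(inv\<^bsub>H\<^esub> h, \<one>\<^bsub>M\<^esub>) \<otimes>\<^bsub>S\<^esub> x = \<one>\<^bsub>S\<^esub>" using h KH by simp
    then have "inv\<^bsub>S\<^esub> x = (inv\<^bsub>H\<^esub> h, \<one>\<^bsub>M\<^esub>)" using h KH by (intro S.inv_equality) auto
    then show "inv\<^bsub>S\<^esub> x \<in> ?K" using h subgroup.m_inv_closed[OF K(1)] by simp
  qed (use KH subgroup.one_closed[OF K(1)] in auto)
  moreover have "finite ?K" "?K \<subseteq> kernel" using K(2) KH by (auto simp: kernel_def)
  moreover have "card ?K = card K" by (simp add: card_cartesian_product)
  ultimately have "card K dvd card (com_tuples S lifts)"
    using S.card_subgroup_dvd_card_com_tuples[OF p _ kernel_normal cosets conj fin', of ?K] adm K(3)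
    by (simp add: snds)
  then show ?thesis using bij_betw_same_card[OF crossed_homs_bij] by simp
qed

end

section \<open>The group \<open>pgroup_M\<close>\<close>

lemma comm_group_pgroup_M: "comm_group (pgroup_M p n m k)"
proof -
  have "group (pgroup_M p n m k)"
    unfolding pgroup_M_def by (intro DirProd_group product_group) simp_all
  then show ?thesis
    by (rule group.group_comm_groupI) (auto simp: pgroup_M_def add.commute fun_eq_iff)
qed

lemma order_pgroup_M:
  assumes "p > 0"
  shows "order (pgroup_M p n m k) = p ^ m * (p\<^sup>2) ^ k * p ^ n"
proof -
  have "card (carrier (integer_mod_group q)) = q" if "q > 0" for q
    using that by (simp add: carrier_integer_mod_group)
  then show ?thesis
    using assms by (simp add: pgroup_M_def order_def card_cartesian_product card_PiE)
qed

text \<open>The factors are ordered so that the large cyclic one comes last, as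
  \<^const>\<open>admissible\<close> requires.\<close>

definition pgroup_M_exponent where
  "pgroup_M_exponent m k i a =
    (case a of (c, f, g) \<Rightarrow> if i < m then f i else if i < m + k then g (i - m) else c)"
  for a :: "int \<times> (nat \<Rightarrow> int) \<times> (nat \<Rightarrow> int)"

text \<open>For \<open>n = 0\<close> the cyclic factor is trivial and its generator must be
  \<open>0\<close>, hence \<open>1 mod int (p ^ n)\<close>. The other factors have order greater
  than 1 for prime \<open>p\<close>, so there \<open>1\<close> is already reduced.\<close>

definition pgroup_M_basis :: "nat \<Rightarrow> nat \<Rightarrow> nat \<Rightarrow> nat \<Rightarrow> nat \<Rightarrow> int \<times> (nat \<Rightarrow> int) \<times> (nat \<Rightarrow> int)" where
  "pgroup_M_basis p n m k i =
    (if i = m + k then 1 mod int (p ^ n) else 0,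
     \<lambda>j\<in>{..<m}. if j = i then 1 else 0, \<lambda>j\<in>{..<k}. if m + j = i then 1 else 0)"

definition pgroup_M_orders :: "nat \<Rightarrow> nat \<Rightarrow> nat \<Rightarrow> nat \<Rightarrow> nat \<Rightarrow> nat" where
  "pgroup_M_orders p n m k i = (if i < m then p else if i < m + k then p\<^sup>2 else p ^ n)"

lemma map_pgroup_M_orders:
  "map (pgroup_M_orders p n m k) [0..<Suc (m + k)] = replicate m p @ replicate k (p\<^sup>2) @ [p ^ n]"
  by (rule nth_equalityI) (auto simp: pgroup_M_orders_def nth_append simp del: upt_Suc)

lemma admissible_pgroup_M_orders:
  "admissible p (map (pgroup_M_orders p n m k) [0..<Suc (m + k)])"
proof -
  have "admissible p (replicate k (p\<^sup>2) @ [p ^ n])"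
    by (induction k) (auto intro: admissible.intros)
  then have "admissible p (replicate m p @ replicate k (p\<^sup>2) @ [p ^ n])"
    by (induction m) (auto intro: admissible.intros)
  then show ?thesis unfolding map_pgroup_M_orders .
qed

lemma automorphism_action_basis_pgroup_M:
  assumes p: "prime p" and H: "group H" and act: "right_action_by_automorphisms (pgroup_M p n m k) H act"
  shows "automorphism_action_basis (pgroup_M p n m k) H act (Suc (m + k))
    (pgroup_M_orders p n m k) (pgroup_M_basis p n m k) (pgroup_M_exponent m k)"
proof -
  have p1: "p > 1" using p prime_gt_1_nat by blast
  then have p2: "1 < (int p)\<^sup>2" by (simp add: power2_eq_square less_1_mult)
  interpret automorphism_action "pgroup_M p n m k" H act
    by (intro automorphism_action.intro automorphism_action_axioms.intro comm_group_pgroup_M H act)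
  show ?thesis
  proof
    fix i :: nat assume i: "i < Suc (m + k)"
    show "0 < pgroup_M_orders p n m k i" using p1 by (simp add: pgroup_M_orders_def)
    show "pgroup_M_basis p n m k i \<in> carrier (pgroup_M p n m k)"
      using p1 p2 by (auto simp: pgroup_M_basis_def pgroup_M_def carrier_integer_mod_group)
    show "pgroup_M_exponent m k i \<in> hom (pgroup_M p n m k) (integer_mod_group (pgroup_M_orders p n m k i))"
      using i p1 by (intro homI)
        (auto simp: pgroup_M_exponent_def pgroup_M_orders_def pgroup_M_def carrier_integer_mod_group PiE_iff)
    fix j assume "j < Suc (m + k)"
    then show "pgroup_M_exponent m k i (pgroup_M_basis p n m k j) =
        (if i = j then 1 mod int (pgroup_M_orders p n m k i) else 0)"
      using i p1 p2 by (auto simp: pgroup_M_exponent_def pgroup_M_orders_def pgroup_M_basis_def)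
  next
    fix a b assume a: "a \<in> carrier (pgroup_M p n m k)" and b: "b \<in> carrier (pgroup_M p n m k)"
      and eq: "\<And>i. i < Suc (m + k) \<Longrightarrow> pgroup_M_exponent m k i a = pgroup_M_exponent m k i b"
    obtain c f g c' f' g' where abs: "a = (c, f, g)" "b = (c', f', g')" by (cases a; cases b)
    have "c = c'" using eq[of "m + k"] by (simp add: abs pgroup_M_exponent_def)
    moreover have "f = f'"
    proof (rule PiE_ext)
      show "f \<in> PiE {..<m} (\<lambda>_. carrier (integer_mod_group p))"
        "f' \<in> PiE {..<m} (\<lambda>_. carrier (integer_mod_group p))"
        using a b by (simp_all add: abs pgroup_M_def)
      show "f i = f' i" if "i \<in> {..<m}" for i
        using eq[of i] that by (simp add: abs pgroup_M_exponent_def)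
    qed
    moreover have "g = g'"
    proof (rule PiE_ext)
      show "g \<in> PiE {..<k} (\<lambda>_. carrier (integer_mod_group (p\<^sup>2)))"
        "g' \<in> PiE {..<k} (\<lambda>_. carrier (integer_mod_group (p\<^sup>2)))"
        using a b by (simp_all add: abs pgroup_M_def)
      show "g i = g' i" if "i \<in> {..<k}" for i
        using eq[of "m + i"] that by (simp add: abs pgroup_M_exponent_def)
    qed
    ultimately show "a = b" by (simp add: abs)
  qed
qed

theorem theorem4p1:
  fixes p n m k :: nat
    and H :: "('h, 'z) monoid_scheme"
    and act :: "'h \<Rightarrow> int \<times> (nat \<Rightarrow> int) \<times> (nat \<Rightarrow> int) \<Rightarrow> 'h"
  assumes "prime p"
    and "group H"
    and "right_action_by_automorphisms (pgroup_M p n m k) H act"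
  shows "cardinality_dvd {..<group_gcd H (order (pgroup_M p n m k))}
           (crossed_homs (pgroup_M p n m k) H act)"
proof -
  interpret automorphism_action_basis "pgroup_M p n m k" H act "Suc (m + k)"
    "pgroup_M_orders p n m k" "pgroup_M_basis p n m k" "pgroup_M_exponent m k"
    by (rule automorphism_action_basis_pgroup_M) fact+
  let ?M = "pgroup_M p n m k"
  define d where "d = group_gcd H (order ?M)"
  have p0: "p > 0" using assms(1) prime_gt_0_nat by blast
  have orders: "prod_list (map (pgroup_M_orders p n m k) [0..<Suc (m + k)]) = order ?M"
    unfolding map_pgroup_M_orders order_pgroup_M[OF p0] by simp
  \<comment> \<open>The least common multiple of divisors of a nonzero number is nonzero; the
    infinite case needs this, since zero does not divide an infinite cardinal.\<close>
  have "d dvd order ?M" unfolding d_def group_gcd_def by (rule Lcm_least) auto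
  moreover have "order ?M \<noteq> 0" using p0 by (simp add: order_pgroup_M)
  ultimately have "d > 0" by (metis dvd_0_left_iff gr0I)
  show ?thesis
  proof (cases "finite (crossed_homs ?M H act)")
    case True
    have "d dvd card (crossed_homs ?M H act)"
      unfolding d_def group_gcd_def
    proof (rule Lcm_least)
      fix c assume "c \<in> {card K |K. subgroup K H \<and> finite K \<and> card K dvd order ?M}"
      then obtain K where "c = card K" "subgroup K H" "finite K" "card K dvd order ?M" by blast
      then show "c dvd card (crossed_homs ?M H act)"
        using card_subgroup_dvd_card_crossed_homs[OF assms(1) admissible_pgroup_M_orders True, of K] orders
        by simp
    qed
    then show ?thesis using True by (simp add: cardinality_dvd_def d_def)
  next
    case False
    \<comment> \<open>An infinite set of crossed homomorphisms admits an injection from any finite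
      set, so here only \<open>d > 0\<close> matters.\<close>
    then have "{..<d} \<lesssim> crossed_homs ?M H act" by (intro finite_lepoll_infinite) auto
    then show ?thesis using False \<open>d > 0\<close> by (auto simp: cardinality_dvd_def d_def)
  qed
qed

end
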